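(* Let $N\in\mathbb Z$, $T(u)=\sum_\lambda\Phi^*_\lambda(u)\Phi_\lambda(u)$ (sum over all partitions), $M\ge1$, $u_1,\dots,u_M\in\mathbb C^\times$, $u_{i,j}=u_i/u_j$, and $\mathfrak q_M=\mathfrak q\,p^{-(M-1)}$ with $\mathfrak q=p^{*-1}p^{N-1}(t/q)^{1/2}$. Then the vacuum expectation value (the instanton partition function of the 5d lift of the 4d $\mathcal N=2^*$ $U(M)$ theory) is $$\langle0|T(u_1)\cdots T(u_M)|0\rangle=\mathcal C_M\sum_{k=0}^\infty\mathfrak q_M^k\,\chi_p(\mathfrak M_{k,M}),\qquad\chi_p(\mathfrak M_{k,M})=\sum_{\substack{\lambda^{(1)},\dots,\lambda^{(M)}\\\sum_j|\lambda^{(j)}|=k}}\prod_{i,j=1}^M\frac{N_{\lambda^{(i)}\lambda^{(j)}}(pqu_{i,j}/t)}{N_{\lambda^{(i)}\lambda^{(j)}}(qu_{i,j}/t)},$$ $$\mathcal C_M=\Big(\frac{(p^{-1}t;q,t,p)_\infty}{(q;q,t,p)_\infty}\Big)^M\prod_{1\le i<j\le M}\frac{(p^{-1}tu_{j,i};q,t)_\infty(pqu_{j,i};q,t)_\infty}{(tu_{j,i};q,t)_\infty(qu_{j,i};q,t)_\infty}.$$ Furthermore, with $u_1v_1=u_2v_2=\cdots=u_Mv_M$ for arbitrary $v_1,\dots,v_M\in\mathbb C^\times$, the trace (the instanton partition function of the 6d lift) is $$\mathrm{tr}_{\mathcal F^{(1,N+1)}_{-u_1v_1}}Q^{d}\,T(u_1)\cdots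 T(u_M)=\mathcal C_{Q,M}\sum_{k=0}^\infty\mathfrak q_M^k\,\mathcal E_{p,Q}(\mathfrak M_{k,M}),\qquad\mathcal E_{p,Q}(\mathfrak M_{k,M})=\sum_{\substack{\lambda^{(1)},\dots,\lambda^{(M)}\\\sum_j|\lambda^{(j)}|=k}}\prod_{i,j=1}^M\frac{N^\theta_{\lambda^{(i)}\lambda^{(j)}}(pqu_{i,j}/t;Q)}{N^\theta_{\lambda^{(i)}\lambda^{(j)}}(qu_{i,j}/t;Q)},$$ $$\mathcal C_{Q,M}=\frac{1}{(Q;Q)_\infty}\Big(\frac{(t;q,t)_\infty\Gamma_3(p^{-1}t;q,t,Q)}{(p^{-1}t;q,t)_\infty\Gamma_3(t;q,t,Q)}\Big)^M\prod_{1\le i<j\le M}\frac{\Gamma_3(p^{-1}tu_{j,i};q,t,Q)\Gamma_3(pqu_{j,i};q,t,Q)}{\Gamma_3(tu_{j,i};q,t,Q)\Gamma_3(qu_{j,i};q,t,Q)}.$$ Here $\chi_p(\mathfrak M_{k,M})$ and $\mathcal E_{p,Q}(\mathfrak M_{k,M})$ give respectively the equivariant $\chi_y$ genus ($y=p$) and the equivariant elliptic genus of the moduli space $\mathfrak M_{k,M}$ of rank $M$ instantons with charge $k$.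
   Context: $q,t,p,Q$ generic complex numbers with $|q|,|t|,|p|,|pq/t|,|Q|<1$; $\kappa_m=(1-q^m)(1-t^{-m})(1-(t/q)^m)$, $p^*=pq/t$; $(z;p_1,\dots,p_r)_\infty=\prod_{n_1,\dots,n_r\ge0}(1-zp_1^{n_1}\cdots p_r^{n_r})$; $\theta_Q(z)=(z;Q)_\infty(Q/z;Q)_\infty$; $\Gamma_3(z;p_1,p_2,p_3)=(z;p_1,p_2,p_3)_\infty(p_1p_2p_3/z;p_1,p_2,p_3)_\infty$. The level $(1,N)$ Fock spaces $\mathcal F^{(1,N)}_u$ are all copies of $\mathbb C[\alpha'_{-m}\,(m>0)]|0\rangle$ with $[\alpha'_m,\alpha'_n]=-\frac{\kappa_m}{m}((t/q)^m-1)\frac{1-p^{*m}}{1-p^m}\delta_{m+n,0}$, $\alpha'_m|0\rangle=0$ ($m>0$); oscillator operators act between differently labelled Fock spaces by identifying vacua; $\langle0|\cdot|0\rangle$ is the vacuum expectation value with $\langle0|0\rangle=1$. The degree counting operator is $d=-\sum_{m>0}\frac{m^2}{\kappa_m(1-(t/q)^m)}\frac{1-p^m}{1-p^{*m}}\alpha'_{-m}\alpha'_m$, which satisfies $[d,\alpha'_m]=m\alpha'_m$ ($m\neq0$). $:\ :$ is normal ordering; products of vertex operators are given by their normal-ordering formulas with scalar coefficients understood by analytic continuation, and sums over partitions as formal sums. For a partition $\lambda$, $|\lambda|=\sum\lambda_i$, $n(\lambda)=\sum_i(i-1)\lambda_i$, $n(\lambda')=\sum_i\lambda_i(\lambda_i-1)/2$;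 for a box $\square=(i,j)$ put $a_\lambda(\square)=\lambda_i-j$, $\ell_\lambda(\square)=\lambda'_j-i$; $c_\lambda=\prod_{\square\in\lambda}(1-q^{a_\lambda(\square)}t^{\ell_\lambda(\square)+1})$, $c'_\lambda=\prod_{\square\in\lambda}(1-q^{a_\lambda(\square)+1}t^{\ell_\lambda(\square)})$, $N_\lambda(p)=\prod_{\square\in\lambda}\frac{(pq^{a_\lambda(\square)+1}t^{\ell_\lambda(\square)};p)_\infty}{(pq^{a_\lambda(\square)}t^{\ell_\lambda(\square)+1};p)_\infty}$, $N'_\lambda(p)=\prod_{\square\in\lambda}\frac{(pq^{-a_\lambda(\square)}t^{-\ell_\lambda(\square)-1};p)_\infty}{(pq^{-a_\lambda(\square)-1}t^{-\ell_\lambda(\square)};p)_\infty}$, $f_\lambda(q,t)=(-1)^{|\lambda|}q^{n(\lambda')+|\lambda|/2}t^{-n(\lambda)-|\lambda|/2}$, $t^*(\lambda,u,v,N)=(q^{-1}v)^{-|\lambda|}(-u)^{N|\lambda|}f_\lambda(q,t)^N$, $t(\lambda,u,v,N)=(-uv)^{|\lambda|}(-v)^{-(N+1)|\lambda|}f_\lambda(q,t)^{-N-1}$. Vertex operators: $\widetilde\Phi_\lambda(u)=:\exp\big(\sum_{m\ne0}\frac{1-t^m}{\kappa_m}\mathcal E_{\lambda,m}\alpha'_m((t/q)^{1/2}u)^{-m}\big):$, $\mathcal E_{\lambda,m}=\frac1{1-t^m}+\sum_{j=1}^{\ell(\lambda)}(q^{-m\lambda_j}-1)t^{m(j-1)}$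 ($\ell(\lambda)$ the length of $\lambda$), $\Phi_\lambda(u)=\frac{q^{n(\lambda')}N_\lambda(p)t^*(\lambda,u,v,N)}{c_\lambda}\widetilde\Phi_\lambda(u)$ from $\mathcal F^{(1,N+1)}_{-uv}$ to $\mathcal F^{(1,N)}_v$, $\Phi^*_\lambda(u)=\frac{q^{n(\lambda')}N'_\lambda(p)t(\lambda,v,p^{-1}u,N)}{c'_\lambda}:\widetilde\Phi_\lambda(p^{-1}u)^{-1}:$ from $\mathcal F^{(1,N)}_v$ to $\mathcal F^{(1,N+1)}_{-uv}$, with $v\in\mathbb C^\times$ arbitrary (for $T(u_i)$ the parameter $v$ is $v_i$). Nekrasov functions: $N_{\lambda\mu}(x)=\prod_{\square\in\lambda}(1-xq^{-a_\mu(\square)-1}t^{-\ell_\lambda(\square)})\prod_{\blacksquare\in\mu}(1-xq^{a_\lambda(\blacksquare)}t^{\ell_\mu(\blacksquare)+1})$, and $N^\theta_{\lambda\mu}(x;Q)$ is the same product with each factor $1-y$ replaced by $\theta_Q(y)$.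
   Formalization: Corrected: the first factor of C_M is ((pt;q,t,p)/(p^2 q;q,t,p))^M; C_{Q,M} also carries this factor; 𝔮 has p* in place of p*^{-1}; the trace uses Q^{-d}, as tr Q^d diverges. u_i/u_j (i≠j) avoids q^Z t^Z (trace: q^Z t^Z Q^Z). The closing remark on genera is not covered. *)

theory Defs
  imports
    "HOL-Complex_Analysis.Complex_Analysis"
    "HOL-Library.Multiset"
    "HOL-Library.FuncSet"
begin

section \<open>Infinite products\<close>

text \<open>\<open>qpoch z [p\<^sub>1,\<dots>,p\<^sub>r]\<close> is \<open>(z;p\<^sub>1,\<dots>,p\<^sub>r)\<^sub>\<infinity>\<close>. The product over \<open>\<nat>\<^sup>r\<close> converges absolutely
  when all \<open>|p\<^sub>i| < 1\<close>, so it may be iterated.\<close>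

fun qpoch :: "complex \<Rightarrow> complex list \<Rightarrow> complex" where
  "qpoch z [] = 1 - z"
| "qpoch z (b # bs) = (\<Prod>n. qpoch (z * b ^ n) bs)"

definition theta :: "complex \<Rightarrow> complex \<Rightarrow> complex" where
  "theta Q z = qpoch z [Q] * qpoch (Q / z) [Q]"

definition Gamma3 :: "complex \<Rightarrow> complex \<Rightarrow> complex \<Rightarrow> complex \<Rightarrow> complex" where
  "Gamma3 z a b c = qpoch z [a, b, c] * qpoch (a * b * c / z) [a, b, c]"

section \<open>Partitions\<close>

definition is_partition :: "nat list \<Rightarrow> bool" where
  "is_partition \<xi> \<longleftrightarrow> sorted_wrt (\<ge>) \<xi> \<and> 0 \<notin> set \<xi>"

text \<open>Parts are numbered from 1, and \<open>\<xi>\<^sub>i = 0\<close> beyond the length.\<close>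

definition part :: "nat list \<Rightarrow> nat \<Rightarrow> nat" where
  "part \<xi> i = (if 1 \<le> i \<and> i \<le> length \<xi> then \<xi> ! (i - 1) else 0)"

definition conj_part :: "nat list \<Rightarrow> nat \<Rightarrow> nat" where
  "conj_part \<xi> j = card {i. 1 \<le> i \<and> i \<le> length \<xi> \<and> j \<le> part \<xi> i}"

definition boxes :: "nat list \<Rightarrow> (nat \<times> nat) set" where
  "boxes \<xi> = (SIGMA i : {1..length \<xi>}. {1..part \<xi> i})"

text \<open>The box need not belong to \<open>\<xi>\<close>, so arm and leg lengths may be negative.\<close>

definition arm :: "nat list \<Rightarrow> nat \<times> nat \<Rightarrow> int" where
  "arm \<xi> s = int (part \<xi> (fst s)) - int (snd s)"

definition leg :: "nat list \<Rightarrow> nat \<times> nat \<Rightarrow> int" where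
  "leg \<xi> s = int (conj_part \<xi> (snd s)) - int (fst s)"

definition n_stat :: "nat list \<Rightarrow> nat" where
  "n_stat \<xi> = (\<Sum>i = 1..length \<xi>. (i - 1) * part \<xi> i)"

definition n_stat_conj :: "nat list \<Rightarrow> nat" where
  "n_stat_conj \<xi> = (\<Sum>i = 1..length \<xi>. part \<xi> i * (part \<xi> i - 1) div 2)"

definition c_part :: "complex \<Rightarrow> complex \<Rightarrow> nat list \<Rightarrow> complex" where
  "c_part q t \<xi> = (\<Prod>s\<in>boxes \<xi>. 1 - q powi arm \<xi> s * t powi (leg \<xi> s + 1))"

definition c_part' :: "complex \<Rightarrow> complex \<Rightarrow> nat list \<Rightarrow> complex" where
  "c_part' q t \<xi> = (\<Prod>s\<in>boxes \<xi>. 1 - q powi (arm \<xi> s + 1) * t powi leg \<xi> s)"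

definition N_part :: "complex \<Rightarrow> complex \<Rightarrow> complex \<Rightarrow> nat list \<Rightarrow> complex" where
  "N_part q t p \<xi> = (\<Prod>s\<in>boxes \<xi>.
     qpoch (p * q powi (arm \<xi> s + 1) * t powi leg \<xi> s) [p] /
     qpoch (p * q powi arm \<xi> s * t powi (leg \<xi> s + 1)) [p])"

definition N_part' :: "complex \<Rightarrow> complex \<Rightarrow> complex \<Rightarrow> nat list \<Rightarrow> complex" where
  "N_part' q t p \<xi> = (\<Prod>s\<in>boxes \<xi>.
     qpoch (p * q powi (- arm \<xi> s) * t powi (- leg \<xi> s - 1)) [p] /
     qpoch (p * q powi (- arm \<xi> s - 1) * t powi (- leg \<xi> s)) [p])"

text \<open>Throughout, \<open>r\<close> is a fixed square root of \<open>t/q\<close>; the half-integer powers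
  \<open>q\<^bsup>|\<xi>|/2\<^esup> t\<^bsup>-|\<xi>|/2\<^esup>\<close> and \<open>(t/q)\<^bsup>1/2\<^esup>\<close> are taken with this one choice.\<close>

definition framing :: "complex \<Rightarrow> complex \<Rightarrow> complex \<Rightarrow> nat list \<Rightarrow> complex" where
  "framing q t r \<xi> =
     (-1) ^ sum_list \<xi> * q ^ n_stat_conj \<xi> * t powi (- int (n_stat \<xi>)) * r powi (- int (sum_list \<xi>))"

definition t_star :: "complex \<Rightarrow> complex \<Rightarrow> complex \<Rightarrow> nat list \<Rightarrow> complex \<Rightarrow> complex \<Rightarrow> int \<Rightarrow> complex" where
  "t_star q t r \<xi> u v N =
     (v / q) powi (- int (sum_list \<xi>)) * (- u) powi (N * int (sum_list \<xi>)) * framing q t r \<xi> powi N"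

definition t_plain :: "complex \<Rightarrow> complex \<Rightarrow> complex \<Rightarrow> nat list \<Rightarrow> complex \<Rightarrow> complex \<Rightarrow> int \<Rightarrow> complex" where
  "t_plain q t r \<xi> u v N =
     (- u * v) ^ sum_list \<xi> * (- v) powi (- (N + 1) * int (sum_list \<xi>)) * framing q t r \<xi> powi (- N - 1)"

section \<open>Nekrasov functions\<close>

text \<open>\<open>nek (\<lambda>y. 1 - y)\<close> is \<open>N\<^sub>\<xi>\<^sub>\<mu>(x)\<close> and \<open>nek (theta Q)\<close> is its theta version.\<close>

definition nek :: "(complex \<Rightarrow> complex) \<Rightarrow> complex \<Rightarrow> complex \<Rightarrow> nat list \<Rightarrow> nat list \<Rightarrow> complex \<Rightarrow> complex" where
  "nek g q t \<xi> \<mu> x =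
     (\<Prod>s\<in>boxes \<xi>. g (x * q powi (- arm \<mu> s - 1) * t powi (- leg \<xi> s))) *
     (\<Prod>s\<in>boxes \<mu>. g (x * q powi arm \<xi> s * t powi (leg \<mu> s + 1)))"

definition partition_tuples :: "nat \<Rightarrow> nat \<Rightarrow> (nat \<Rightarrow> nat list) set" where
  "partition_tuples M k =
     {\<Lambda> \<in> {1..M} \<rightarrow>\<^sub>E Collect is_partition. (\<Sum>j = 1..M. sum_list (\<Lambda> j)) = k}"

definition nek_sum :: "(complex \<Rightarrow> complex) \<Rightarrow> complex \<Rightarrow> complex \<Rightarrow> complex \<Rightarrow> nat \<Rightarrow> (nat \<Rightarrow> complex) \<Rightarrow> nat \<Rightarrow> complex" where
  "nek_sum g q t p M u k = (\<Sum>\<Lambda>\<in>partition_tuples M k. \<Prod>i = 1..M. \<Prod>j = 1..M.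
     nek g q t (\<Lambda> i) (\<Lambda> j) (p * q * (u i / u j) / t) / nek g q t (\<Lambda> i) (\<Lambda> j) (q * (u i / u j) / t))"

definition chi_genus :: "complex \<Rightarrow> complex \<Rightarrow> complex \<Rightarrow> nat \<Rightarrow> (nat \<Rightarrow> complex) \<Rightarrow> nat \<Rightarrow> complex" where
  "chi_genus q t p M u k = nek_sum (\<lambda>y. 1 - y) q t p M u k"

definition elliptic_genus :: "complex \<Rightarrow> complex \<Rightarrow> complex \<Rightarrow> complex \<Rightarrow> nat \<Rightarrow> (nat \<Rightarrow> complex) \<Rightarrow> nat \<Rightarrow> complex" where
  "elliptic_genus q t p Q M u k = nek_sum (theta Q) q t p M u k"

section \<open>Fock space and oscillators\<close>

text \<open>The monomial \<open>\<alpha>'\<^sub>-\<^sub>m\<^sub>1 \<cdots> \<alpha>'\<^sub>-\<^sub>m\<^sub>k |0>\<close> is indexed by the multiset \<open>{m\<^sub>1,\<dots>,m\<^sub>k}\<close> of positive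
  integers. A vector is its coefficient function; finitely supported functions form the Fock space,
  arbitrary ones its completion, in which vertex operators take their values. All the level
  \<open>(1,N)\<close> Fock spaces are identified with this one, and their labels are not recorded.\<close>

type_synonym fock = "nat multiset \<Rightarrow> complex"

definition fock_basis :: "nat multiset set" where
  "fock_basis = {\<mu>. 0 \<notin># \<mu>}"

definition ket :: "nat multiset \<Rightarrow> fock" where
  "ket \<mu> = (\<lambda>\<nu>. if \<nu> = \<mu> then 1 else 0)"

definition kappa :: "complex \<Rightarrow> complex \<Rightarrow> int \<Rightarrow> complex" where
  "kappa q t m = (1 - q powi m) * (1 - t powi (- m)) * (1 - (t / q) powi m)"

definition pstar :: "complex \<Rightarrow> complex \<Rightarrow> complex \<Rightarrow> complex" where
  "pstar q t p = p * q / t"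

text \<open>\<open>comm q t p m\<close> is the value of \<open>[\<alpha>'\<^sub>m, \<alpha>'\<^sub>-\<^sub>m]\<close>.\<close>

definition comm :: "complex \<Rightarrow> complex \<Rightarrow> complex \<Rightarrow> int \<Rightarrow> complex" where
  "comm q t p m = - (kappa q t m / of_int m) * ((t / q) powi m - 1) *
     ((1 - pstar q t p powi m) / (1 - p powi m))"

text \<open>\<open>\<alpha>'\<^sub>-\<^sub>m\<close> multiplies by a variable; \<open>\<alpha>'\<^sub>m\<close> (\<open>m > 0\<close>) is \<open>comm m\<close> times the derivative with
  respect to that variable. There is no zero mode.\<close>

definition osc :: "complex \<Rightarrow> complex \<Rightarrow> complex \<Rightarrow> int \<Rightarrow> fock \<Rightarrow> fock" where
  "osc q t p m f = (\<lambda>\<mu>.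
     if m > 0 then comm q t p m * of_nat (count \<mu> (nat m) + 1) * f (add_mset (nat m) \<mu>)
     else if m < 0 \<and> nat (- m) \<in># \<mu> then f (\<mu> - {#nat (- m)#})
     else 0)"

definition op_exp :: "(fock \<Rightarrow> fock) \<Rightarrow> fock \<Rightarrow> fock" where
  "op_exp A f = (\<lambda>\<mu>. \<Sum>k. (A ^^ k) f \<mu> / fact k)"

text \<open>With this sign one has \<open>[d, \<alpha>'\<^sub>m] = m \<alpha>'\<^sub>m\<close>, hence \<open>d\<close> is minus the degree on the Fock space:
  a monomial indexed by \<open>\<mu>\<close> has eigenvalue \<open>- sum_mset \<mu>\<close>.\<close>

definition degree_op :: "complex \<Rightarrow> complex \<Rightarrow> complex \<Rightarrow> fock \<Rightarrow> fock" where
  "degree_op q t p f = (\<lambda>\<mu>. - (\<Sum>n. let m = int (Suc n) in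
     of_int (m\<^sup>2) / (kappa q t m * (1 - (t / q) powi m)) * ((1 - p powi m) / (1 - pstar q t p powi m)) *
     osc q t p (- m) (osc q t p m f) \<mu>))"

text \<open>\<open>x\<^sup>D\<close> for a diagonal operator \<open>D\<close> with integer eigenvalues (so the branch of \<open>Ln\<close> is
  immaterial).\<close>

definition op_power :: "complex \<Rightarrow> (fock \<Rightarrow> fock) \<Rightarrow> fock \<Rightarrow> fock" where
  "op_power x D = op_exp (\<lambda>f \<mu>. Ln x * D f \<mu>)"

definition fock_trace :: "(fock \<Rightarrow> fock) \<Rightarrow> complex" where
  "fock_trace A = (\<Sum>\<^sub>\<infinity>\<mu>\<in>fock_basis. A (ket \<mu>) \<mu>)"

section \<open>Vertex operators\<close>

text \<open>Value at \<open>z\<close> of the meromorphic continuation to the domain \<open>D\<close> of a function given near the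
  origin (\<open>D\<close> is the plane or a disc about 0, so the continuation is unique).\<close>

definition mero_cont :: "complex set \<Rightarrow> (complex \<Rightarrow> complex) \<Rightarrow> complex \<Rightarrow> complex" where
  "mero_cont D f z = (THE w. \<exists>F. F meromorphic_on D \<and> (\<forall>\<^sub>F x in at 0. F x = f x) \<and>
     F analytic_on {z} \<and> F z = w)"

text \<open>\<open>VOp c a\<close> stands for \<open>c :exp (\<Sum>m\<noteq>0. a\<^sub>m \<alpha>'\<^sub>m):\<close>.\<close>

datatype vop = VOp (vscalar: complex) (vmodes: "int \<Rightarrow> complex")

definition vop_apply :: "complex \<Rightarrow> complex \<Rightarrow> complex \<Rightarrow> vop \<Rightarrow> fock \<Rightarrow> fock" where
  "vop_apply q t p X f = (\<lambda>\<mu>. vscalar X *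
     op_exp (\<lambda>g \<nu>. \<Sum>n. vmodes X (- int (Suc n)) * osc q t p (- int (Suc n)) g \<nu>)
      (op_exp (\<lambda>g \<nu>. \<Sum>n. vmodes X (int (Suc n)) * osc q t p (int (Suc n)) g \<nu>) f) \<mu>)"

text \<open>Moving the annihilation part of the left factor through the creation part of the right one
  gives \<open>exp (\<Sum>m>0. a\<^sub>m b\<^sub>-\<^sub>m [\<alpha>'\<^sub>m, \<alpha>'\<^sub>-\<^sub>m])\<close>. The variable \<open>z\<close> rescales the ratio of the spectral
  parameter of the right factor to that of the left one; the series converges for small \<open>z\<close>, and
  the coefficient is its meromorphic continuation to \<open>z = 1\<close>.\<close>

definition contraction :: "complex \<Rightarrow> complex \<Rightarrow> complex \<Rightarrow> (int \<Rightarrow> complex) \<Rightarrow> (int \<Rightarrow> complex) \<Rightarrow> complex" where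
  "contraction q t p a b = mero_cont UNIV
     (\<lambda>z. exp (\<Sum>n. a (int (Suc n)) * b (- int (Suc n)) * comm q t p (int (Suc n)) * z ^ Suc n)) 1"

definition vop_mult :: "complex \<Rightarrow> complex \<Rightarrow> complex \<Rightarrow> vop \<Rightarrow> vop \<Rightarrow> vop" where
  "vop_mult q t p X Y = VOp (vscalar X * vscalar Y * contraction q t p (vmodes X) (vmodes Y))
     (\<lambda>m. vmodes X m + vmodes Y m)"

definition E_mode :: "complex \<Rightarrow> complex \<Rightarrow> nat list \<Rightarrow> int \<Rightarrow> complex" where
  "E_mode q t \<xi> m = 1 / (1 - t powi m) +
     (\<Sum>j = 1..length \<xi>. (q powi (- m * int (part \<xi> j)) - 1) * t powi (m * (int j - 1)))"

definition Phi_modes :: "complex \<Rightarrow> complex \<Rightarrow> complex \<Rightarrow> nat list \<Rightarrow> complex \<Rightarrow> int \<Rightarrow> complex" where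
  "Phi_modes q t r \<xi> u m = (1 - t powi m) / kappa q t m * E_mode q t \<xi> m * (r * u) powi (- m)"

definition Phi :: "complex \<Rightarrow> complex \<Rightarrow> complex \<Rightarrow> complex \<Rightarrow> int \<Rightarrow> nat list \<Rightarrow> complex \<Rightarrow> complex \<Rightarrow> vop" where
  "Phi q t p r N \<xi> u v =
     VOp (q ^ n_stat_conj \<xi> * N_part q t p \<xi> * t_star q t r \<xi> u v N / c_part q t \<xi>)
         (Phi_modes q t r \<xi> u)"

definition Phi_dual :: "complex \<Rightarrow> complex \<Rightarrow> complex \<Rightarrow> complex \<Rightarrow> int \<Rightarrow> nat list \<Rightarrow> complex \<Rightarrow> complex \<Rightarrow> vop" where
  "Phi_dual q t p r N \<xi> u v =
     VOp (q ^ n_stat_conj \<xi> * N_part' q t p \<xi> * t_plain q t r \<xi> v (u / p) N / c_part' q t \<xi>)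
         (\<lambda>m. - Phi_modes q t r \<xi> (u / p) m)"

text \<open>\<open>T(u)\<close> is the formal sum of the operators \<open>T_term \<xi> u\<close> over all partitions \<open>\<xi>\<close>, and
  \<open>T(u\<^sub>1)\<cdots>T(u\<^sub>M)\<close> that of \<open>T_product \<Lambda>\<close> over all \<open>M\<close>-tuples of partitions.\<close>

definition T_term :: "complex \<Rightarrow> complex \<Rightarrow> complex \<Rightarrow> complex \<Rightarrow> int \<Rightarrow> nat list \<Rightarrow> complex \<Rightarrow> complex \<Rightarrow> vop" where
  "T_term q t p r N \<xi> u v = vop_mult q t p (Phi_dual q t p r N \<xi> u v) (Phi q t p r N \<xi> u v)"

definition T_product :: "complex \<Rightarrow> complex \<Rightarrow> complex \<Rightarrow> complex \<Rightarrow> int \<Rightarrow> nat \<Rightarrow>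
    (nat \<Rightarrow> complex) \<Rightarrow> (nat \<Rightarrow> complex) \<Rightarrow> (nat \<Rightarrow> nat list) \<Rightarrow> vop" where
  "T_product q t p r N M u v \<Lambda> =
     foldr (\<lambda>i. vop_mult q t p (T_term q t p r N (\<Lambda> i) (u i) (v i))) [1..<Suc M] (VOp 1 (\<lambda>m. 0))"

definition vop_vev :: "complex \<Rightarrow> complex \<Rightarrow> complex \<Rightarrow> vop \<Rightarrow> complex" where
  "vop_vev q t p X = vop_apply q t p X (ket {#}) {#}"

text \<open>The trace of a vertex operator weighted by \<open>x\<^bsup>degree\<^esup>\<close>, i.e. by \<open>x\<^bsup>-d\<^esup>\<close>: with the sign of
  \<open>d\<close> above, \<open>x\<^sup>d\<close> has the eigenvalues \<open>x\<^bsup>-n\<^esup>\<close> and no trace for \<open>|x| < 1\<close>. For a given vertex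
  operator the trace converges for small \<open>x\<close>; it is continued to the unit disc.\<close>

definition vop_trace :: "complex \<Rightarrow> complex \<Rightarrow> complex \<Rightarrow> complex \<Rightarrow> vop \<Rightarrow> complex" where
  "vop_trace q t p Q X = mero_cont (ball 0 1)
     (\<lambda>x. fock_trace (\<lambda>f. op_power x (\<lambda>g \<mu>. - degree_op q t p g \<mu>) (vop_apply q t p X f))) Q"

text \<open>Formal sums over tuples of partitions are power series in a variable counting the total
  number of boxes.\<close>

definition vev_series :: "complex \<Rightarrow> complex \<Rightarrow> complex \<Rightarrow> complex \<Rightarrow> int \<Rightarrow> nat \<Rightarrow>
    (nat \<Rightarrow> complex) \<Rightarrow> (nat \<Rightarrow> complex) \<Rightarrow> complex fps" where
  "vev_series q t p r N M u v =
     Abs_fps (\<lambda>k. \<Sum>\<Lambda>\<in>partition_tuples M k. vop_vev q t p (T_product q t p r N M u v \<Lambda>))"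

definition trace_series :: "complex \<Rightarrow> complex \<Rightarrow> complex \<Rightarrow> complex \<Rightarrow> complex \<Rightarrow> int \<Rightarrow> nat \<Rightarrow>
    (nat \<Rightarrow> complex) \<Rightarrow> (nat \<Rightarrow> complex) \<Rightarrow> complex fps" where
  "trace_series q t p r Q N M u v =
     Abs_fps (\<lambda>k. \<Sum>\<Lambda>\<in>partition_tuples M k. vop_trace q t p Q (T_product q t p r N M u v \<Lambda>))"

section \<open>Prefactors\<close>

text \<open>The coefficient of \<open>\<Phi>\<^sup>*\<^sub>\<emptyset>(u) \<Phi>\<^sub>\<emptyset>(u)\<close>: the ratio of spectral parameters, right to left, is \<open>p\<close>,
  and \<open>exp (- \<Sum>m>0. (p t)\<^sup>m (1 - (p q / t)\<^sup>m) / (m (1 - q\<^sup>m) (1 - t\<^sup>m) (1 - p\<^sup>m)))\<close> is the quotient below.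
  The source prints \<open>(p\<^sup>-\<^sup>1 t; q,t,p) / (q; q,t,p)\<close>, which is the coefficient for the opposite
  order \<open>\<Phi> \<Phi>\<^sup>*\<close> (ratio \<open>p\<^sup>-\<^sup>1\<close>).\<close>

definition C_self :: "complex \<Rightarrow> complex \<Rightarrow> complex \<Rightarrow> complex" where
  "C_self q t p = qpoch (p * t) [q, t, p] / qpoch (p\<^sup>2 * q) [q, t, p]"

definition C_vev :: "complex \<Rightarrow> complex \<Rightarrow> complex \<Rightarrow> nat \<Rightarrow> (nat \<Rightarrow> complex) \<Rightarrow> complex" where
  "C_vev q t p M u = C_self q t p ^ M * (\<Prod>(i, j)\<in>{(i, j). 1 \<le> i \<and> i < j \<and> j \<le> M}.
     qpoch (t / p * (u j / u i)) [q, t] * qpoch (p * q * (u j / u i)) [q, t] /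
     (qpoch (t * (u j / u i)) [q, t] * qpoch (q * (u j / u i)) [q, t]))"

text \<open>The factor \<open>C_self\<close> of each \<open>T(u\<^sub>i)\<close> occurs in the trace as well; the source omits it there.
  All the other factors tend to those of \<open>C_vev\<close> as \<open>Q \<rightarrow> 0\<close>.\<close>

definition C_trace :: "complex \<Rightarrow> complex \<Rightarrow> complex \<Rightarrow> complex \<Rightarrow> nat \<Rightarrow> (nat \<Rightarrow> complex) \<Rightarrow> complex" where
  "C_trace q t p Q M u = C_self q t p ^ M * (1 / qpoch Q [Q]) *
     (qpoch t [q, t] * Gamma3 (t / p) q t Q / (qpoch (t / p) [q, t] * Gamma3 t q t Q)) ^ M *
     (\<Prod>(i, j)\<in>{(i, j). 1 \<le> i \<and> i < j \<and> j \<le> M}.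
       Gamma3 (t / p * (u j / u i)) q t Q * Gamma3 (p * q * (u j / u i)) q t Q /
       (Gamma3 (t * (u j / u i)) q t Q * Gamma3 (q * (u j / u i)) q t Q))"

text \<open>In the order \<open>\<Phi>\<^sup>* \<Phi>\<close> the instanton parameter is \<open>p\<^sup>* p\<^bsup>N-1\<^esup> (t/q)\<^bsup>1/2\<^esup>\<close>; the source has
  \<open>p\<^sup>*\<^sup>-\<^sup>1\<close> in place of \<open>p\<^sup>*\<close>, again the value for \<open>\<Phi> \<Phi>\<^sup>*\<close>.\<close>

definition inst_param :: "complex \<Rightarrow> complex \<Rightarrow> complex \<Rightarrow> complex \<Rightarrow> int \<Rightarrow> nat \<Rightarrow> complex" where
  "inst_param q t p r N M = pstar q t p * p powi (N - 1) * r * p powi (- (int M - 1))"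

section \<open>Genericity\<close>

definition generic_params :: "complex \<Rightarrow> complex \<Rightarrow> complex \<Rightarrow> complex \<Rightarrow> bool" where
  "generic_params q t p Q \<longleftrightarrow> q \<noteq> 0 \<and> t \<noteq> 0 \<and> p \<noteq> 0 \<and> Q \<noteq> 0 \<and>
     (\<forall>a b c d :: int. q powi a * t powi b * p powi c * Q powi d = 1 \<longrightarrow>
        a = 0 \<and> b = 0 \<and> c = 0 \<and> d = 0)"

end

theory Submission
  imports Defs
begin

text \<open>Each term of \<open>T(u\<^sub>1)\<cdots>T(u\<^sub>M)\<close> is a scalar times one normal-ordered exponential. All
  contractions come from one mode identity: the commutator turns a pair of vertex modes into
  \<open>(1 - t) / (1 - q) E\<^sub>\<xi> E\<^sub>\<mu>\<^sup>\<or>\<close>, which is a universal term minus the sum of the Nekrasov weights of the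
  pair \<open>(\<mu>, \<xi>)\<close>. Exponentiating, the universal term gives multiple \<open>q\<close>-Pochhammer symbols and the weights
  give Nekrasov functions. In the trace, summing each oscillator separately multiplies the \<open>m\<close>-th
  contraction exponent by \<open>Q\<^sup>m / (1 - Q\<^sup>m)\<close>, i.e. it replaces every factor at \<open>z\<close> by its product over
  \<open>z Q\<^sup>k\<close>, \<open>k \<ge> 1\<close>. The weights of \<open>(\<mu>, \<xi>)\<close> and of \<open>(\<xi>, \<mu>)\<close> are inverse to each other up to the factor \<open>t / q\<close>,
  which pairs these products into theta functions and produces the power \<open>p\<^bsup>-(M-1)\<^esup>\<close> per box.\<close>

section \<open>Infinite products\<close>

text \<open>A contraction series converges only for a small ratio of spectral parameters, while
  \<open>u j / u i\<close> is arbitrary, so nothing can be summed at the physical point itself.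
  \<open>exp_continues\<close> therefore records a continuation together with absolute summability
  near 0: exponents add, values multiply, and a change of sign costs one nonvanishing condition,
  which is what most uses of genericity serve. The analytic input is that a \<open>qpoch\<close>
  continues its own logarithmic series. Vacuum value and trace differ only in the kernel, so the
  algebra is done once for an abstract \<open>V\<close>. The dual operator sits at
  \<open>u / p\<close>; the modes of a single \<open>T\<close> thus carry a factor
  \<open>1 - p powi m\<close>, which cancels the \<open>1 - p ^ m\<close> of the commutator. What
  remains, the Adams powers of (1 - pq/t)(1 - 1/p), has four terms: two numerators and two
  denominators of Nekrasov functions. Only the contraction inside one \<open>T\<close> keeps
  \<open>p\<close> as a base; its infinite products cancel box by box against \<open>N_part\<close>
  and \<open>N_part'\<close>. Between different \<open>T\<close>s the plain factors 1 - z arise for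
  i < j only, and the Nekrasov ratio of the opposite order is recovered from the inversion of
  weights.\<close>

lemma holomorphic_prodinf:
  fixes g :: "nat \<Rightarrow> complex \<Rightarrow> complex" and \<delta> :: "complex \<Rightarrow> real" and h :: "complex \<Rightarrow> nat \<Rightarrow> real"
  assumes "open A" and holo: "\<And>n. g n holomorphic_on A"
    and pos: "\<And>z. z \<in> A \<Longrightarrow> \<delta> z > 0"
    and summ: "\<And>z. z \<in> A \<Longrightarrow> summable (h z)"
    and bound: "\<And>z w n. z \<in> A \<Longrightarrow> w \<in> ball z (\<delta> z) \<Longrightarrow> norm (g n w - 1) \<le> h z n"
  shows "\<And>z. z \<in> A \<Longrightarrow> convergent_prod (\<lambda>n. g n z)"
    and "(\<lambda>z. \<Prod>n. g n z) holomorphic_on A"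
proof -
  show conv: "convergent_prod (\<lambda>n. g n z)" if z: "z \<in> A" for z
  proof -
    have "summable (\<lambda>n. norm (g n z - 1))"
      using bound[OF z] pos[OF z] by (intro summable_comparison_test'[OF summ[OF z], of 0]) auto
    then show ?thesis
      by (intro abs_convergent_prod_imp_convergent_prod summable_imp_abs_convergent_prod)
  qed
  have "(\<lambda>z. \<Prod>n. g n z) analytic_on {z}" if z: "z \<in> A" for z
  proof -
    have "open (A \<inter> ball z (\<delta> z))" "z \<in> A \<inter> ball z (\<delta> z)"
      using \<open>open A\<close> z pos[OF z] by auto
    then obtain \<epsilon> where e: "\<epsilon> > 0" "cball z \<epsilon> \<subseteq> A \<inter> ball z (\<delta> z)"
      using open_contains_cball_eq by blast
    \<comment> \<open>\<open>h z\<close> dominates on a whole ball about \<open>z\<close>. Letting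
      the radius and the majorant depend on \<open>z\<close> covers domains without a global
      majorant, such as the disc of nomes.\<close>
    have "uniformly_convergent_on (cball z \<epsilon>) (\<lambda>N x. \<Sum>n<N. norm (g n x - 1))"
      by (rule Weierstrass_m_test'[of _ _ "h z"]) (use e bound[OF z] summ[OF z] in auto)
    then have "uniformly_convergent_on (cball z \<epsilon>) (\<lambda>N x. \<Prod>n<N. g n x)"
      using e holo
      by (intro uniformly_convergent_on_prod')
         (auto intro: holomorphic_on_imp_continuous_on holomorphic_on_subset)
    then have ul: "uniform_limit (cball z \<epsilon>) (\<lambda>N x. \<Prod>n<N. g n x)
                    (\<lambda>x. lim (\<lambda>N. \<Prod>n<N. g n x)) sequentially"
      using uniformly_convergent_uniform_limit_iff by blast
    have eq: "lim (\<lambda>N. \<Prod>n<N. g n x) = (\<Prod>n. g n x)" if "x \<in> cball z \<epsilon>" for x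
    proof -
      have "(\<lambda>N. \<Prod>n\<le>N. g n x) \<longlonglongrightarrow> (\<Prod>n. g n x)"
        using conv e(2) that by (intro convergent_prod_LIMSEQ) auto
      then have "(\<lambda>N. \<Prod>n<N. g n x) \<longlonglongrightarrow> (\<Prod>n. g n x)"
        using LIMSEQ_lessThan_iff_atMost[of "\<lambda>S. \<Prod>n\<in>S. g n x"] by simp
      then show ?thesis
        by (rule limI)
    qed
    have "uniform_limit (cball z \<epsilon>) (\<lambda>N x. \<Prod>n<N. g n x) (\<lambda>x. \<Prod>n. g n x) sequentially"
      using ul eq by (subst uniform_limit_cong'[of _ _ "\<lambda>N x. \<Prod>n<N. g n x" _ "\<lambda>x. lim (\<lambda>N. \<Prod>n<N. g n x)"]) auto
    moreover have "continuous_on (cball z \<epsilon>) (\<lambda>x. \<Prod>n<N. g n x)" for N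
      using e(2) holo
      by (intro continuous_intros) (auto intro: holomorphic_on_imp_continuous_on holomorphic_on_subset)
    moreover have "(\<lambda>x. \<Prod>n<N. g n x) holomorphic_on ball z \<epsilon>" for N
    proof -
      have "ball z \<epsilon> \<subseteq> A"
        using e(2) ball_subset_cball by blast
      then show ?thesis
        using holo by (intro holomorphic_intros) (auto intro: holomorphic_on_subset)
    qed
    ultimately have "(\<lambda>x. \<Prod>n. g n x) holomorphic_on ball z \<epsilon>"
      using holomorphic_uniform_limit[of z \<epsilon> "\<lambda>N x. \<Prod>n<N. g n x" sequentially] by auto
    then show ?thesis
      using e(1) by (auto simp: analytic_at intro: exI[of _ "ball z \<epsilon>"])
  qed
  then show "(\<lambda>z. \<Prod>n. g n z) holomorphic_on A"
    using analytic_on_analytic_at[of _ A] analytic_imp_holomorphic by blast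
qed

text \<open>The derivative is bounded on the compact disc. With \<open>E 0 = 1\<close> this makes
  the factors \<open>E (z * b ^ n)\<close> differ from 1 by a geometric sequence.\<close>

lemma entire_diff_bound:
  fixes E :: "complex \<Rightarrow> complex"
  assumes "E holomorphic_on UNIV"
  obtains K where "K \<ge> 0" "\<And>w. norm w \<le> R \<Longrightarrow> norm (E w - E 0) \<le> K * norm w"
proof -
  have "compact (deriv E ` cball 0 R)"
    using holomorphic_deriv[OF assms]
    by (intro compact_continuous_image holomorphic_on_imp_continuous_on)
       (auto intro: holomorphic_on_subset)
  then obtain K where K: "\<And>w. w \<in> cball 0 R \<Longrightarrow> norm (deriv E w) \<le> K"
    using compact_imp_bounded[of "deriv E ` cball 0 R"] unfolding bounded_iff by fastforce
  have "norm (E w - E 0) \<le> max K 0 * norm w" if "norm w \<le> R" for w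
  proof -
    have "norm (E w - E 0) \<le> max K 0 * norm (w - 0)"
    proof (rule field_differentiable_bound[of "cball 0 R" E "deriv E"])
      show "(E has_field_derivative deriv E z) (at z within cball 0 R)" if "z \<in> cball 0 R" for z
        using assms by (meson UNIV_I has_field_derivative_at_within holomorphic_derivI open_UNIV)
      show "norm (deriv E z) \<le> max K 0" if "z \<in> cball 0 R" for z
        using K[OF that] by auto
    qed (use that in \<open>auto intro: order_trans[OF norm_ge_zero]\<close>)
    then show ?thesis by simp
  qed
  then show ?thesis using that[of "max K 0"] by auto
qed

text \<open>The inductive step for \<open>qpoch\<close>: being entire with value 1 at 0 passes from
  \<open>E\<close> to its product over \<open>z * b ^ n\<close>.\<close>

lemma prod_geometric_holomorphic:
  fixes E :: "complex \<Rightarrow> complex"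
  assumes "E holomorphic_on UNIV" "E 0 = 1" "norm b < 1"
  shows "convergent_prod (\<lambda>n. E (z * b ^ n))"
    and "(\<lambda>z. \<Prod>n. E (z * b ^ n)) holomorphic_on UNIV"
proof -
  have 1: "(\<lambda>z. E (z * b ^ n)) holomorphic_on UNIV" for n
    using holomorphic_on_compose_gen[of "\<lambda>z. z * b ^ n" UNIV E UNIV] assms(1)
    by (simp add: o_def holomorphic_intros)
  have "\<exists>K. \<forall>w\<in>ball z 1. \<forall>n. norm (E (w * b ^ n) - 1) \<le> K * ((norm z + 1) * norm b ^ n)" for z
  proof -
    obtain K where K: "K \<ge> 0" "\<And>w. norm w \<le> norm z + 1 \<Longrightarrow> norm (E w - E 0) \<le> K * norm w"
      using entire_diff_bound[OF assms(1)] by blast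
    have "norm (E (w * b ^ n) - 1) \<le> K * ((norm z + 1) * norm b ^ n)" if "w \<in> ball z 1" for w n
    proof -
      have "norm w \<le> norm z + 1"
        using that norm_triangle_sub[of w z] by (auto simp: dist_norm norm_minus_commute)
      then have le: "norm (w * b ^ n) \<le> (norm z + 1) * norm b ^ n"
        by (simp add: norm_mult norm_power mult_right_mono)
      also have "\<dots> \<le> (norm z + 1) * 1"
        using assms(3) by (intro mult_left_mono power_le_one) auto
      finally have "norm (E (w * b ^ n) - E 0) \<le> K * norm (w * b ^ n)"
        by (intro K) simp
      also have "\<dots> \<le> K * ((norm z + 1) * norm b ^ n)"
        by (intro mult_left_mono le K)
      finally show ?thesis using assms(2) by simp
    qed
    then show ?thesis by blast
  qed
  then obtain K where 2: "\<And>z w n. w \<in> ball z 1 \<Longrightarrow>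
      norm (E (w * b ^ n) - 1) \<le> K z * ((norm z + 1) * norm b ^ n)"
    by metis
  have 3: "summable (\<lambda>n. K z * ((norm z + 1) * norm b ^ n))" for z
    using assms(3) by (intro summable_mult summable_geometric) auto
  show "convergent_prod (\<lambda>n. E (z * b ^ n))"
    using 1 2 3 by (intro holomorphic_prodinf(1)[of UNIV "\<lambda>n z. E (z * b ^ n)" "\<lambda>_. 1"
        "\<lambda>z n. K z * ((norm z + 1) * norm b ^ n)"]) auto
  show "(\<lambda>z. \<Prod>n. E (z * b ^ n)) holomorphic_on UNIV"
    using 1 2 3 by (intro holomorphic_prodinf(2)[of UNIV "\<lambda>n z. E (z * b ^ n)" "\<lambda>_. 1"
        "\<lambda>z n. K z * ((norm z + 1) * norm b ^ n)"]) auto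
qed

text \<open>Here the base itself is the variable, as required for continuing a trace in its nome.
  This confines holomorphy to the unit disc, with majorants that degenerate towards the
  boundary.\<close>

lemma prod_nome_holomorphic:
  fixes E :: "complex \<Rightarrow> complex"
  assumes "E holomorphic_on UNIV" "E 0 = 1"
  shows "(\<lambda>x. \<Prod>n. E (c * x * x ^ n)) holomorphic_on ball 0 1"
proof -
  \<comment> \<open>A radius strictly between \<open>norm z\<close> and 1; on the ball of radius
    \<open>\<rho> z - norm z\<close> about \<open>z\<close> all powers are dominated by those of
    \<open>\<rho> z\<close>.\<close>
  define \<rho> where "\<rho> z = (norm z + 1) / 2" for z :: complex
  have rho: "norm z < \<rho> z" "0 < \<rho> z" "\<rho> z < 1" if "z \<in> ball 0 1" for z
    using that norm_ge_zero[of z] unfolding \<rho>_def mem_ball_0 by (simp_all, linarith+)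
  obtain K where K: "K \<ge> 0" "\<And>w. norm w \<le> norm c \<Longrightarrow> norm (E w - E 0) \<le> K * norm w"
    using entire_diff_bound[OF assms(1)] by blast
  show ?thesis
  proof (rule holomorphic_prodinf(2)[of _ _ "\<lambda>z. \<rho> z - norm z" "\<lambda>z n. K * (norm c * \<rho> z ^ n)"])
    show "(\<lambda>x. E (c * x * x ^ n)) holomorphic_on ball 0 1" for n
      using holomorphic_on_compose_gen[of "\<lambda>x. c * x * x ^ n" "ball 0 1" E UNIV] assms(1)
      by (simp add: o_def holomorphic_intros)
    show "norm (E (c * w * w ^ n) - 1) \<le> K * (norm c * \<rho> z ^ n)"
      if z: "z \<in> ball 0 1" and w: "w \<in> ball z (\<rho> z - norm z)" for z w n
    proof -
      have w: "norm w \<le> \<rho> z"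
        using w norm_triangle_sub[of w z] by (auto simp: dist_norm norm_minus_commute)
      have "norm (c * w * w ^ n) = norm c * (norm w * norm w ^ n)"
        by (simp add: norm_mult norm_power)
      also have "\<dots> \<le> norm c * (1 * \<rho> z ^ n)"
        using w rho[OF z] by (intro mult_left_mono mult_mono power_mono) auto
      finally have le: "norm (c * w * w ^ n) \<le> norm c * \<rho> z ^ n" by simp
      also have "\<dots> \<le> norm c * 1"
        using rho[OF z] by (intro mult_left_mono power_le_one) auto
      finally have "norm (E (c * w * w ^ n) - E 0) \<le> K * norm (c * w * w ^ n)"
        by (intro K) simp
      also have "\<dots> \<le> K * (norm c * \<rho> z ^ n)"
        by (intro mult_left_mono le K)
      finally show ?thesis using assms(2) by simp
    qed
    show "summable (\<lambda>n. K * (norm c * \<rho> z ^ n))" if "z \<in> ball 0 1" for z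
      using rho[OF that] by (intro summable_mult summable_geometric) auto
  qed (use rho in auto)
qed

lemma prodinf_eq_0_iff:
  fixes f :: "nat \<Rightarrow> complex"
  assumes "convergent_prod f"
  shows "prodinf f = 0 \<longleftrightarrow> (\<exists>n. f n = 0)"
  using has_prod_eq_0_iff[OF convergent_prod_has_prod[OF assms]] by auto

section \<open>Multiple q-Pochhammer symbols as entire functions\<close>

lemma qpoch_entire:
  assumes "\<And>b. b \<in> set bs \<Longrightarrow> norm b < 1"
  shows "(\<lambda>z. qpoch z bs) holomorphic_on UNIV \<and> qpoch 0 bs = 1"
  using assms
proof (induction bs)
  case (Cons b bs)
  then show ?case
    using prod_geometric_holomorphic(2)[of "\<lambda>z. qpoch z bs" b] by auto
qed (auto intro!: holomorphic_intros)

lemma qpoch_convergent: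
  assumes "\<And>b. b \<in> set bs \<Longrightarrow> norm b < 1" "norm b < 1"
  shows "convergent_prod (\<lambda>n. qpoch (z * b ^ n) bs)"
  using prod_geometric_holomorphic(1)[of "\<lambda>z. qpoch z bs" b] qpoch_entire[of bs] assms by auto

lemma qpoch_Cons_nonzero:
  assumes "\<And>b. b \<in> set bs \<Longrightarrow> norm b < 1" "norm b < 1" "\<And>n. qpoch (z * b ^ n) bs \<noteq> 0"
  shows "qpoch z (b # bs) \<noteq> 0"
  using prodinf_eq_0_iff[OF qpoch_convergent[OF assms(1,2)]] assms(3) by auto

lemma qpoch_Cons_shift:
  assumes "\<And>b. b \<in> set bs \<Longrightarrow> norm b < 1" "norm b < 1"
  shows "qpoch z (b # bs) = qpoch z bs * qpoch (z * b) (b # bs)"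
proof -
  have "(\<lambda>n. qpoch (z * b * b ^ n) bs) has_prod qpoch (z * b) (b # bs)"
    using convergent_prod_has_prod[OF qpoch_convergent[where z = "z * b", OF assms]] by simp
  then have *: "(\<lambda>n. qpoch (z * b ^ Suc n) bs) has_prod qpoch (z * b) (b # bs)"
    by (simp add: mult_ac)
  have "(\<lambda>n. qpoch (z * b ^ n) bs) has_prod (qpoch (z * b) (b # bs) * qpoch (z * b ^ 0) bs)"
  proof (cases "qpoch z bs = 0")
    case False
    then show ?thesis using has_prod_Suc_iff[of "\<lambda>n. qpoch (z * b ^ n) bs"] * by auto
  next
    \<comment> \<open>\<open>has_prod_Suc_iff\<close> needs a nonzero first factor. If it vanishes,
      both products are 0.\<close>
    case True
    have "(\<lambda>n. qpoch (z * b ^ n) bs) has_prod (\<Prod>n. qpoch (z * b ^ n) bs)"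
      by (intro convergent_prod_has_prod qpoch_convergent assms)
    moreover have "(\<Prod>n. qpoch (z * b ^ n) bs) = 0"
      using prodinf_eq_0_iff[OF qpoch_convergent[where z = z, OF assms]] True by (metis mult_1_right power_0)
    ultimately show ?thesis using True by simp
  qed
  then show ?thesis
    using has_prod_unique[of "\<lambda>n. qpoch (z * b ^ n) bs"] by (simp add: mult.commute)
qed

section \<open>Logarithmic series of q-Pochhammer symbols\<close>

lemma double_series_swap:
  fixes f :: "nat \<Rightarrow> nat \<Rightarrow> complex"
  assumes "\<And>k n. norm (f k n) \<le> A k * B n" "summable A" "summable B"
    and "\<And>k. A k \<ge> 0" "\<And>n. B n \<ge> 0"
  shows "(\<lambda>k. \<Sum>n. f k n) sums (\<Sum>n. \<Sum>k. f k n)"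
proof -
  have A: "A summable_on UNIV" and B: "B summable_on UNIV"
    using assms by (auto intro!: norm_summable_imp_summable_on)
  \<comment> \<open>Domination by a product gives absolute summability over all pairs, where
    unordered sums may be exchanged; the rest translates between \<open>infsum\<close> and
    series.\<close>
  have "(\<lambda>x. norm (case x of (k, n) \<Rightarrow> A k * B n)) summable_on UNIV \<times> UNIV"
    unfolding Infinite_Sum.abs_summable_on_Sigma_iff
  proof (intro conjI ballI)
    show "(\<lambda>n. norm (case (k, n) of (k, n) \<Rightarrow> A k * B n)) summable_on UNIV" for k
      using summable_on_cmult_right[OF B, of "A k"] assms(4,5) by (simp add: abs_mult)
    have "(\<Sum>\<^sub>\<infinity>n. norm (case (k, n) of (k, n) \<Rightarrow> A k * B n)) = A k * (\<Sum>\<^sub>\<infinity>n. B n)" for k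
      using assms(4,5) by (simp add: abs_mult infsum_cmult_right')
    then show "(\<lambda>k. norm (\<Sum>\<^sub>\<infinity>n. norm (case (k, n) of (k, n) \<Rightarrow> A k * B n))) summable_on UNIV"
      using summable_on_cmult_left[OF A] assms(4,5) by (simp add: abs_mult infsum_nonneg)
  qed
  then have "(\<lambda>x. norm (case x of (k, n) \<Rightarrow> A k * B n)) summable_on UNIV"
    by simp
  then have "(\<lambda>x. norm (case x of (k, n) \<Rightarrow> f k n)) summable_on UNIV"
    by (rule Infinite_Sum.abs_summable_on_comparison_test)
       (use assms in \<open>auto intro: order_trans[OF _ abs_ge_self]\<close>)
  then have fs: "(\<lambda>(k, n). f k n) summable_on UNIV \<times> UNIV"
    using abs_summable_summable by fastforce
  have nk: "norm (f k n) \<le> A k * B n" for k n by fact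
  have s1: "summable (\<lambda>n. norm (f k n))" for k
    by (rule summable_comparison_test'[of "\<lambda>n. A k * B n" 0])
       (use nk assms in \<open>auto intro: summable_mult\<close>)
  have s2: "summable (\<lambda>k. norm (f k n))" for n
    by (rule summable_comparison_test'[of "\<lambda>k. A k * B n" 0])
       (use nk assms in \<open>auto intro: summable_mult2\<close>)
  have i1: "(\<Sum>\<^sub>\<infinity>n. f k n) = (\<Sum>n. f k n)" for k
    using norm_summable_imp_has_sum[OF s1 summable_sums[OF summable_norm_cancel[OF s1]]]
    by (rule infsumI)
  have i2: "(\<Sum>\<^sub>\<infinity>k. f k n) = (\<Sum>k. f k n)" for n
    using norm_summable_imp_has_sum[OF s2 summable_sums[OF summable_norm_cancel[OF s2]]]
    by (rule infsumI)
  have fs': "(\<lambda>(n, k). f k n) summable_on UNIV \<times> UNIV"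
    using fs by (subst (asm) summable_on_swap) auto
  have "(\<lambda>k. \<Sum>\<^sub>\<infinity>n. f k n) sums (\<Sum>\<^sub>\<infinity>k. \<Sum>\<^sub>\<infinity>n. f k n)"
    by (intro has_sum_imp_sums has_sum_infsum summable_on_Sigma_banach fs)
  moreover have "(\<lambda>n. \<Sum>\<^sub>\<infinity>k. f k n) sums (\<Sum>\<^sub>\<infinity>n. \<Sum>\<^sub>\<infinity>k. f k n)"
    by (intro has_sum_imp_sums has_sum_infsum summable_on_Sigma_banach fs')
  ultimately show ?thesis
    using infsum_swap_banach[OF fs] by (simp add: i1 i2 sums_iff)
qed

text \<open>The Taylor coefficients of the negative logarithm of \<open>qpoch z bs\<close> at 0 are
  \<open>1 / qpoch_denom bs m\<close>. The value at \<open>m = 0\<close> is 0, and all series start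
  at \<open>Suc n\<close>.\<close>

definition qpoch_denom :: "complex list \<Rightarrow> nat \<Rightarrow> complex" where
  "qpoch_denom bs m = of_nat m * (\<Prod>b\<leftarrow>bs. 1 - b ^ m)"

text \<open>For positive \<open>m\<close>, \<open>norm (1 - b ^ m)\<close> is at least
  \<open>1 - norm b\<close>, so the logarithmic coefficients are bounded uniformly in
  \<open>m\<close>.\<close>

lemma qpoch_denom_bound:
  assumes "\<And>b. b \<in> set bs \<Longrightarrow> norm b < 1"
  obtains \<delta> where "\<delta> > 0" "\<And>m. m > 0 \<Longrightarrow> norm (qpoch_denom bs m) \<ge> \<delta>"
proof -
  have "\<exists>\<delta>>0. \<forall>m>0. norm (\<Prod>b\<leftarrow>bs. 1 - b ^ m) \<ge> \<delta>"
    using assms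
  proof (induction bs)
    case (Cons b bs)
    then obtain \<delta> where d: "\<delta> > 0" "\<And>m. m > 0 \<Longrightarrow> norm (\<Prod>b\<leftarrow>bs. 1 - b ^ m) \<ge> \<delta>"
      by auto
    have b: "norm b < 1" using Cons by auto
    have "norm (1 - b ^ m) \<ge> 1 - norm b" if "m > 0" for m
    proof -
      have "norm b ^ m \<le> norm b ^ 1"
        using that b by (intro power_decreasing) auto
      then show ?thesis
        using norm_triangle_ineq2[of 1 "b ^ m"] by (simp add: norm_power)
    qed
    then have "norm (\<Prod>b\<leftarrow>b # bs. 1 - b ^ m) \<ge> (1 - norm b) * \<delta>" if "m > 0" for m
      using that d b by (auto simp: norm_mult intro!: mult_mono)
    then show ?case
      using d(1) b by (intro exI[of _ "(1 - norm b) * \<delta>"]) auto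
  qed (auto intro: exI[of _ 1])
  then obtain \<delta> where d: "\<delta> > 0" "\<And>m. m > 0 \<Longrightarrow> norm (\<Prod>b\<leftarrow>bs. 1 - b ^ m) \<ge> \<delta>"
    by auto
  have "norm (qpoch_denom bs m) \<ge> \<delta>" if "m > 0" for m
  proof -
    have "1 * \<delta> \<le> real m * norm (\<Prod>b\<leftarrow>bs. 1 - b ^ m)"
      using that d by (intro mult_mono) auto
    then show ?thesis by (simp add: qpoch_denom_def norm_mult)
  qed
  then show ?thesis using that d(1) by blast
qed

lemma qpoch_log_summable:
  assumes "\<And>b. b \<in> set bs \<Longrightarrow> norm b < 1" "norm z < 1"
  shows "summable (\<lambda>n. norm (z ^ Suc n / qpoch_denom bs (Suc n)))"
proof -
  obtain \<delta> where d: "\<delta> > 0" "\<And>m. m > 0 \<Longrightarrow> norm (qpoch_denom bs m) \<ge> \<delta>"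
    using qpoch_denom_bound assms(1) by blast
  have le: "norm (z ^ Suc n / qpoch_denom bs (Suc n)) \<le> norm z ^ Suc n / \<delta>" for n
    unfolding norm_divide norm_power using d(1) d(2)[of "Suc n"]
    by (intro divide_left_mono mult_pos_pos) auto
  have "summable (\<lambda>n. norm z ^ Suc n / \<delta>)"
    using assms(2) by (intro summable_divide) (simp add: summable_geometric)
  then show ?thesis
    by (rule summable_comparison_test'[where N = 0]) (simp only: real_norm_def abs_norm_cancel le)
qed

text \<open>For one more base \<open>b\<close>, sum the series at \<open>z * b ^ k\<close> over
  \<open>k\<close>: the geometric series in \<open>b ^ m\<close> produces exactly the new factor
  \<open>1 - b ^ m\<close> of \<open>qpoch_denom\<close>.\<close>

lemma qpoch_eq_exp:
  assumes "\<And>b. b \<in> set bs \<Longrightarrow> norm b < 1" "norm z < 1"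
  shows "qpoch z bs = exp (- (\<Sum>n. z ^ Suc n / qpoch_denom bs (Suc n)))"
  using assms
proof (induction bs arbitrary: z)
  case Nil
  have "(\<lambda>n. - (z ^ n / of_nat n)) sums ln (1 - z)"
    using Ln_series'[of "- z"] Nil by simp
  then have "(\<lambda>n. - (z ^ Suc n / of_nat (Suc n))) sums ln (1 - z)"
    using sums_Suc_iff[of "\<lambda>n. - (z ^ n / of_nat n)" "ln (1 - z)"]
    by (simp del: of_nat_Suc power_Suc)
  from sums_minus[OF this] have "(\<lambda>n. z ^ Suc n / of_nat (Suc n)) sums - ln (1 - z)"
    by (simp del: of_nat_Suc power_Suc)
  then have "(\<Sum>n. z ^ Suc n / of_nat (Suc n)) = - ln (1 - z)"
    by (simp only: sums_iff)
  moreover have "z \<noteq> 1"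
    using Nil by auto
  ultimately show ?case
    by (simp add: qpoch_denom_def del: of_nat_Suc power_Suc)
next
  case (Cons b bs)
  have b: "norm b < 1" and bs: "\<And>b. b \<in> set bs \<Longrightarrow> norm b < 1" using Cons by auto
  define f where "f k n = (z * b ^ k) ^ Suc n / qpoch_denom bs (Suc n)" for k n
  obtain \<delta> where d: "\<delta> > 0" "\<And>m. m > 0 \<Longrightarrow> norm (qpoch_denom bs m) \<ge> \<delta>"
    using qpoch_denom_bound bs by blast
  have "norm (f k n) \<le> norm b ^ k * (norm z ^ Suc n / \<delta>)" for k n
  proof -
    have "norm (f k n) \<le> norm ((z * b ^ k) ^ Suc n) / \<delta>"
      unfolding norm_divide f_def using d(1) d(2)[of "Suc n"]
      by (intro divide_left_mono mult_pos_pos) auto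
    also have "norm ((z * b ^ k) ^ Suc n) = norm z ^ Suc n * (norm b ^ k) ^ Suc n"
      by (simp add: norm_mult norm_power power_mult_distrib)
    \<comment> \<open>Giving up all but one power of \<open>norm b ^ k\<close> splits the bound into
      a function of \<open>k\<close> times a function of \<open>n\<close>.\<close>
    also have "\<dots> \<le> norm z ^ Suc n * (norm b ^ k) ^ 1"
      using b by (intro mult_left_mono power_decreasing) (auto intro: power_le_one)
    finally show ?thesis using d by (simp add: divide_simps mult_ac)
  qed
  then have "(\<lambda>k. \<Sum>n. f k n) sums (\<Sum>n. \<Sum>k. f k n)"
    using Cons.prems b d(1)
    by (intro double_series_swap[of f "\<lambda>k. norm b ^ k" "\<lambda>n. norm z ^ Suc n / \<delta>"])
       (auto intro!: summable_divide summable_geometric simp: summable_mult)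
  moreover have "(\<Sum>k. f k n) = z ^ Suc n / qpoch_denom (b # bs) (Suc n)" for n
  proof -
    have bn: "norm (b ^ Suc n) < 1"
      unfolding norm_power using b power_decreasing[of 1 "Suc n" "norm b"] by simp
    have "(\<lambda>k. z ^ Suc n / qpoch_denom bs (Suc n) * (b ^ Suc n) ^ k) sums
            (z ^ Suc n / qpoch_denom bs (Suc n) * (1 / (1 - b ^ Suc n)))"
      by (intro sums_mult geometric_sums bn)
    also have "(\<lambda>k. z ^ Suc n / qpoch_denom bs (Suc n) * (b ^ Suc n) ^ k) = (\<lambda>k. f k n)"
      by (simp add: f_def power_mult_distrib mult_ac flip: power_mult)
    finally show ?thesis
      by (simp add: sums_iff qpoch_denom_def mult_ac)
  qed
  ultimately have s: "(\<lambda>k. \<Sum>n. f k n) sums (\<Sum>n. z ^ Suc n / qpoch_denom (b # bs) (Suc n))"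
    by simp
  have "norm (z * b ^ k) < 1" for k
  proof -
    have "norm (z * b ^ k) \<le> norm z * 1"
      unfolding norm_mult norm_power using b by (intro mult_left_mono power_le_one) auto
    then show ?thesis using Cons.prems by simp
  qed
  then have "qpoch (z * b ^ k) bs = exp (- (\<Sum>n. f k n))" for k
    unfolding f_def using Cons.prems by (intro Cons.IH) auto
  then have "qpoch z (b # bs) = (\<Prod>k. exp (- (\<Sum>n. f k n)))"
    by simp
  also have "\<dots> = exp (\<Sum>k. - (\<Sum>n. f k n))"
    using s by (intro prodinf_exp summable_minus) (auto simp: sums_iff)
  also have "(\<Sum>k. - (\<Sum>n. f k n)) = - (\<Sum>n. z ^ Suc n / qpoch_denom (b # bs) (Suc n))"
    using sums_minus[OF s] by (simp add: sums_iff)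
  finally show ?case .
qed

text \<open>\<open>qpoch_denom\<close> is symmetric in the bases, so the two functions agree on the
  unit disc. Both are entire, hence they agree everywhere; no infinite product is
  rearranged.\<close>

lemma qpoch_perm:
  assumes "\<And>b. b \<in> set bs \<Longrightarrow> norm b < 1" "mset bs = mset bs'"
  shows "qpoch z bs = qpoch z bs'"
proof -
  have b': "\<And>b. b \<in> set bs' \<Longrightarrow> norm b < 1"
    using assms mset_eq_setD[OF assms(2)] by simp
  have "qpoch_denom bs = qpoch_denom bs'"
    unfolding qpoch_denom_def using assms(2)
    by (simp add: fun_eq_iff mset_map flip: prod_mset_prod_list)
  then have eq: "qpoch w bs = qpoch w bs'" if "norm w < 1" for w
    using qpoch_eq_exp[of bs w] qpoch_eq_exp[of bs' w] assms b' that by simp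
  have "qpoch z bs - qpoch z bs' = 0"
  proof (rule analytic_continuation_open[of "ball 0 1" UNIV "\<lambda>z. qpoch z bs - qpoch z bs'" "\<lambda>_. 0"])
    show "(\<lambda>z. qpoch z bs - qpoch z bs') holomorphic_on UNIV"
      using qpoch_entire[of bs] qpoch_entire[of bs'] assms b' by (intro holomorphic_intros) auto
  qed (use eq in auto)
  then show ?thesis by simp
qed

section \<open>Analytic continuation of exponentials\<close>

text \<open>\<open>w\<close> is the value at \<open>z\<^sub>0\<close> of the continuation to \<open>D\<close> of \<open>exp (\<Sum>m>0. a\<^sub>m K\<^sub>m(z))\<close>. The kernel
  is \<open>z\<^sup>m\<close> for contractions and \<open>z\<^sup>m / (1 - z\<^sup>m)\<close> for traces.\<close>

definition exp_continues ::
    "complex set \<Rightarrow> complex \<Rightarrow> (nat \<Rightarrow> complex \<Rightarrow> complex) \<Rightarrow> (nat \<Rightarrow> complex) \<Rightarrow> complex \<Rightarrow> bool" where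
  "exp_continues D z0 K a w \<longleftrightarrow> (\<exists>F. F meromorphic_on D \<and> F analytic_on {z0} \<and> F z0 = w \<and>
     (\<forall>\<^sub>F z in at 0. summable (\<lambda>n. norm (a (Suc n) * K (Suc n) z)) \<and>
        F z = exp (\<Sum>n. a (Suc n) * K (Suc n) z)))"

lemma exp_continues_zero: "exp_continues D z0 K (\<lambda>_. 0) 1"
  unfolding exp_continues_def by (intro exI[of _ "\<lambda>_. 1"]) (auto intro: meromorphic_intros)

lemma exp_continues_add:
  assumes "exp_continues D z0 K a w" "exp_continues D z0 K b w'"
  shows "exp_continues D z0 K (\<lambda>m. a m + b m) (w * w')"
proof -
  obtain F where F: "F meromorphic_on D" "F analytic_on {z0}" "F z0 = w"
    "\<forall>\<^sub>F z in at 0. summable (\<lambda>n. norm (a (Suc n) * K (Suc n) z)) \<and>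
        F z = exp (\<Sum>n. a (Suc n) * K (Suc n) z)"
    using assms(1) unfolding exp_continues_def by blast
  obtain G where G: "G meromorphic_on D" "G analytic_on {z0}" "G z0 = w'"
    "\<forall>\<^sub>F z in at 0. summable (\<lambda>n. norm (b (Suc n) * K (Suc n) z)) \<and>
        G z = exp (\<Sum>n. b (Suc n) * K (Suc n) z)"
    using assms(2) unfolding exp_continues_def by blast
  have "\<forall>\<^sub>F z in at 0. summable (\<lambda>n. norm ((a (Suc n) + b (Suc n)) * K (Suc n) z)) \<and>
        F z * G z = exp (\<Sum>n. (a (Suc n) + b (Suc n)) * K (Suc n) z)"
    using F(4) G(4)
  proof eventually_elim
    case (elim z)
    have "summable (\<lambda>n. norm (a (Suc n) * K (Suc n) z) + norm (b (Suc n) * K (Suc n) z))"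
      using elim by (intro summable_add) auto
    then have "summable (\<lambda>n. norm ((a (Suc n) + b (Suc n)) * K (Suc n) z))"
      by (rule summable_comparison_test'[where N = 0])
         (simp only: real_norm_def abs_norm_cancel ring_distribs norm_triangle_ineq)
    moreover have "(\<Sum>n. (a (Suc n) + b (Suc n)) * K (Suc n) z) =
        (\<Sum>n. a (Suc n) * K (Suc n) z) + (\<Sum>n. b (Suc n) * K (Suc n) z)"
      using elim by (subst suminf_add) (auto intro: summable_norm_cancel simp: ring_distribs)
    ultimately show ?case
      using elim by (simp add: exp_add)
  qed
  then show ?thesis
    unfolding exp_continues_def using F G
    by (intro exI[of _ "\<lambda>z. F z * G z"]) (auto intro!: meromorphic_intros analytic_intros)
qed

text \<open>The condition \<open>w \<noteq> 0\<close> keeps \<open>inverse F\<close> analytic at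
  \<open>z0\<close>. Zeros of \<open>F\<close> elsewhere only create poles, which is why
  continuations are meromorphic rather than holomorphic.\<close>

lemma exp_continues_uminus:
  assumes "exp_continues D z0 K a w" "w \<noteq> 0"
  shows "exp_continues D z0 K (\<lambda>m. - a m) (inverse w)"
proof -
  obtain F where F: "F meromorphic_on D" "F analytic_on {z0}" "F z0 = w"
    "\<forall>\<^sub>F z in at 0. summable (\<lambda>n. norm (a (Suc n) * K (Suc n) z)) \<and>
        F z = exp (\<Sum>n. a (Suc n) * K (Suc n) z)"
    using assms(1) unfolding exp_continues_def by blast
  have "\<forall>\<^sub>F z in at 0. summable (\<lambda>n. norm (- a (Suc n) * K (Suc n) z)) \<and>
        inverse (F z) = exp (\<Sum>n. - a (Suc n) * K (Suc n) z)"
    using F(4)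
  proof eventually_elim
    case (elim z)
    have "(\<Sum>n. - a (Suc n) * K (Suc n) z) = - (\<Sum>n. a (Suc n) * K (Suc n) z)"
      using elim by (simp add: suminf_minus summable_norm_cancel)
    then show ?case
      using elim by (simp add: exp_minus)
  qed
  then show ?thesis
    unfolding exp_continues_def using F assms(2)
    by (intro exI[of _ "\<lambda>z. inverse (F z)"]) (auto intro!: meromorphic_intros analytic_intros)
qed

lemma exp_continues_cong:
  assumes "exp_continues D z0 K a w" "\<And>m. m > 0 \<Longrightarrow> a m = b m" "w = w'"
  shows "exp_continues D z0 K b w'"
  using assms unfolding exp_continues_def by simp

lemma exp_continues_sum:
  assumes "finite A" "\<And>i. i \<in> A \<Longrightarrow> exp_continues D z0 K (a i) (w i)"
  shows "exp_continues D z0 K (\<lambda>m. \<Sum>i\<in>A. a i m) (\<Prod>i\<in>A. w i)"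
  using assms
  by (induction A rule: finite_induct) (auto intro: exp_continues_zero exp_continues_add)

text \<open>Two continuations differ by a meromorphic function vanishing near 0, hence vanishing on
  the connected \<open>D\<close>. The function \<open>f\<close> is compared only where the series
  converges, and \<open>s\<close> absorbs the scalar of a vertex operator.\<close>

lemma mero_cont_eqI:
  assumes D: "open D" "connected D" "0 \<in> D" "z0 \<in> D"
    and "exp_continues D z0 K a w"
    and f: "\<forall>\<^sub>F z in at 0. summable (\<lambda>n. norm (a (Suc n) * K (Suc n) z)) \<longrightarrow>
        f z = s * exp (\<Sum>n. a (Suc n) * K (Suc n) z)"
  shows "mero_cont D f z0 = s * w"
proof -
  obtain F where F: "F meromorphic_on D" "F analytic_on {z0}" "F z0 = w"
    "\<forall>\<^sub>F z in at 0. summable (\<lambda>n. norm (a (Suc n) * K (Suc n) z)) \<and>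
        F z = exp (\<Sum>n. a (Suc n) * K (Suc n) z)"
    using assms(5) unfolding exp_continues_def by blast
  have ev: "\<forall>\<^sub>F z in at 0. s * F z = f z"
    using F(4) f by eventually_elim auto
  show ?thesis
    unfolding mero_cont_def
  proof (rule the_equality)
    show "\<exists>F. F meromorphic_on D \<and> (\<forall>\<^sub>F x in at 0. F x = f x) \<and> F analytic_on {z0} \<and> F z0 = s * w"
      using F ev by (intro exI[of _ "\<lambda>z. s * F z"]) (auto intro!: meromorphic_intros analytic_intros)
  next
    fix w' assume "\<exists>F. F meromorphic_on D \<and> (\<forall>\<^sub>F x in at 0. F x = f x) \<and> F analytic_on {z0} \<and> F z0 = w'"
    then obtain G where G: "G meromorphic_on D" "\<forall>\<^sub>F x in at 0. G x = f x" "G analytic_on {z0}" "G z0 = w'"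
      by blast
    define H where "H = (\<lambda>z. G z - s * F z)"
    have "H meromorphic_on D"
      unfolding H_def using F G by (intro meromorphic_intros)
    then have nice: "remove_sings H nicely_meromorphic_on D"
      by (rule remove_sings_nicely_meromorphic)
    have "\<forall>\<^sub>F z in at 0. H z = 0"
      using ev G(2) by eventually_elim (simp add: H_def)
    moreover have "isolated_singularity_at H 0"
      using \<open>H meromorphic_on D\<close> D(3) meromorphic_on_subset
      by (intro meromorphic_on_isolated_singularity) blast
    then have "\<forall>\<^sub>F z in at 0. remove_sings H z = H z"
      by (rule eventually_remove_sings_eq_at)
    ultimately have "\<forall>\<^sub>F z in at 0. remove_sings H z = 0"
      by eventually_elim simp
    then have "\<exists>\<^sub>F z in at 0. remove_sings H z = 0"
      by (intro eventually_frequently) auto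
    then have "remove_sings H z0 = 0"
      using frequently_eq_meromorphic_imp_constant nice D by blast
    \<comment> \<open>Analyticity lets the value of \<open>H\<close> at \<open>z0\<close> be read
      off from \<open>remove_sings H\<close>; at a singular point the two may differ.\<close>
    moreover have "H analytic_on {z0}"
      unfolding H_def using F G by (intro analytic_intros)
    ultimately have "H z0 = 0"
      by simp
    then show "w' = s * w"
      using F G by (simp add: H_def)
  qed
qed

lemma eventually_norm_mult_less_1: "\<forall>\<^sub>F z in at 0. norm (c * z :: complex) < 1"
proof -
  have "((\<lambda>z. norm (c * z)) \<longlongrightarrow> norm (c * 0)) (at 0)"
    by (intro tendsto_intros)
  then show ?thesis
    by (rule order_tendstoD) simp
qed

text \<open>The constant \<open>c\<close> may be large. The series is a logarithm only while
  \<open>norm (c * z) < 1\<close>, and the entire function \<open>qpoch (c * z) bs\<close> carries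
  it to \<open>z = 1\<close>.\<close>

lemma exp_continues_qpoch:
  assumes "\<And>b. b \<in> set bs \<Longrightarrow> norm b < 1"
  shows "exp_continues UNIV 1 (\<lambda>m z. z ^ m) (\<lambda>m. - (c ^ m / qpoch_denom bs m)) (qpoch c bs)"
proof -
  have "(\<lambda>z. qpoch (c * z) bs) holomorphic_on UNIV"
    using holomorphic_on_compose_gen[of "\<lambda>z. c * z" UNIV "\<lambda>z. qpoch z bs" UNIV] qpoch_entire[OF assms]
    by (simp add: o_def holomorphic_intros)
  then have an: "(\<lambda>z. qpoch (c * z) bs) analytic_on A" for A
    using analytic_on_open analytic_on_subset by blast
  have "\<forall>\<^sub>F z in at 0. summable (\<lambda>n. norm (- (c ^ Suc n / qpoch_denom bs (Suc n)) * z ^ Suc n)) \<and>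
     qpoch (c * z) bs = exp (\<Sum>n. - (c ^ Suc n / qpoch_denom bs (Suc n)) * z ^ Suc n)"
    using eventually_norm_mult_less_1[of c]
  proof eventually_elim
    case (elim z)
    have *: "- (c ^ Suc n / qpoch_denom bs (Suc n)) * z ^ Suc n = - ((c * z) ^ Suc n / qpoch_denom bs (Suc n))" for n
      unfolding power_mult_distrib by simp
    show ?case
      unfolding * norm_minus_cancel
      using qpoch_eq_exp[OF assms elim] qpoch_log_summable[OF assms elim]
      by (simp add: suminf_minus summable_norm_cancel del: power_Suc)
  qed
  then show ?thesis
    unfolding exp_continues_def using an
    by (intro exI[of _ "\<lambda>z. qpoch (c * z) bs"]) (auto intro: analytic_on_imp_meromorphic_on)
qed

text \<open>The kernel contributes a factor \<open>1 - x ^ m\<close> to the denominator and a power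
  of \<open>x\<close> to the argument, so the nome simply becomes one more base.\<close>

lemma exp_continues_qpoch_nome:
  assumes "\<And>b. b \<in> set bs \<Longrightarrow> norm b < 1" "norm Q < 1"
  shows "exp_continues (ball 0 1) Q (\<lambda>m x. x ^ m / (1 - x ^ m)) (\<lambda>m. - (c ^ m / qpoch_denom bs m))
    (qpoch (c * Q) (Q # bs))"
proof -
  have "(\<lambda>x. qpoch (c * x) (x # bs)) holomorphic_on ball 0 1"
    using prod_nome_holomorphic[of "\<lambda>z. qpoch z bs" c] qpoch_entire[OF assms(1)] by simp
  then have an: "(\<lambda>x. qpoch (c * x) (x # bs)) analytic_on A" if "A \<subseteq> ball 0 1" for A
    using analytic_on_open analytic_on_subset that by blast
  have "\<forall>\<^sub>F x in at 0. norm (1 * x :: complex) < 1" "\<forall>\<^sub>F x in at 0. norm (c * x) < 1"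
    by (rule eventually_norm_mult_less_1)+
  then have "\<forall>\<^sub>F x in at 0.
     summable (\<lambda>n. norm (- (c ^ Suc n / qpoch_denom bs (Suc n)) * (x ^ Suc n / (1 - x ^ Suc n)))) \<and>
     qpoch (c * x) (x # bs) = exp (\<Sum>n. - (c ^ Suc n / qpoch_denom bs (Suc n)) * (x ^ Suc n / (1 - x ^ Suc n)))"
  proof eventually_elim
    case (elim x)
    have bs: "\<And>b. b \<in> set (x # bs) \<Longrightarrow> norm b < 1"
      using assms elim by auto
    have *: "- (c ^ Suc n / qpoch_denom bs (Suc n)) * (x ^ Suc n / (1 - x ^ Suc n)) =
        - ((c * x) ^ Suc n / qpoch_denom (x # bs) (Suc n))" for n
      unfolding power_mult_distrib by (simp add: qpoch_denom_def mult_ac)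
    show ?case
      unfolding * norm_minus_cancel
      using qpoch_eq_exp[of "x # bs" "c * x"] qpoch_log_summable[of "x # bs" "c * x"] bs elim(2)
      by (simp add: suminf_minus summable_norm_cancel del: power_Suc qpoch.simps)
  qed
  then show ?thesis
    unfolding exp_continues_def using an[of "ball 0 1"] an[of "{Q}"] assms(2)
    by (intro exI[of _ "\<lambda>x. qpoch (c * x) (x # bs)"])
       (auto intro!: analytic_on_imp_meromorphic_on simp del: qpoch.simps)
qed

section \<open>Characters of pairs of partitions\<close>

lemma part_antimono:
  assumes "is_partition \<xi>" "1 \<le> i" "i \<le> j"
  shows "part \<xi> j \<le> part \<xi> i"
  using assms sorted_wrt_nth_less[of "(\<ge>)" \<xi> "i - 1" "j - 1"]
  by (cases "i = j") (auto simp: part_def is_partition_def)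

lemma part_eq_0: "length \<xi> < i \<Longrightarrow> part \<xi> i = 0"
  by (simp add: part_def)

text \<open>By monotonicity the rows reaching column \<open>j\<close> form an initial segment, so
  membership is a comparison with its cardinality.\<close>

lemma le_part_iff_le_conj_part:
  assumes "is_partition \<xi>" "1 \<le> i" "1 \<le> j"
  shows "j \<le> part \<xi> i \<longleftrightarrow> i \<le> conj_part \<xi> j"
proof
  let ?S = "{i. 1 \<le> i \<and> i \<le> length \<xi> \<and> j \<le> part \<xi> i}"
  have fin: "finite ?S" by (rule finite_subset[of _ "{1..length \<xi>}"]) auto
  assume ji: "j \<le> part \<xi> i"
  have "i \<le> length \<xi>"
    using ji assms(3) part_eq_0[of \<xi> i] by (cases "i \<le> length \<xi>") auto
  then have "{1..i} \<subseteq> ?S"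
    using ji part_antimono[OF assms(1)] by (auto intro: order_trans)
  then show "i \<le> conj_part \<xi> j"
    using card_mono[OF fin, of "{1..i}"] by (simp add: conj_part_def)
next
  let ?S = "{i. 1 \<le> i \<and> i \<le> length \<xi> \<and> j \<le> part \<xi> i}"
  assume ij: "i \<le> conj_part \<xi> j"
  show "j \<le> part \<xi> i"
  proof (rule ccontr)
    assume "\<not> j \<le> part \<xi> i"
    then have "?S \<subseteq> {1..<i}"
      using part_antimono[OF assms(1,2)] by (auto simp: not_le) (meson le_trans not_le)
    then have "conj_part \<xi> j \<le> i - 1"
      using card_mono[of "{1..<i}" ?S] by (simp add: conj_part_def)
    then show False using ij assms(2) by simp
  qed
qed

lemma conj_part_eqI:
  assumes "is_partition \<xi>" "1 \<le> k" "part \<xi> (Suc k) < j" "j \<le> part \<xi> k"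
  shows "conj_part \<xi> j = k"
  using le_part_iff_le_conj_part[OF assms(1), of k j] le_part_iff_le_conj_part[OF assms(1), of "Suc k" j]
    assms by auto

lemma finite_boxes [simp]: "finite (boxes \<xi>)"
  by (simp add: boxes_def)

lemma sum_boxes:
  assumes "length \<xi> \<le> L"
  shows "(\<Sum>s\<in>boxes \<xi>. f s) = (\<Sum>i=1..L. \<Sum>j=1..part \<xi> i. f (i, j))"
proof -
  have "(\<Sum>s\<in>boxes \<xi>. f s) = (\<Sum>i=1..length \<xi>. \<Sum>j=1..part \<xi> i. f (i, j))"
    by (simp add: boxes_def sum.Sigma)
  also have "\<dots> = (\<Sum>i=1..L. \<Sum>j=1..part \<xi> i. f (i, j))"
    using assms by (intro sum.mono_neutral_left) (auto simp: part_eq_0)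
  finally show ?thesis .
qed

text \<open>The columns in \<open>{part \<xi> (Suc k)<..part \<xi> k}\<close> are those of length
  exactly \<open>k\<close>, and for \<open>k\<close> from \<open>i\<close> to \<open>L\<close> these
  intervals exhaust row \<open>i\<close>. The case \<open>i = Suc L\<close> is the empty start of a
  downward induction.\<close>

lemma sum_row_by_column_length:
  fixes g :: "nat \<Rightarrow> nat \<Rightarrow> complex"
  assumes "is_partition \<xi>" "length \<xi> \<le> L" "1 \<le> i" "i \<le> Suc L"
  shows "(\<Sum>j=1..part \<xi> i. g j (conj_part \<xi> j)) = (\<Sum>k=i..L. \<Sum>j\<in>{part \<xi> (Suc k)<..part \<xi> k}. g j k)"
  using assms(4,3)
proof (induction rule: inc_induct)
  case base
  then show ?case using assms(2) by (simp add: part_eq_0)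
next
  case (step i)
  have le: "part \<xi> (Suc i) \<le> part \<xi> i"
    using part_antimono[OF assms(1)] step by simp
  then have "{1..part \<xi> i} = {1..part \<xi> (Suc i)} \<union> {part \<xi> (Suc i)<..part \<xi> i}" by auto
  then have "(\<Sum>j=1..part \<xi> i. g j (conj_part \<xi> j)) =
      (\<Sum>j=1..part \<xi> (Suc i). g j (conj_part \<xi> j)) + (\<Sum>j\<in>{part \<xi> (Suc i)<..part \<xi> i}. g j (conj_part \<xi> j))"
    by (simp only:, subst sum.union_disjoint) auto
  also have "(\<Sum>j\<in>{part \<xi> (Suc i)<..part \<xi> i}. g j (conj_part \<xi> j)) = (\<Sum>j\<in>{part \<xi> (Suc i)<..part \<xi> i}. g j i)"
    using conj_part_eqI[OF assms(1)] step by (intro sum.cong) auto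
  also have "(\<Sum>j=1..part \<xi> (Suc i). g j (conj_part \<xi> j)) =
      (\<Sum>k=Suc i..L. \<Sum>j\<in>{part \<xi> (Suc k)<..part \<xi> k}. g j k)"
    using step by simp
  finally show ?case
    using step by (simp add: sum.atLeast_Suc_atMost)
qed

lemma sum_power_interval:
  fixes q :: complex
  assumes "q \<noteq> 1" "a \<le> b"
  shows "(\<Sum>j\<in>{a<..b}. q ^ j) = q * (q ^ b - q ^ a) / (q - 1)"
  using assms(2)
proof (induction rule: dec_induct)
  case (step n)
  have "{a<..Suc n} = insert (Suc n) {a<..n}" using step by auto
  then show ?case using step assms(1) by (simp add: divide_simps) (simp add: algebra_simps)
qed auto

lemma sum_powi_interval:
  fixes q :: complex
  assumes "q \<noteq> 0" "q \<noteq> 1" "a \<le> b"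
  shows "(\<Sum>j\<in>{a<..b}. q powi (int j - 1 - c)) = q powi (- c) * (q powi int b - q powi int a) / (q - 1)"
    and "(\<Sum>j\<in>{a<..b}. q powi (c - int j)) = q powi c * (q powi (- int a) - q powi (- int b)) / (q - 1)"
proof -
  have "(\<Sum>j\<in>{a<..b}. q powi (int j - 1 - c)) = q powi (- c) / q * (\<Sum>j\<in>{a<..b}. q ^ j)"
    using assms(1)
    by (simp add: sum_distrib_left power_int_diff power_int_add power_int_minus divide_inverse mult_ac)
  then show "(\<Sum>j\<in>{a<..b}. q powi (int j - 1 - c)) = q powi (- c) * (q powi int b - q powi int a) / (q - 1)"
    using assms by (simp add: sum_power_interval)
  have "(\<Sum>j\<in>{a<..b}. q powi (c - int j)) = q powi c * (\<Sum>j\<in>{a<..b}. (1 / q) ^ j)"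
    using assms(1) by (simp add: sum_distrib_left power_int_diff power_divide)
  also have "(\<Sum>j\<in>{a<..b}. (1 / q) ^ j) = (1 / q) * ((1 / q) ^ b - (1 / q) ^ a) / (1 / q - 1)"
    using assms by (intro sum_power_interval) auto
  also have "\<dots> = (q powi (- int a) - q powi (- int b)) / (q - 1)"
    using assms by (simp add: power_int_minus power_divide divide_simps) (simp add: algebra_simps)
  finally show "(\<Sum>j\<in>{a<..b}. q powi (c - int j)) = q powi c * (q powi (- int a) - q powi (- int b)) / (q - 1)"
    by simp
qed

text \<open>Abel summation. The first summand supplies the terms \<open>x i * y k\<close> with i < k
  and the second those with i > k, all with coefficient (1 - t) times t to the power i - k; on the
  diagonal they give 1 and -t. Together this is the full product of \<open>X L\<close> and
  \<open>Y L\<close>, up to the boundary terms at \<open>Suc L\<close>.\<close>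

lemma telescoping_pairs:
  fixes x y :: "nat \<Rightarrow> complex" and t :: complex
  assumes "t \<noteq> 0"
  defines "X \<equiv> \<lambda>L. \<Sum>i=1..L. x i * t powi int i" and "Y \<equiv> \<lambda>L. \<Sum>i=1..L. y i * t powi (- int i)"
  shows "(\<Sum>k=1..L. t powi (- int k) * X k * (y k - y (Suc k)) + t powi (int k + 1) * Y k * (x (Suc k) - x k)) =
    (1 - t) * X L * Y L - y (Suc L) * t powi (- int L) * X L + x (Suc L) * t powi (int L + 1) * Y L"
proof (induction L)
  case 0
  then show ?case by (simp add: X_def Y_def)
next
  case (Suc L)
  have XS: "X (Suc L) = X L + x (Suc L) * (t * t ^ L)" and YS: "Y (Suc L) = Y L + y (Suc L) / (t * t ^ L)"
    by (simp_all add: X_def Y_def power_int_minus divide_inverse flip: power_Suc)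
  have T: "t powi (- int L) = 1 / t ^ L" "t powi (int L + 1) = t * t ^ L"
    "t powi (int (Suc L) + 1) = t * (t * t ^ L)"
    using assms(1) by (simp_all add: power_int_minus divide_inverse power_int_add power2_eq_square)
  have T': "t powi (- int (Suc L)) = 1 / (t * t ^ L)"
    by (simp only: power_int_minus power_int_of_nat power_Suc inverse_eq_divide)
  have "t ^ L \<noteq> 0" using assms(1) by simp
  then show ?case
    unfolding sum.cl_ivl_Suc Suc.IH XS YS T T' using assms(1) by (simp add: field_simps)
qed

lemma sum_triangle_swap:
  "(\<Sum>i=1..L::nat. \<Sum>k=i..L. f i k) = (\<Sum>k=1..L. \<Sum>i=1..k. f i k :: complex)"
proof -
  have "(\<Sum>i=1..L. \<Sum>k=i..L. f i k) = (\<Sum>i\<in>{1..L}. \<Sum>k\<in>{k\<in>{1..L}. i \<le> k}. f i k)"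
    by (intro sum.cong) auto
  also have "\<dots> = (\<Sum>k\<in>{1..L}. \<Sum>i\<in>{i\<in>{1..L}. i \<le> k}. f i k)"
    by (rule sum.swap_restrict) auto
  also have "\<dots> = (\<Sum>k=1..L. \<Sum>i=1..k. f i k)"
    by (intro sum.cong) auto
  finally show ?thesis .
qed

text \<open>The mode is the regularised sum of \<open>q powi (- part) * t ^ (j - 1)\<close> over all
  j \<ge> 1, and 1/(1 - t) is its value for the empty partition. Cutting at any \<open>L\<close>
  beyond the length leaves the tail \<open>t ^ L / (1 - t)\<close>, so two partitions can share one
  cut.\<close>

lemma E_mode_1:
  assumes "length \<xi> \<le> L" "t \<noteq> 0" "t \<noteq> 1"
  shows "E_mode q t \<xi> 1 = (\<Sum>i=1..L. q powi (- int (part \<xi> i)) * t powi int i) / t + t ^ L / (1 - t)"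
proof -
  have "(\<Sum>j = 1..length \<xi>. (q powi (- 1 * int (part \<xi> j)) - 1) * t powi (1 * (int j - 1))) =
      (\<Sum>j = 1..L. (q powi (- 1 * int (part \<xi> j)) - 1) * t powi (1 * (int j - 1)))"
    using assms(1) by (intro sum.mono_neutral_left) (auto simp: part_def)
  also have "\<dots> = (\<Sum>j = 1..L. q powi (- int (part \<xi> j)) * t powi int j) / t - (\<Sum>j = 1..L. t ^ (j - 1))"
    unfolding sum_divide_distrib sum_subtractf[symmetric]
  proof (intro sum.cong refl)
    fix j assume "j \<in> {1..L}"
    then have "t powi (int j - 1) = t ^ (j - 1)" and "t powi int j = t * t ^ (j - 1)"
      using power_int_of_nat[of t "j - 1"] by (auto simp: of_nat_diff power_eq_if)
    then show "(q powi (- 1 * int (part \<xi> j)) - 1) * t powi (1 * (int j - 1)) =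
        q powi (- int (part \<xi> j)) * t powi int j / t - t ^ (j - 1)"
      using assms(2) by (simp add: algebra_simps)
  qed
  also have "(\<Sum>j = 1..L. t ^ (j - 1)) = (\<Sum>j<L. t ^ j)"
    by (rule sum.reindex_bij_witness[of _ Suc "\<lambda>j. j - 1"]) auto
  also have "\<dots> = (1 - t ^ L) / (1 - t)"
    using assms(3) by (simp add: geometric_sum divide_simps) (simp add: algebra_simps)
  finally show ?thesis
    using assms(3) by (simp add: E_mode_def diff_divide_distrib)
qed

lemma powi_flip: "(x :: complex) powi (a - b) = inverse (x powi (b - a))"
  using power_int_minus[of x "b - a"] by simp

lemma E_mode_minus_1: "E_mode q t \<xi> (- 1) = E_mode (1 / q) (1 / t) \<xi> 1"
  by (simp add: E_mode_def powi_flip[of t 1] power_int_inverse power_int_minus power_inverse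
      flip: inverse_eq_divide)

text \<open>A disjoint sum, because a box may lie in both partitions and then enters twice with
  different weights. Every Nekrasov function becomes a single product over this index.\<close>

definition nek_index :: "nat list \<Rightarrow> nat list \<Rightarrow> ((nat \<times> nat) + (nat \<times> nat)) set" where
  "nek_index \<xi> \<mu> = boxes \<xi> <+> boxes \<mu>"

text \<open>Up to an overall twist, these are the torus weights of the bifundamental at a pair of
  fixed points.\<close>

definition nek_weight ::
    "complex \<Rightarrow> complex \<Rightarrow> nat list \<Rightarrow> nat list \<Rightarrow> (nat \<times> nat) + (nat \<times> nat) \<Rightarrow> complex" where
  "nek_weight q t \<xi> \<mu> = case_sum
     (\<lambda>s. q powi (- arm \<mu> s - 1) * t powi (- leg \<xi> s))
     (\<lambda>s. q powi arm \<xi> s * t powi (leg \<mu> s + 1))"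

lemma finite_nek_index [simp]: "finite (nek_index \<xi> \<mu>)"
  by (simp add: nek_index_def)

lemma nek_eq_prod: "nek g q t \<xi> \<mu> x = (\<Prod>c\<in>nek_index \<xi> \<mu>. g (x * nek_weight q t \<xi> \<mu> c))"
  by (simp add: nek_def nek_index_def prod.Plus nek_weight_def mult.assoc o_def)

lemma sum_nek_weight:
  assumes "is_partition \<xi>" "is_partition \<mu>" "q \<noteq> 0" "q \<noteq> 1" "t \<noteq> 0" "t \<noteq> 1"
  shows "(\<Sum>c\<in>nek_index \<mu> \<xi>. nek_weight q t \<mu> \<xi> c) =
    - t / ((1 - q) * (1 - t)) - (1 - t) / (1 - q) * E_mode q t \<xi> 1 * E_mode q t \<mu> (- 1)"
proof -
  \<comment> \<open>A column of length \<open>k\<close> contributes only through \<open>k\<close>: row \<open>i\<close> of \<open>\<mu>\<close> has \<open>\<mu>\<^sub>k - \<mu>\<^sub>k\<^sub>+\<^sub>1\<close> boxes in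
    columns of length \<open>k \<ge> i\<close>, so both box sums become double sums over \<open>i \<le> k\<close>.\<close>
  define L where "L = max (length \<xi>) (length \<mu>)"
  have L: "length \<xi> \<le> L" "length \<mu> \<le> L" by (auto simp: L_def)
  define x y where "x i = q powi (- int (part \<xi> i))" and "y i = q powi int (part \<mu> i)" for i
  define X Y where "X k = (\<Sum>i=1..k. x i * t powi int i)" and "Y k = (\<Sum>i=1..k. y i * t powi (- int i))" for k
  \<comment> \<open>Beyond \<open>L\<close> both partitions have zero parts, which fixes the
    boundary terms of the telescoping.\<close>
  have xy_end: "x (Suc L) = 1" "y (Suc L) = 1"
    using L by (simp_all add: x_def y_def part_eq_0)
  have "(\<Sum>s\<in>boxes \<mu>. q powi (- arm \<xi> s - 1) * t powi (- leg \<mu> s)) =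
      (\<Sum>i=1..L. \<Sum>j=1..part \<mu> i. q powi (int j - 1 - int (part \<xi> i)) * t powi (int i - int (conj_part \<mu> j)))"
    using L by (simp add: sum_boxes arm_def leg_def algebra_simps)
  also have "\<dots> = (\<Sum>i=1..L. \<Sum>k=i..L. \<Sum>j\<in>{part \<mu> (Suc k)<..part \<mu> k}.
      q powi (int j - 1 - int (part \<xi> i)) * t powi (int i - int k))"
    using L assms(2) by (intro sum.cong refl sum_row_by_column_length) auto
  also have "\<dots> = (\<Sum>i=1..L. \<Sum>k=i..L. x i * (y k - y (Suc k)) / (q - 1) * t powi (int i - int k))"
    unfolding sum_distrib_right[symmetric] x_def y_def using assms part_antimono
    by (intro sum.cong refl arg_cong2[of _ _ _ _ "(*)"] sum_powi_interval(1)) auto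
  also have "\<dots> = (\<Sum>k=1..L. \<Sum>i=1..k. x i * (y k - y (Suc k)) / (q - 1) * t powi (int i - int k))"
    by (rule sum_triangle_swap)
  also have "\<dots> = (\<Sum>k=1..L. t powi (- int k) * X k * (y k - y (Suc k))) / (q - 1)"
    using assms(5) unfolding X_def
    by (simp add: sum_divide_distrib sum_distrib_left sum_distrib_right power_int_diff power_int_minus divide_inverse mult_ac)
  finally have S1: "(\<Sum>s\<in>boxes \<mu>. q powi (- arm \<xi> s - 1) * t powi (- leg \<mu> s)) =
      (\<Sum>k=1..L. t powi (- int k) * X k * (y k - y (Suc k))) / (q - 1)" .
  have "(\<Sum>s\<in>boxes \<xi>. q powi arm \<mu> s * t powi (leg \<xi> s + 1)) =
      (\<Sum>i=1..L. \<Sum>j=1..part \<xi> i. q powi (int (part \<mu> i) - int j) * t powi (int (conj_part \<xi> j) - int i + 1))"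
    using L by (simp add: sum_boxes arm_def leg_def algebra_simps)
  also have "\<dots> = (\<Sum>i=1..L. \<Sum>k=i..L. \<Sum>j\<in>{part \<xi> (Suc k)<..part \<xi> k}.
      q powi (int (part \<mu> i) - int j) * t powi (int k - int i + 1))"
    using L assms(1) by (intro sum.cong refl sum_row_by_column_length) auto
  also have "\<dots> = (\<Sum>i=1..L. \<Sum>k=i..L. y i * (x (Suc k) - x k) / (q - 1) * t powi (int k - int i + 1))"
    unfolding sum_distrib_right[symmetric] x_def y_def using assms part_antimono
    by (intro sum.cong refl arg_cong2[of _ _ _ _ "(*)"] sum_powi_interval(2)) auto
  also have "\<dots> = (\<Sum>k=1..L. \<Sum>i=1..k. y i * (x (Suc k) - x k) / (q - 1) * t powi (int k - int i + 1))"
    by (rule sum_triangle_swap)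
  also have "\<dots> = (\<Sum>k=1..L. t powi (int k + 1) * Y k * (x (Suc k) - x k)) / (q - 1)"
    using assms(5) unfolding Y_def
    by (simp add: sum_divide_distrib sum_distrib_left sum_distrib_right power_int_diff power_int_add
         power_int_minus divide_inverse mult_ac)
  finally have S2: "(\<Sum>s\<in>boxes \<xi>. q powi arm \<mu> s * t powi (leg \<xi> s + 1)) =
      (\<Sum>k=1..L. t powi (int k + 1) * Y k * (x (Suc k) - x k)) / (q - 1)" .
  have "(\<Sum>c\<in>nek_index \<mu> \<xi>. nek_weight q t \<mu> \<xi> c) =
     (\<Sum>k=1..L. t powi (- int k) * X k * (y k - y (Suc k)) + t powi (int k + 1) * Y k * (x (Suc k) - x k)) / (q - 1)"
    by (simp add: nek_index_def sum.Plus nek_weight_def S1 S2 o_def sum.distrib add_divide_distrib)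
  also have "\<dots> = ((1 - t) * X L * Y L - 1 / t ^ L * X L + t * t ^ L * Y L) / (q - 1)"
    unfolding X_def Y_def telescoping_pairs[OF assms(5)] xy_end
    using assms(5) by (simp add: power_int_minus power_int_add divide_inverse)
  finally have S: "(\<Sum>c\<in>nek_index \<mu> \<xi>. nek_weight q t \<mu> \<xi> c) =
     ((1 - t) * X L * Y L - 1 / t ^ L * X L + t * t ^ L * Y L) / (q - 1)" .
  \<comment> \<open>In the product of the two truncated modes the cross terms between sums and tails
    reproduce the boundary terms in \<open>S\<close>, and tail times tail gives the universal
    term.\<close>
  have E1: "E_mode q t \<xi> 1 = X L / t + t ^ L / (1 - t)"
    unfolding X_def x_def using L assms by (intro E_mode_1) auto
  have "E_mode q t \<mu> (- 1) = (\<Sum>i=1..L. (1 / q) powi (- int (part \<mu> i)) * (1 / t) powi int i) / (1 / t) + (1 / t) ^ L / (1 - 1 / t)"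
    unfolding E_mode_minus_1 using L assms by (intro E_mode_1) auto
  also have "(\<Sum>i=1..L. (1 / q) powi (- int (part \<mu> i)) * (1 / t) powi int i) = Y L"
    unfolding Y_def y_def using assms
    by (intro sum.cong refl) (simp add: power_int_minus power_divide power_inverse divide_inverse)
  finally have E2: "E_mode q t \<mu> (- 1) = t * Y L - t / (t ^ L * (1 - t))"
    using assms by (simp add: power_divide divide_simps) (simp add: algebra_simps)
  have "t ^ L \<noteq> 0" "1 - t \<noteq> 0" "q - 1 \<noteq> 0" "1 - q \<noteq> 0" using assms by auto
  then show ?thesis
    unfolding S E1 E2 using assms(5)
    by (simp add: divide_simps) (simp add: algebra_simps)
qed

lemma power_int_power_base: "(x powi k) ^ m = (x ^ m) powi k" for x :: complex
  by (metis power_int_mult power_int_of_nat mult.commute)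

text \<open>The m-th power of a weight is an Adams operation, the substitution of
  \<open>q ^ m\<close> and \<open>t ^ m\<close>. With the same fact for \<open>E_mode\<close>, the
  identity \<open>sum_nek_weight\<close> at mode 1 yields all modes.\<close>

lemma nek_weight_power: "nek_weight q t \<xi> \<mu> c ^ m = nek_weight (q ^ m) (t ^ m) \<xi> \<mu> c"
  by (cases c) (simp_all add: nek_weight_def power_mult_distrib power_int_power_base)

lemma E_mode_power:
  "E_mode q t \<xi> (int m) = E_mode (q ^ m) (t ^ m) \<xi> 1"
  "E_mode q t \<xi> (- int m) = E_mode (q ^ m) (t ^ m) \<xi> (- 1)"
  unfolding E_mode_def
  by (simp_all add: power_int_mult power_int_minus mult.assoc powi_flip[of _ 1] flip: power_int_of_nat)

text \<open>A box of either partition enters both orders with the same arm and the same leg, once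
  negated and once not; the shifts by 1 leave the product \<open>t / q\<close>.\<close>

lemma nek_weight_swap:
  assumes "q \<noteq> 0" "t \<noteq> 0"
  shows "nek_weight q t \<mu> \<xi> (case c of Inl s \<Rightarrow> Inr s | Inr s \<Rightarrow> Inl s) = t / q / nek_weight q t \<xi> \<mu> c"
  using assms
  by (cases c) (simp_all add: nek_weight_def power_int_diff power_int_add power_int_minus divide_simps)

lemma nek_weight_nonzero: "q \<noteq> 0 \<Longrightarrow> t \<noteq> 0 \<Longrightarrow> nek_weight q t \<xi> \<mu> c \<noteq> 0"
  by (cases c) (simp_all add: nek_weight_def)

lemma prod_nek_index_swap:
  "(\<Prod>c\<in>nek_index \<mu> \<xi>. f c) = (\<Prod>c\<in>nek_index \<xi> \<mu>. f (case c of Inl s \<Rightarrow> Inr s | Inr s \<Rightarrow> Inl s) :: complex)"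
  by (rule prod.reindex_bij_witness[of _ "\<lambda>c. case c of Inl s \<Rightarrow> Inr s | Inr s \<Rightarrow> Inl s"
        "\<lambda>c. case c of Inl s \<Rightarrow> Inr s | Inr s \<Rightarrow> Inl s"])
     (auto simp: nek_index_def split: sum.splits)

section \<open>Products over the boxes of one partition\<close>

lemma card_boxes: "is_partition \<xi> \<Longrightarrow> card (boxes \<xi>) = sum_list \<xi>"
proof -
  have "card (boxes \<xi>) = (\<Sum>i=1..length \<xi>. part \<xi> i)"
    by (simp add: boxes_def)
  also have "\<dots> = (\<Sum>i<length \<xi>. \<xi> ! i)"
    by (rule sum.reindex_bij_witness[of _ Suc "\<lambda>i. i - 1"]) (auto simp: part_def)
  finally show ?thesis by (simp add: sum_list_sum_nth atLeast0LessThan)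
qed

lemma card_nek_index:
  "is_partition \<xi> \<Longrightarrow> is_partition \<mu> \<Longrightarrow> card (nek_index \<xi> \<mu>) = sum_list \<xi> + sum_list \<mu>"
  by (simp add: nek_index_def card_Plus card_boxes)

lemma prod_powi_sum: "finite A \<Longrightarrow> x \<noteq> 0 \<Longrightarrow> (\<Prod>s\<in>A. x powi f s) = (x :: complex) powi (\<Sum>s\<in>A. f s)"
  by (induction A rule: finite_induct) (auto simp: power_int_add)

lemma sum_arm: "(\<Sum>s\<in>boxes \<xi>. arm \<xi> s) = int (n_stat_conj \<xi>)"
proof -
  have *: "(\<Sum>j=1..n. int n - int j) = int (n * (n - 1) div 2)" for n
  proof -
    have "(\<Sum>j=1..n. int n - int j) = (\<Sum>j<n. int j)"
      by (rule sum.reindex_bij_witness[of _ "\<lambda>j. n - j" "\<lambda>j. n - j"]) (auto simp: of_nat_diff)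
    also have "\<dots> = int (\<Sum>{0..<n})"
      by (simp add: atLeast0LessThan)
    finally show ?thesis by (simp add: Sum_Ico_nat)
  qed
  have "(\<Sum>s\<in>boxes \<xi>. arm \<xi> s) = (\<Sum>i=1..length \<xi>. \<Sum>j=1..part \<xi> i. int (part \<xi> i) - int j)"
    by (simp add: boxes_def sum.Sigma arm_def case_prod_unfold)
  then show ?thesis
    unfolding * n_stat_conj_def by simp
qed

text \<open>Reflecting each column, i to \<open>conj_part \<xi> j + 1 - i\<close>, turns the leg of
  a box into its row number minus 1.\<close>

lemma sum_leg:
  assumes "is_partition \<xi>"
  shows "(\<Sum>s\<in>boxes \<xi>. leg \<xi> s) = int (n_stat \<xi>)"
proof -
  let ?r = "\<lambda>(i, j). (conj_part \<xi> j + 1 - i, j)"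
  have mem: "(i, j) \<in> boxes \<xi> \<longleftrightarrow> 1 \<le> i \<and> 1 \<le> j \<and> i \<le> conj_part \<xi> j" for i j
  proof (cases "1 \<le> i \<and> 1 \<le> j")
    case True
    then show ?thesis
      using le_part_iff_le_conj_part[OF assms, of i j]
      by (auto simp: boxes_def part_def split: if_splits)
  qed (auto simp: boxes_def)
  have "(\<Sum>s\<in>boxes \<xi>. leg \<xi> s) = (\<Sum>s\<in>boxes \<xi>. int (fst s - 1))"
    by (rule sum.reindex_bij_witness[of _ ?r ?r])
       (auto simp: mem leg_def of_nat_diff)
  also have "\<dots> = int (\<Sum>i=1..length \<xi>. \<Sum>j=1..part \<xi> i. i - 1)"
    by (simp add: sum_boxes[OF order_refl] of_nat_diff)
  also have "\<dots> = int (n_stat \<xi>)"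
    by (simp add: n_stat_def mult.commute)
  finally show ?thesis .
qed

text \<open>Distributes the sign and powers coming from the normalisations and framings over the
  boxes, where \<open>self_scalar\<close> can absorb them factor by factor.\<close>

lemma prod_arm_leg:
  fixes q t :: complex
  assumes "is_partition \<xi>" "q \<noteq> 0" "t \<noteq> 0"
  shows "(\<Prod>s\<in>boxes \<xi>. - (q powi arm \<xi> s * t powi (leg \<xi> s + 1))) =
    (-1) ^ sum_list \<xi> * q ^ n_stat_conj \<xi> * t ^ (n_stat \<xi> + sum_list \<xi>)"
proof -
  have "(\<Prod>s\<in>boxes \<xi>. - (q powi arm \<xi> s * t powi (leg \<xi> s + 1))) =
      (\<Prod>s\<in>boxes \<xi>. -1) * (\<Prod>s\<in>boxes \<xi>. q powi arm \<xi> s) * (\<Prod>s\<in>boxes \<xi>. t powi (leg \<xi> s + 1))"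
    unfolding prod.distrib[symmetric] by (intro prod.cong refl) simp
  also have "\<dots> = (-1) ^ sum_list \<xi> * q powi int (n_stat_conj \<xi>) * t powi int (n_stat \<xi> + sum_list \<xi>)"
    using assms by (simp add: prod_powi_sum sum.distrib sum_arm sum_leg card_boxes)
  finally show ?thesis by (simp only: power_int_of_nat)
qed

section \<open>Contractions\<close>

locale refined_params =
  fixes q t p Q r :: complex
  assumes norms: "norm q < 1" "norm t < 1" "norm p < 1" "norm (p * q / t) < 1" "norm Q < 1"
    and generic: "generic_params q t p Q"
    and root: "r\<^sup>2 = t / q"
begin

lemma nonzero [simp]: "q \<noteq> 0" "t \<noteq> 0" "p \<noteq> 0" "Q \<noteq> 0" "r \<noteq> 0"
  using generic root by (auto simp: generic_params_def)

lemma generic_neq_1: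
  "a \<noteq> 0 \<or> b \<noteq> 0 \<or> c \<noteq> 0 \<or> d \<noteq> 0 \<Longrightarrow> q powi a * t powi b * p powi c * Q powi d \<noteq> 1"
  using generic unfolding generic_params_def by blast

lemma power_neq_1: "m > 0 \<Longrightarrow> norm (z :: complex) < 1 \<Longrightarrow> z ^ m \<noteq> 1"
  using power_less_one_iff[of "norm z" m] by (metis less_irrefl norm_ge_zero norm_one norm_power)

lemma power_q_neq_power_t: "m > 0 \<Longrightarrow> q ^ m \<noteq> t ^ m"
  using generic_neq_1[of "int m" "- int m" 0 0] by (auto simp: power_int_minus)

text \<open>\<open>pair_char \<xi> \<mu> m\<close> is minus the \<open>m\<close>-th Adams operation applied to
  \<open>(1 - t) / (1 - q) E\<^sub>\<xi> E\<^sub>\<mu>\<^sup>\<or>\<close>.\<close>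

definition pair_char :: "nat list \<Rightarrow> nat list \<Rightarrow> nat \<Rightarrow> complex" where
  "pair_char \<xi> \<mu> m = t ^ m / ((1 - q ^ m) * (1 - t ^ m)) + (\<Sum>c\<in>nek_index \<mu> \<xi>. nek_weight q t \<mu> \<xi> c ^ m)"

text \<open>The contraction of opposite modes as an identity of rational functions:
  \<open>a = q ^ m\<close>, \<open>b = t ^ m\<close>, \<open>s = r ^ m\<close>,
  \<open>x = u ^ m\<close>, \<open>y = w ^ m\<close>, \<open>d = m\<close>, and \<open>P\<close> is
  the p-dependent ratio of the commutator. One of the two kappa denominators cancels the kappa of
  the commutator.\<close>

lemma mode_algebra:
  fixes a b s x y E F e P d :: complex
  assumes "a \<noteq> 0" "b \<noteq> 0" "a \<noteq> 1" "b \<noteq> 1" "a \<noteq> b" "s \<noteq> 0" "x \<noteq> 0" "d \<noteq> 0"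
  shows "((1 - b) / ((1 - a) * (1 - 1 / b) * (1 - b / a)) * E * (1 / (s * x))) *
     ((1 - 1 / b) / ((1 - 1 / a) * (1 - b) * (1 - a / b)) * F * (s * y)) *
     (- ((1 - a) * (1 - 1 / b) * (1 - b / a) / d) * (b / a - 1) * P) =
    - ((1 - b) / (1 - a) * E * F) / d * (y / x) * P"
proof -
  have nz: "1 - a \<noteq> 0" "1 - b \<noteq> 0" "a - b \<noteq> 0" "b - a \<noteq> 0" "a - 1 \<noteq> 0" "b - 1 \<noteq> 0" using assms by auto
  have eqs: "1 - 1 / b = (b - 1) / b" "1 - 1 / a = (a - 1) / a" "1 - b / a = (a - b) / a"
    "1 - a / b = (b - a) / b" "b / a - 1 = (b - a) / a"
    using assms by (simp_all add: field_simps)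
  have X: "((1 - b) / ((1 - a) * (1 - 1 / b) * (1 - b / a))) * ((1 - 1 / b) / ((1 - 1 / a) * (1 - b) * (1 - a / b))) *
     (- ((1 - a) * (1 - 1 / b) * (1 - b / a) / d) * (b / a - 1)) = - ((1 - b) / (1 - a)) / d"
    unfolding eqs using assms nz by (simp add: divide_simps) (simp add: algebra_simps)
  have Y: "1 / (s * x) * (s * y) = y / x" using assms by simp
  have Z: "(A * E * g) * (B * F * h) * (C * D * P) = (A * B * (C * D)) * (g * h) * (E * F * P)"
    for A B C D g h :: complex
    by (simp only: mult_ac)
  show ?thesis
    by (rule trans[OF Z], unfold X Y) (simp add: mult_ac)
qed

text \<open>The square root \<open>r\<close> cancels between opposite modes, so only
  \<open>w / u\<close> survives. The universal term and the weights are collected in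
  \<open>pair_char\<close> by \<open>sum_nek_weight\<close> at \<open>q ^ m\<close>,
  \<open>t ^ m\<close>.\<close>

lemma Phi_modes_product:
  assumes "is_partition \<xi>" "is_partition \<mu>" "u \<noteq> 0" "m > 0"
  shows "Phi_modes q t r \<xi> u (int m) * Phi_modes q t r \<mu> w (- int m) * comm q t p (int m) =
    pair_char \<xi> \<mu> m / of_nat m * (w / u) ^ m * ((1 - (p * q / t) ^ m) / (1 - p ^ m))"
proof -
  let ?a = "q ^ m" and ?b = "t ^ m"
  have ab: "?a \<noteq> 0" "?b \<noteq> 0" "?a \<noteq> 1" "?b \<noteq> 1" "?a \<noteq> ?b"
    using power_neq_1[OF assms(4)] norms power_q_neq_power_t[OF assms(4)] by auto
  let ?E = "E_mode ?a ?b \<xi> 1" and ?F = "E_mode ?a ?b \<mu> (- 1)"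
  let ?P = "(1 - (p * q / t) ^ m) / (1 - p ^ m)"
  have k: "kappa q t (int m) = (1 - ?a) * (1 - 1 / ?b) * (1 - ?b / ?a)"
    "kappa q t (- int m) = (1 - 1 / ?a) * (1 - ?b) * (1 - ?a / ?b)"
    by (simp_all add: kappa_def power_int_minus power_mult_distrib power_inverse divide_inverse)
  have "Phi_modes q t r \<xi> u (int m) * Phi_modes q t r \<mu> w (- int m) * comm q t p (int m) =
     ((1 - ?b) / ((1 - ?a) * (1 - 1 / ?b) * (1 - ?b / ?a)) * ?E * (1 / (r ^ m * u ^ m))) *
     ((1 - 1 / ?b) / ((1 - 1 / ?a) * (1 - ?b) * (1 - ?a / ?b)) * ?F * (r ^ m * w ^ m)) *
     (- ((1 - ?a) * (1 - 1 / ?b) * (1 - ?b / ?a) / of_nat m) * (?b / ?a - 1) * ?P)"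
    unfolding Phi_modes_def comm_def k E_mode_power pstar_def
    by (simp add: power_int_minus power_divide power_mult_distrib inverse_eq_divide)
  also have "\<dots> = - ((1 - ?b) / (1 - ?a) * ?E * ?F) / of_nat m * (w ^ m / u ^ m) * ?P"
    using ab assms by (intro mode_algebra) auto
  also have "- ((1 - ?b) / (1 - ?a) * ?E * ?F) = pair_char \<xi> \<mu> m"
    unfolding pair_char_def nek_weight_power
    using sum_nek_weight[OF assms(1,2), of ?a ?b] ab by simp
  finally show ?thesis by (simp add: power_divide)
qed

text \<open>The modes of the dual operator at \<open>u / p\<close> plus those of the other one at
  \<open>u\<close>. The factor \<open>1 - p powi m\<close> later removes the denominator
  \<open>1 - p ^ m\<close> of the commutator.\<close>

definition T_modes :: "nat list \<Rightarrow> complex \<Rightarrow> int \<Rightarrow> complex" where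
  "T_modes \<xi> u m = Phi_modes q t r \<xi> u m * (1 - p powi m)"

lemma T_modes_eq: "- Phi_modes q t r \<xi> (u / p) m + Phi_modes q t r \<xi> u m = T_modes \<xi> u m"
proof -
  have *: "(r * (u / p)) powi (- m) = (r * u) powi (- m) * p powi m"
    by (simp add: power_int_mult_distrib power_int_divide_distrib power_int_minus power_int_inverse divide_inverse)
  have "- (X * E * (g * h)) + X * E * g = X * E * g * (1 - h)" for X E g h :: complex
    by (simp add: algebra_simps)
  then show ?thesis
    unfolding T_modes_def Phi_modes_def * .
qed

text \<open>The p-dependent factors combine to (1 - (pq/t)^m)(1 - p^(-m)), whose four monomials are
  the four terms of the statement.\<close>

lemma T_modes_product:
  assumes "is_partition \<xi>" "is_partition \<mu>" "u \<noteq> 0" "m > 0"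
  shows "T_modes \<xi> u (int m) * T_modes \<mu> w (- int m) * comm q t p (int m) =
    - (pair_char \<xi> \<mu> m * (w / u / p) ^ m / of_nat m) + - (pair_char \<xi> \<mu> m * (p * q / t * (w / u)) ^ m / of_nat m)
    - (- (pair_char \<xi> \<mu> m * (w / u) ^ m / of_nat m) + - (pair_char \<xi> \<mu> m * (q / t * (w / u)) ^ m / of_nat m))"
proof -
  have p: "p ^ m \<noteq> 1" "p ^ m \<noteq> 0" using power_neq_1[OF assms(4)] norms by auto
  have "T_modes \<xi> u (int m) * T_modes \<mu> w (- int m) * comm q t p (int m) =
     (Phi_modes q t r \<xi> u (int m) * Phi_modes q t r \<mu> w (- int m) * comm q t p (int m)) *
     ((1 - p ^ m) * (1 - 1 / p ^ m))"
    by (simp add: T_modes_def power_int_minus inverse_eq_divide)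
  also have "\<dots> = pair_char \<xi> \<mu> m / of_nat m * (w / u) ^ m * (1 - p ^ m * (q / t) ^ m) * (1 - 1 / p ^ m)"
    unfolding Phi_modes_product[OF assms] using p by (simp add: power_mult_distrib power_divide)
  also have "\<dots> = - (pair_char \<xi> \<mu> m * ((w / u) ^ m / p ^ m) / of_nat m)
     + - (pair_char \<xi> \<mu> m * (p ^ m * (q / t) ^ m * (w / u) ^ m) / of_nat m)
    - (- (pair_char \<xi> \<mu> m * (w / u) ^ m / of_nat m) + - (pair_char \<xi> \<mu> m * ((q / t) ^ m * (w / u) ^ m) / of_nat m))"
    using p(2) assms(4) by (simp add: divide_simps) (simp add: algebra_simps)
  finally show ?thesis by (simp add: power_mult_distrib power_divide)
qed

text \<open>Here \<open>V c bs\<close> stands for the continuation of \<open>exp (- \<Sum>m>0. c\<^sup>m K\<^sub>m / (m \<Prod>b. 1 - b\<^sup>m))\<close>.\<close>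

definition pair_factor ::
    "(complex \<Rightarrow> complex list \<Rightarrow> complex) \<Rightarrow> nat list \<Rightarrow> nat list \<Rightarrow> complex \<Rightarrow> complex" where
  "pair_factor V \<xi> \<mu> z = V (t * z) [q, t] * (\<Prod>c\<in>nek_index \<mu> \<xi>. V (z * nek_weight q t \<mu> \<xi> c) [])"

text \<open>The arguments are \<open>y\<close> times the monomials of (1 - 1/p)(1 - pq/t); those
  with coefficient -1 stand in the numerator, because \<open>V\<close> continues the exponential of
  a negated series.\<close>

definition pair_value ::
    "(complex \<Rightarrow> complex list \<Rightarrow> complex) \<Rightarrow> nat list \<Rightarrow> nat list \<Rightarrow> complex \<Rightarrow> complex" where
  "pair_value V \<xi> \<mu> y = pair_factor V \<xi> \<mu> (y / p) * pair_factor V \<xi> \<mu> (p * q / t * y) *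
     inverse (pair_factor V \<xi> \<mu> y * pair_factor V \<xi> \<mu> (q / t * y))"

lemma exp_continues_pair_factor:
  assumes V: "\<And>c bs. (\<And>b. b \<in> set bs \<Longrightarrow> norm b < 1) \<Longrightarrow>
      exp_continues D z0 K (\<lambda>m. - (c ^ m / qpoch_denom bs m)) (V c bs)"
  shows "exp_continues D z0 K (\<lambda>m. - (pair_char \<xi> \<mu> m * z ^ m / of_nat m)) (pair_factor V \<xi> \<mu> z)"
proof -
  have "exp_continues D z0 K (\<lambda>m. - ((t * z) ^ m / qpoch_denom [q, t] m) +
      (\<Sum>c\<in>nek_index \<mu> \<xi>. - ((z * nek_weight q t \<mu> \<xi> c) ^ m / qpoch_denom [] m))) (pair_factor V \<xi> \<mu> z)"
    unfolding pair_factor_def using norms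
    by (intro exp_continues_add exp_continues_sum V) auto
  then show ?thesis
    by (rule exp_continues_cong)
       (simp_all add: pair_char_def qpoch_denom_def power_mult_distrib sum_negf sum_distrib_left
          sum_distrib_right sum_divide_distrib algebra_simps add_divide_distrib)
qed

lemma exp_continues_T_pair:
  assumes V: "\<And>c bs. (\<And>b. b \<in> set bs \<Longrightarrow> norm b < 1) \<Longrightarrow>
      exp_continues D z0 K (\<lambda>m. - (c ^ m / qpoch_denom bs m)) (V c bs)"
    and "is_partition \<xi>" "is_partition \<mu>" "u \<noteq> 0"
    and nz: "pair_factor V \<xi> \<mu> (w / u) \<noteq> 0" "pair_factor V \<xi> \<mu> (q / t * (w / u)) \<noteq> 0"
  shows "exp_continues D z0 K (\<lambda>m. T_modes \<xi> u (int m) * T_modes \<mu> w (- int m) * comm q t p (int m))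
    (pair_value V \<xi> \<mu> (w / u))"
proof -
  have "exp_continues D z0 K (\<lambda>m.
      (- (pair_char \<xi> \<mu> m * (w / u / p) ^ m / of_nat m) + - (pair_char \<xi> \<mu> m * (p * q / t * (w / u)) ^ m / of_nat m))
    + - (- (pair_char \<xi> \<mu> m * (w / u) ^ m / of_nat m) + - (pair_char \<xi> \<mu> m * (q / t * (w / u)) ^ m / of_nat m)))
     (pair_value V \<xi> \<mu> (w / u))"
    unfolding pair_value_def
    by (intro exp_continues_add exp_continues_uminus exp_continues_pair_factor[OF V]) (use nz in auto)
  then show ?thesis
    by (rule exp_continues_cong) (simp_all add: T_modes_product[OF assms(2-4)])
qed

lemma contraction_eqI:
  assumes "exp_continues UNIV 1 (\<lambda>m z. z ^ m) (\<lambda>m. a (int m) * b (- int m) * comm q t p (int m)) w"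
  shows "contraction q t p a b = w"
proof -
  have "mero_cont UNIV
     (\<lambda>z. exp (\<Sum>n. a (int (Suc n)) * b (- int (Suc n)) * comm q t p (int (Suc n)) * z ^ Suc n)) 1 = 1 * w"
    by (rule mero_cont_eqI[OF _ _ _ _ assms]) auto
  then show ?thesis by (simp add: contraction_def)
qed

lemma qpoch2_nonzero:
  assumes "\<And>a b :: nat. z * q ^ a * t ^ b \<noteq> 1"
  shows "qpoch z [q, t] \<noteq> 0"
  using norms assms by (intro qpoch_Cons_nonzero) (auto simp: eq_commute[of 1])

lemma qpoch3_nonzero:
  assumes "\<And>a b c :: nat. z * q ^ a * t ^ b * x ^ c \<noteq> 1" "norm x < 1"
  shows "qpoch z [q, t, x] \<noteq> 0"
  using norms assms by (intro qpoch_Cons_nonzero) (auto simp: eq_commute[of 1])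

lemma qpoch1_nonzero:
  assumes "\<And>a :: nat. z * x ^ a \<noteq> 1" "norm x < 1"
  shows "qpoch z [x] \<noteq> 0"
  using assms by (intro qpoch_Cons_nonzero) (auto simp: eq_commute[of 1])

lemma nek_weight_monomial: "\<exists>a b. nek_weight q t \<xi> \<mu> c = q powi a * t powi b"
  by (cases c) (auto simp: nek_weight_def)

lemma prod_nek_index_self:
  "(\<Prod>c\<in>nek_index \<xi> \<xi>. f (nek_weight q t \<xi> \<xi> c)) =
   (\<Prod>s\<in>boxes \<xi>. f (q powi (- arm \<xi> s - 1) * t powi (- leg \<xi> s)) * f (q powi arm \<xi> s * t powi (leg \<xi> s + 1)))"
  for f :: "complex \<Rightarrow> complex"
  by (simp add: nek_index_def nek_weight_def prod.Plus o_def prod.distrib)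

definition nek_ratio :: "(complex \<Rightarrow> complex) \<Rightarrow> nat list \<Rightarrow> nat list \<Rightarrow> complex \<Rightarrow> complex" where
  "nek_ratio g \<xi> \<mu> x = nek g q t \<xi> \<mu> (p * q * x / t) / nek g q t \<xi> \<mu> (q * x / t)"

text \<open>Inside one \<open>T\<close> nothing cancels the \<open>1 - p ^ m\<close> in the
  commutator, so \<open>p\<close> remains a base. \<open>C_self\<close> is the part independent of
  the partition.\<close>

definition self_contraction :: "nat list \<Rightarrow> complex" where
  "self_contraction \<xi> = C_self q t p *
     (\<Prod>c\<in>nek_index \<xi> \<xi>. qpoch (p * nek_weight q t \<xi> \<xi> c) [p] / qpoch (p\<^sup>2 * q / t * nek_weight q t \<xi> \<xi> c) [p])"

lemma generic_p_monomial:
  fixes a b c :: int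
  assumes "c \<noteq> 0" shows "p powi c * (q powi a * t powi b) \<noteq> 1"
  using generic_neq_1[of a b c 0] assms by (simp add: mult_ac)

text \<open>The left factor stands at \<open>u / p\<close> with negated modes, so the exponent is
  \<open>pair_char\<close> times -p^m (1 - (pq/t)^m) / (m (1 - p^m)). Its universal term gives the
  arguments \<open>p * t\<close> and \<open>p\<^sup>2 * q\<close> over the bases q, t, p; each
  weight gives one quotient over the base p.\<close>

lemma Phi_dual_Phi_contraction:
  assumes "is_partition \<xi>" "u \<noteq> 0"
  shows "contraction q t p (\<lambda>m. - Phi_modes q t r \<xi> (u / p) m) (Phi_modes q t r \<xi> u) = self_contraction \<xi>"
proof (rule contraction_eqI)
  let ?K = "\<lambda>m z :: complex. z ^ m"
  have nz1: "qpoch (p\<^sup>2 * q) [q, t, p] \<noteq> 0"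
  proof (rule qpoch3_nonzero[OF _ norms(3)])
    fix a b c :: nat
    show "p\<^sup>2 * q * q ^ a * t ^ b * p ^ c \<noteq> 1"
      using generic_p_monomial[of "int (c + 2)" "int (Suc a)" "int b"]
      unfolding power_int_of_nat by (simp add: power_add power2_eq_square mult_ac)
  qed
  have nz2: "qpoch (p\<^sup>2 * q / t * nek_weight q t \<xi> \<xi> c) [p] \<noteq> 0" for c
  proof (rule qpoch1_nonzero[OF _ norms(3)])
    fix k :: nat
    obtain a b where "nek_weight q t \<xi> \<xi> c = q powi a * t powi b" using nek_weight_monomial by blast
    then show "p\<^sup>2 * q / t * nek_weight q t \<xi> \<xi> c * p ^ k \<noteq> 1"
      using generic_p_monomial[of "int (k + 2)" "a + 1" "b - 1"]
      unfolding power_int_of_nat by (simp add: power_add power2_eq_square mult_ac power_int_add power_int_diff)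
  qed
  have E: "exp_continues UNIV 1 ?K (\<lambda>m. - (c ^ m / qpoch_denom bs m)) (qpoch c bs)"
    if "\<And>b. b \<in> set bs \<Longrightarrow> norm b < 1" for c bs
    by (rule exp_continues_qpoch) (rule that)
  have "exp_continues UNIV 1 ?K (\<lambda>m.
      (- ((p * t) ^ m / qpoch_denom [q, t, p] m) + - (- ((p\<^sup>2 * q) ^ m / qpoch_denom [q, t, p] m))) +
      (\<Sum>c\<in>nek_index \<xi> \<xi>. - ((p * nek_weight q t \<xi> \<xi> c) ^ m / qpoch_denom [p] m) +
          - (- ((p\<^sup>2 * q / t * nek_weight q t \<xi> \<xi> c) ^ m / qpoch_denom [p] m))))
     ((qpoch (p * t) [q, t, p] * inverse (qpoch (p\<^sup>2 * q) [q, t, p])) *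
      (\<Prod>c\<in>nek_index \<xi> \<xi>. qpoch (p * nek_weight q t \<xi> \<xi> c) [p] *
         inverse (qpoch (p\<^sup>2 * q / t * nek_weight q t \<xi> \<xi> c) [p])))"
    using norms nz1 nz2
    by (intro exp_continues_add exp_continues_sum exp_continues_uminus E) auto
  then show "exp_continues UNIV 1 ?K
     (\<lambda>m. - Phi_modes q t r \<xi> (u / p) (int m) * Phi_modes q t r \<xi> u (- int m) * comm q t p (int m))
     (self_contraction \<xi>)"
  proof (rule exp_continues_cong)
    fix m :: nat assume m: "m > 0"
    have p: "1 - p ^ m \<noteq> 0" "1 - q ^ m \<noteq> 0" "1 - t ^ m \<noteq> 0" using power_neq_1[OF m] norms by auto
    have "- Phi_modes q t r \<xi> (u / p) (int m) * Phi_modes q t r \<xi> u (- int m) * comm q t p (int m) =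
       - (pair_char \<xi> \<xi> m / of_nat m * p ^ m * ((1 - (p * q / t) ^ m) / (1 - p ^ m)))"
      using Phi_modes_product[OF assms(1,1) _ m, of "u / p" u] assms(2) by simp
    also have "\<dots> = - (p ^ m * pair_char \<xi> \<xi> m) / (of_nat m * (1 - p ^ m)) + (p\<^sup>2 * q / t) ^ m * pair_char \<xi> \<xi> m / (of_nat m * (1 - p ^ m))"
      using p m by (simp add: divide_simps power_mult_distrib power_divide power2_eq_square) (simp add: algebra_simps)
    also have "\<dots> = (- ((p * t) ^ m / qpoch_denom [q, t, p] m) + - (- ((p\<^sup>2 * q) ^ m / qpoch_denom [q, t, p] m))) +
      (\<Sum>c\<in>nek_index \<xi> \<xi>. - ((p * nek_weight q t \<xi> \<xi> c) ^ m / qpoch_denom [p] m) +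
          - (- ((p\<^sup>2 * q / t * nek_weight q t \<xi> \<xi> c) ^ m / qpoch_denom [p] m)))"
      unfolding sum.distrib minus_minus sum_negf power_mult_distrib[of p] power_mult_distrib[of "p\<^sup>2 * q / t"]
        sum_divide_distrib[symmetric] sum_distrib_left[symmetric] pair_char_def qpoch_denom_def
      using p m by (simp add: divide_simps power_mult_distrib power_divide) (simp add: algebra_simps)
    finally show "(- ((p * t) ^ m / qpoch_denom [q, t, p] m) + - (- ((p\<^sup>2 * q) ^ m / qpoch_denom [q, t, p] m))) +
      (\<Sum>c\<in>nek_index \<xi> \<xi>. - ((p * nek_weight q t \<xi> \<xi> c) ^ m / qpoch_denom [p] m) +
          - (- ((p\<^sup>2 * q / t * nek_weight q t \<xi> \<xi> c) ^ m / qpoch_denom [p] m))) =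
      - Phi_modes q t r \<xi> (u / p) (int m) * Phi_modes q t r \<xi> u (- int m) * comm q t p (int m)" by simp
  qed (simp add: self_contraction_def C_self_def divide_inverse)
qed


text \<open>The powers of \<open>u\<close> and \<open>v\<close> cancel. The shift of
  \<open>u\<close> by 1/p leaves \<open>p powi N\<close> per box, and the framing exponents
  \<open>N\<close> and \<open>- N - 1\<close> leave one inverse framing factor.\<close>

lemma t_star_t_plain:
  assumes "u \<noteq> 0" "v \<noteq> 0"
  shows "t_star q t r \<xi> u v N * t_plain q t r \<xi> v (u / p) N =
    (q * p powi N * r) ^ sum_list \<xi> * ((-1) ^ sum_list \<xi> / q ^ n_stat_conj \<xi> * t ^ n_stat \<xi>)"
proof -
  define k where "k = sum_list \<xi>"
  define f where "f = framing q t r \<xi>"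
  define U where "U = - u"
  define A where "A = U powi (N * int k)"
  have f0: "f \<noteq> 0" by (simp add: f_def framing_def)
  have U0: "U \<noteq> 0" "A \<noteq> 0" "v ^ k \<noteq> 0" "U ^ k \<noteq> 0" "p ^ k \<noteq> 0" "q ^ k \<noteq> 0" using assms by (auto simp: U_def A_def)
  have "- (N + 1) * int k = - (N * int k + int k)" by (simp add: algebra_simps)
  then have "(U / p) powi (- (N + 1) * int k) = inverse ((U / p) powi (N * int k + int k))"
    by (simp only: power_int_minus)
  also have "(U / p) powi (N * int k + int k) = (U / p) powi (N * int k) * (U / p) powi int k"
    using U0 by (simp add: power_int_add)
  also have "(U / p) powi (N * int k) = A / (p powi N) ^ k"
    unfolding A_def power_int_divide_distrib power_int_mult[of p] power_int_of_nat ..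
  also have "inverse (A / (p powi N) ^ k * (U / p) powi int k) = (p powi N) ^ k * p ^ k / (A * U ^ k)"
    by (simp add: power_divide)
  finally have e1: "(- (u / p)) powi (- (N + 1) * int k) = (p powi N) ^ k * p ^ k / (A * U ^ k)"
    by (simp add: U_def)
  have e2: "f powi N * f powi (- N - 1) = inverse f"
    using f0 power_int_add[of f N "- N - 1"] by (simp add: power_int_minus)
  have e3: "inverse f = (-1) ^ k / q ^ n_stat_conj \<xi> * t ^ n_stat \<xi> * r ^ k"
    by (simp add: f_def framing_def k_def power_int_minus field_simps flip: power_mult_distrib)
  have e4: "(v / q) powi (- int k) = q ^ k / v ^ k"
    by (simp add: power_int_minus power_divide)
  have "- v * (u / p) = v * U / p"
    by (simp add: U_def)
  then have e5: "(- v * (u / p)) ^ k = v ^ k * U ^ k / p ^ k"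
    by (simp only: power_divide power_mult_distrib)
  have "t_star q t r \<xi> u v N * t_plain q t r \<xi> v (u / p) N =
     (q ^ k / v ^ k) * A * (v ^ k * U ^ k / p ^ k) * ((p powi N) ^ k * p ^ k / (A * U ^ k)) *
       (f powi N * f powi (- N - 1))"
    unfolding t_star_def t_plain_def k_def[symmetric] f_def[symmetric] e1 e4 e5
    by (simp add: A_def U_def mult_ac)
  also have "(q ^ k / v ^ k) * A * (v ^ k * U ^ k / p ^ k) * ((p powi N) ^ k * p ^ k / (A * U ^ k)) = (q * p powi N) ^ k"
    using U0 by (simp add: power_mult_distrib)
  finally show ?thesis
    unfolding e2 e3 k_def by (simp add: power_mult_distrib mult_ac)
qed

lemma qpoch_p_nonzero:
  "qpoch (p * nek_weight q t \<xi> \<mu> c) [p] \<noteq> 0" "qpoch (p * q / t * nek_weight q t \<xi> \<mu> c * p) [p] \<noteq> 0"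
proof -
  obtain a b where w: "nek_weight q t \<xi> \<mu> c = q powi a * t powi b" using nek_weight_monomial by blast
  show "qpoch (p * nek_weight q t \<xi> \<mu> c) [p] \<noteq> 0"
  proof (rule qpoch1_nonzero[OF _ norms(3)])
    fix k :: nat
    show "p * nek_weight q t \<xi> \<mu> c * p ^ k \<noteq> 1"
      using generic_p_monomial[of "int (Suc k)" a b] w unfolding power_int_of_nat by (simp add: mult_ac)
  qed
  show "qpoch (p * q / t * nek_weight q t \<xi> \<mu> c * p) [p] \<noteq> 0"
  proof (rule qpoch1_nonzero[OF _ norms(3)])
    fix k :: nat
    show "p * q / t * nek_weight q t \<xi> \<mu> c * p * p ^ k \<noteq> 1"
      using generic_p_monomial[of "int (k + 2)" "a + 1" "b - 1"] w
      unfolding power_int_of_nat by (simp add: power_add power2_eq_square mult_ac power_int_add power_int_diff)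
  qed
qed

text \<open>A box-by-box identity in the two weights \<open>w1\<close>, \<open>w2\<close> of a box.
  The quotients over base \<open>p\<close> in the normalisations and in the contraction telescope to
  \<open>1 - p * q / t * w\<close>. The remaining factor \<open>- w2\<close> turns
  \<open>1 - w2\<close> from \<open>c_part\<close> into \<open>1 - q / t * w1\<close>, since the two
  weights multiply to \<open>t / q\<close>.\<close>

lemma self_scalar:
  assumes "is_partition \<xi>"
  shows "N_part q t p \<xi> * N_part' q t p \<xi> / (c_part q t \<xi> * c_part' q t \<xi>) * self_contraction \<xi> *
     ((-1) ^ sum_list \<xi> * q ^ n_stat_conj \<xi> * t ^ (n_stat \<xi> + sum_list \<xi>)) =
     C_self q t p * nek_ratio (\<lambda>y. 1 - y) \<xi> \<xi> 1"
proof -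
  define w1 w2 where "w1 s = nek_weight q t \<xi> \<xi> (Inl s)" and "w2 s = nek_weight q t \<xi> \<xi> (Inr s)" for s
  define F where "F w = qpoch (p * w) [p] / qpoch (p\<^sup>2 * q / t * w) [p]" for w
  let ?pq = "p * q / t"
  have w: "w1 s = q powi (- arm \<xi> s - 1) * t powi (- leg \<xi> s)"
    "w2 s = q powi arm \<xi> s * t powi (leg \<xi> s + 1)" for s
    by (simp_all add: w1_def w2_def nek_weight_def)
  have w0: "w1 s \<noteq> 0" "w2 s \<noteq> 0" for s by (simp_all add: w)
  have w12: "q / t * w1 s = 1 / w2 s" for s
    by (simp add: w power_int_minus power_int_diff power_int_add divide_simps)
  have sc: "self_contraction \<xi> = C_self q t p * (\<Prod>s\<in>boxes \<xi>. F (w1 s) * F (w2 s))"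
    unfolding self_contraction_def w F_def
    by (subst prod_nek_index_self[of "\<lambda>w. qpoch (p * w) [p] / qpoch (p\<^sup>2 * q / t * w) [p]"]) simp
  have np: "N_part q t p \<xi> = (\<Prod>s\<in>boxes \<xi>. qpoch (?pq * w2 s) [p] / qpoch (p * w2 s) [p])"
    unfolding N_part_def w by (intro prod.cong refl arg_cong2[of _ _ _ _ "(/)"] arg_cong2[of _ _ _ _ qpoch])
      (simp_all add: power_int_add)
  have np': "N_part' q t p \<xi> = (\<Prod>s\<in>boxes \<xi>. qpoch (?pq * w1 s) [p] / qpoch (p * w1 s) [p])"
    unfolding N_part'_def w by (intro prod.cong refl arg_cong2[of _ _ _ _ "(/)"] arg_cong2[of _ _ _ _ qpoch])
      (simp_all add: power_int_diff)
  have c: "c_part q t \<xi> = (\<Prod>s\<in>boxes \<xi>. 1 - w2 s)"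
    by (simp add: c_part_def w)
  have c': "c_part' q t \<xi> = (\<Prod>s\<in>boxes \<xi>. 1 - q / t * w2 s)"
    unfolding c_part'_def w by (intro prod.cong refl) (simp add: power_int_add)
  have al: "(-1) ^ sum_list \<xi> * q ^ n_stat_conj \<xi> * t ^ (n_stat \<xi> + sum_list \<xi>) = (\<Prod>s\<in>boxes \<xi>. - w2 s)"
    unfolding w by (rule prod_arm_leg[symmetric]) (use assms in auto)
  have R: "nek_ratio (\<lambda>y. 1 - y) \<xi> \<xi> 1 =
     (\<Prod>s\<in>boxes \<xi>. ((1 - ?pq * w1 s) * (1 - ?pq * w2 s)) / ((1 - q / t * w1 s) * (1 - q / t * w2 s)))"
    unfolding nek_ratio_def nek_eq_prod
    by (simp add: prod_nek_index_self[of "\<lambda>w. 1 - p * q / t * w", simplified] prod_nek_index_self[of "\<lambda>w. 1 - q / t * w", simplified]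
        w prod_dividef)
  have F: "qpoch (?pq * w) [p] / qpoch (p * w) [p] * F w = 1 - ?pq * w"
    if "qpoch (p * w) [p] \<noteq> 0" "qpoch (?pq * w * p) [p] \<noteq> 0" for w
  proof -
    have e1: "qpoch (?pq * w) [p] = (1 - ?pq * w) * qpoch (?pq * w * p) [p]"
      using qpoch_Cons_shift[of "[]" p "?pq * w"] norms by simp
    have e2: "p\<^sup>2 * q / t * w = ?pq * w * p" by (simp add: power2_eq_square)
    show ?thesis unfolding F_def e2 e1 using that by (simp del: qpoch.simps)
  qed
  have summand: "(qpoch (?pq * w2 s) [p] / qpoch (p * w2 s) [p]) * (qpoch (?pq * w1 s) [p] / qpoch (p * w1 s) [p]) /
      ((1 - w2 s) * (1 - q / t * w2 s)) * (F (w1 s) * F (w2 s)) * (- w2 s) =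
      ((1 - ?pq * w1 s) * (1 - ?pq * w2 s)) / ((1 - q / t * w1 s) * (1 - q / t * w2 s))" for s
  proof -
    have F1: "qpoch (?pq * w1 s) [p] / qpoch (p * w1 s) [p] * F (w1 s) = 1 - ?pq * w1 s"
      unfolding w1_def using qpoch_p_nonzero[of \<xi> \<xi> "Inl s"] by (intro F) auto
    have F2: "qpoch (?pq * w2 s) [p] / qpoch (p * w2 s) [p] * F (w2 s) = 1 - ?pq * w2 s"
      unfolding w2_def using qpoch_p_nonzero[of \<xi> \<xi> "Inr s"] by (intro F) auto
    have "a * b / (d * e) * (f1 * f2) * g = ((b * f1) * (a * f2)) / (d / g * e)" for a b d e f1 f2 g :: complex
      by simp
    then have "(qpoch (?pq * w2 s) [p] / qpoch (p * w2 s) [p]) * (qpoch (?pq * w1 s) [p] / qpoch (p * w1 s) [p]) /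
      ((1 - w2 s) * (1 - q / t * w2 s)) * (F (w1 s) * F (w2 s)) * (- w2 s) =
      (1 - ?pq * w1 s) * (1 - ?pq * w2 s) / ((1 - w2 s) / (- w2 s) * (1 - q / t * w2 s))"
      unfolding F1[symmetric] F2[symmetric] by blast
    also have "(1 - w2 s) / (- w2 s) = 1 - q / t * w1 s"
      unfolding w12 using w0(2)[of s] by (simp add: divide_simps)
    finally show ?thesis .
  qed
  show ?thesis
    unfolding sc np np' c c' al R
    unfolding summand[symmetric]
    unfolding prod.distrib prod_dividef
    by (simp only: divide_inverse inverse_mult_distrib mult_ac)
qed

lemma T_term_eq:
  assumes "is_partition \<xi>" "u \<noteq> 0" "v \<noteq> 0"
  shows "T_term q t p r N \<xi> u v =
    VOp (C_self q t p * (pstar q t p * p powi (N - 1) * r) ^ sum_list \<xi> * nek_ratio (\<lambda>y. 1 - y) \<xi> \<xi> 1) (T_modes \<xi> u)"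
proof -
  let ?k = "sum_list \<xi>"
  let ?s = "(-1 :: complex) ^ ?k" and ?Q = "q ^ n_stat_conj \<xi>" and ?T = "t ^ n_stat \<xi>"
  have "(?Q * N_part' q t p \<xi> * t_plain q t r \<xi> v (u / p) N / c_part' q t \<xi>) *
     (?Q * N_part q t p \<xi> * t_star q t r \<xi> u v N / c_part q t \<xi>) * self_contraction \<xi> =
     (N_part q t p \<xi> * N_part' q t p \<xi> / (c_part q t \<xi> * c_part' q t \<xi>) * self_contraction \<xi>) *
     (?Q * ?Q * (t_star q t r \<xi> u v N * t_plain q t r \<xi> v (u / p) N))"
    by (simp add: mult_ac)
  also have "\<dots> = (N_part q t p \<xi> * N_part' q t p \<xi> / (c_part q t \<xi> * c_part' q t \<xi>) * self_contraction \<xi> *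
     (?s * ?Q * t ^ (n_stat \<xi> + ?k))) * ((q * p powi N * r) ^ ?k / t ^ ?k)"
    unfolding t_star_t_plain[OF assms(2,3)] by (simp add: power_add mult_ac)
  \<comment> \<open>One extra \<open>t\<close> per box was lent to \<open>self_scalar\<close> and is
    returned here. The result is the instanton parameter of a single \<open>T\<close>.\<close>
  also have "(q * p powi N * r) ^ ?k / t ^ ?k = (pstar q t p * p powi (N - 1) * r) ^ ?k"
    by (simp add: pstar_def power_int_diff flip: power_divide)
  also note self_scalar[OF assms(1)]
  finally have "(?Q * N_part' q t p \<xi> * t_plain q t r \<xi> v (u / p) N / c_part' q t \<xi>) *
     (?Q * N_part q t p \<xi> * t_star q t r \<xi> u v N / c_part q t \<xi>) * self_contraction \<xi> =
     C_self q t p * (pstar q t p * p powi (N - 1) * r) ^ ?k * nek_ratio (\<lambda>y. 1 - y) \<xi> \<xi> 1"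
    by (simp only: mult_ac)
  then show ?thesis
    unfolding T_term_def vop_mult_def Phi_dual_def Phi_def
    by (simp only: vop.sel Phi_dual_Phi_contraction[OF assms(1,2)] T_modes_eq)
qed

section \<open>Normal ordering a product of several \<open>T\<close>\<close>

lemma pair_factor_qpoch_nonzero:
  assumes "\<And>a b :: int. z \<noteq> q powi a * t powi b"
  shows "pair_factor qpoch \<xi> \<mu> z \<noteq> 0"
proof -
  have mono: "z * (q powi a * t powi b) \<noteq> 1" for a b :: int
    using assms[of "- a" "- b"] by (auto simp: power_int_minus field_simps)
  have "qpoch (t * z) [q, t] \<noteq> 0"
    using mono[of "int _" "int (Suc _)"] unfolding power_int_of_nat
    by (intro qpoch2_nonzero) (auto simp: mult_ac)
  moreover have "z * nek_weight q t \<mu> \<xi> c \<noteq> 1" for c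
    using nek_weight_monomial[of \<mu> \<xi> c] mono by auto
  ultimately show ?thesis
    by (auto simp: pair_factor_def eq_commute[of 1])
qed

text \<open>The contraction exponent is additive in the modes of the right factor, so moving one
  \<open>T\<close> past an already ordered product yields a product of pairwise values. The downward
  induction follows \<open>foldr\<close>.\<close>

lemma T_product_eq:
  fixes N :: int and M :: nat and u v :: "nat \<Rightarrow> complex" and \<Lambda> :: "nat \<Rightarrow> nat list"
  assumes u: "\<And>i. i \<in> {1..M} \<Longrightarrow> u i \<noteq> 0" and v: "\<And>i. i \<in> {1..M} \<Longrightarrow> v i \<noteq> 0"
    and generic_u: "\<And>i j (a :: int) (b :: int). i \<in> {1..M} \<Longrightarrow> j \<in> {1..M} \<Longrightarrow> i \<noteq> j \<Longrightarrow>
      u i / u j \<noteq> q powi a * t powi b"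
    and part: "\<And>i. i \<in> {1..M} \<Longrightarrow> is_partition (\<Lambda> i)"
  defines "s \<equiv> \<lambda>i. C_self q t p * (pstar q t p * p powi (N - 1) * r) ^ sum_list (\<Lambda> i) *
        nek_ratio (\<lambda>y. 1 - y) (\<Lambda> i) (\<Lambda> i) 1"
    and "H \<equiv> \<lambda>i j. pair_value qpoch (\<Lambda> i) (\<Lambda> j) (u j / u i)"
  shows "T_product q t p r N M u v \<Lambda> =
    VOp ((\<Prod>i=1..M. s i) * (\<Prod>i=1..M. \<Prod>j=Suc i..M. H i j)) (\<lambda>m. \<Sum>i=1..M. T_modes (\<Lambda> i) (u i) m)"
proof -
  have "foldr (\<lambda>i. vop_mult q t p (T_term q t p r N (\<Lambda> i) (u i) (v i))) [a..<Suc M] (VOp 1 (\<lambda>m. 0)) =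
    VOp ((\<Prod>i=a..M. s i) * (\<Prod>i=a..M. \<Prod>j=Suc i..M. H i j)) (\<lambda>m. \<Sum>i=a..M. T_modes (\<Lambda> i) (u i) m)"
    if "a \<le> Suc M" "1 \<le> a" for a
    using that
  proof (induction rule: inc_induct)
    case (step a)
    have a: "a \<in> {1..M}" using step by auto
    have "exp_continues UNIV 1 (\<lambda>m z. z ^ m)
        (\<lambda>m. \<Sum>j=Suc a..M. T_modes (\<Lambda> a) (u a) (int m) * T_modes (\<Lambda> j) (u j) (- int m) * comm q t p (int m))
        (\<Prod>j=Suc a..M. H a j)"
      unfolding H_def
    proof (intro exp_continues_sum exp_continues_T_pair exp_continues_qpoch)
      fix j assume "j \<in> {Suc a..M}"
      then have j: "j \<in> {1..M}" "j \<noteq> a" using a by auto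
      show "pair_factor qpoch (\<Lambda> a) (\<Lambda> j) (u j / u a) \<noteq> 0"
        using generic_u[OF j(1) a j(2)] by (intro pair_factor_qpoch_nonzero) auto
      \<comment> \<open>\<open>q / t\<close> is itself a monomial, so this argument stays off the
        lattice of monomials in q and t.\<close>
      show "pair_factor qpoch (\<Lambda> a) (\<Lambda> j) (q / t * (u j / u a)) \<noteq> 0"
      proof (intro pair_factor_qpoch_nonzero notI)
        fix c d :: int assume "q / t * (u j / u a) = q powi c * t powi d"
        then have "u j / u a = q powi (c - 1) * t powi (d + 1)"
          by (simp add: power_int_diff power_int_add divide_simps mult_ac split: if_splits)
        then show False using generic_u[OF j(1) a j(2)] by blast
      qed
    qed (use a u part in auto)
    then have "contraction q t p (T_modes (\<Lambda> a) (u a)) (\<lambda>m. \<Sum>i=Suc a..M. T_modes (\<Lambda> i) (u i) m) = (\<Prod>j=Suc a..M. H a j)"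
      by (intro contraction_eqI) (simp add: sum_distrib_left sum_distrib_right)
    moreover have "[a..<Suc M] = a # [Suc a..<Suc M]"
      using step by (intro upt_conv_Cons) auto
    moreover have "T_term q t p r N (\<Lambda> a) (u a) (v a) = VOp (s a) (T_modes (\<Lambda> a) (u a))"
      unfolding s_def using a u v part by (intro T_term_eq) auto
    ultimately show ?case
      using step a by (simp add: vop_mult_def prod.atLeast_Suc_atMost sum.atLeast_Suc_atMost mult_ac del: upt_Suc)
  qed auto
  from this[of 1] show ?thesis
    unfolding T_product_def by simp
qed

lemma nek_mult: "nek (\<lambda>z. g z * h z) q t \<xi> \<mu> x = nek g q t \<xi> \<mu> x * nek h q t \<xi> \<mu> x"
  by (simp add: nek_eq_prod prod.distrib)

text \<open>Exchanging the partitions inverts the weights up to \<open>t / q\<close>, so each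
  argument becomes the inverse of one for the opposite pair.\<close>

lemma nek_reflect:
  assumes "x \<noteq> 0"
  shows "nek f q t \<xi> \<mu> x = nek (\<lambda>z. f (1 / z)) q t \<mu> \<xi> (q / (t * x))"
proof -
  have "nek f q t \<xi> \<mu> x = (\<Prod>c\<in>nek_index \<mu> \<xi>. f (x * (t / q / nek_weight q t \<mu> \<xi> c)))"
    unfolding nek_eq_prod by (subst prod_nek_index_swap) (simp add: nek_weight_swap)
  also have "\<dots> = (\<Prod>c\<in>nek_index \<mu> \<xi>. f (1 / (q / (t * x) * nek_weight q t \<mu> \<xi> c)))"
    by (intro prod.cong refl arg_cong[of _ _ f]) simp
  finally show ?thesis by (simp only: nek_eq_prod)
qed

text \<open>Inverting the argument of \<open>\<theta>\<close> costs a factor -1/z. In the ratio at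
  \<open>y / p\<close> and \<open>y\<close> everything in it cancels except one \<open>p\<close> per
  weight, and there are \<open>sum_list \<xi> + sum_list \<mu>\<close> weights.\<close>

lemma nek_theta_inverse:
  assumes \<theta>: "\<And>z. z \<noteq> 0 \<Longrightarrow> \<theta> (1 / z) = - \<theta> z / z" and "y \<noteq> 0"
    and "is_partition \<xi>" "is_partition \<mu>"
  shows "nek \<theta> q t \<mu> \<xi> (y / p) / nek \<theta> q t \<mu> \<xi> y =
    inverse p ^ (sum_list \<xi> + sum_list \<mu>) * nek_ratio \<theta> \<xi> \<mu> (1 / y)"
proof -
  let ?w = "nek_weight q t \<mu> \<xi>"
  have "nek_ratio \<theta> \<xi> \<mu> (1 / y) =
      nek (\<lambda>z. \<theta> (1 / z)) q t \<mu> \<xi> (y / p) / nek (\<lambda>z. \<theta> (1 / z)) q t \<mu> \<xi> y"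
    unfolding nek_ratio_def
    using assms(2) nek_reflect[of "p * q * (1 / y) / t" \<theta> \<xi> \<mu>] nek_reflect[of "q * (1 / y) / t" \<theta> \<xi> \<mu>] by simp
  also have "\<dots> = (\<Prod>c\<in>nek_index \<mu> \<xi>. \<theta> (1 / (y / p * ?w c)) / \<theta> (1 / (y * ?w c)))"
    by (simp only: nek_eq_prod prod_dividef)
  also have "\<dots> = (\<Prod>c\<in>nek_index \<mu> \<xi>. p * (\<theta> (y / p * ?w c) / \<theta> (y * ?w c)))"
  proof (intro prod.cong refl)
    fix c
    have w: "?w c \<noteq> 0" by (simp add: nek_weight_nonzero)
    have "\<theta> (1 / (y / p * ?w c)) = - \<theta> (y / p * ?w c) / (y / p * ?w c)"
      "\<theta> (1 / (y * ?w c)) = - \<theta> (y * ?w c) / (y * ?w c)"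
      using assms(2) w by (intro \<theta>; simp)+
    then show "\<theta> (1 / (y / p * ?w c)) / \<theta> (1 / (y * ?w c)) = p * (\<theta> (y / p * ?w c) / \<theta> (y * ?w c))"
      using w assms(2) by simp
  qed
  also have "\<dots> = p ^ (sum_list \<xi> + sum_list \<mu>) * (nek \<theta> q t \<mu> \<xi> (y / p) / nek \<theta> q t \<mu> \<xi> y)"
    by (simp add: nek_eq_prod prod.distrib prod_dividef card_nek_index assms add_ac)
  finally show ?thesis by (simp add: power_inverse)
qed

text \<open>The value of a pair of empty partitions; being independent of the partitions, it goes
  into the prefactor.\<close>

definition pair_head :: "(complex \<Rightarrow> complex list \<Rightarrow> complex) \<Rightarrow> complex \<Rightarrow> complex" where
  "pair_head V y = V (t / p * y) [q, t] * V (p * q * y) [q, t] / (V (t * y) [q, t] * V (q * y) [q, t])"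

lemma pair_value_eq:
  "pair_value V \<xi> \<mu> y = pair_head V y *
     (nek (\<lambda>z. V z []) q t \<mu> \<xi> (y / p) * nek (\<lambda>z. V z []) q t \<mu> \<xi> (p * q / t * y) /
      (nek (\<lambda>z. V z []) q t \<mu> \<xi> y * nek (\<lambda>z. V z []) q t \<mu> \<xi> (q / t * y)))"
proof -
  have "t * (y / p) = t / p * y" "t * (p * q / t * y) = p * q * y" "t * (q / t * y) = q * y" by simp_all
  then show ?thesis
    unfolding pair_value_def pair_factor_def pair_head_def nek_eq_prod
    by (simp only: divide_inverse inverse_mult_distrib mult_ac)
qed

text \<open>Both parts of the theorem are instances of the next two lemmas: \<open>V = 1\<close> and \<open>\<theta>(z) = 1 - z\<close> give the vacuum
  expectation value, \<open>V z [] = (zQ;Q)\<^sub>\<infinity>\<close> and \<open>\<theta> = \<theta>\<^sub>Q\<close> the trace.\<close>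

lemma pair_value_self:
  assumes \<theta>: "\<And>z. \<theta> z = (1 - z) * V z [] * V (1 / z) []"
  shows "nek_ratio (\<lambda>y. 1 - y) \<xi> \<xi> 1 * pair_value V \<xi> \<xi> 1 = pair_head V 1 * nek_ratio \<theta> \<xi> \<xi> 1"
proof -
  let ?h = "\<lambda>z. V z []" and ?k = "\<lambda>z. V (1 / z) []" and ?l = "\<lambda>y :: complex. 1 - y"
  have th: "\<theta> = (\<lambda>z. ?l z * ?h z * ?k z)" using \<theta> by auto
  \<comment> \<open>For equal partitions at ratio 1, reflection moves two of the four Nekrasov
    factors to the arguments of the other two and supplies the missing
    \<open>V (1 / z) []\<close>.\<close>
  have 1: "nek ?h q t \<xi> \<xi> (1 / p) = nek ?k q t \<xi> \<xi> (p * q / t)"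
    using nek_reflect[of "1 / p" ?h \<xi> \<xi>] by (simp add: mult_ac)
  have 2: "nek ?h q t \<xi> \<xi> 1 = nek ?k q t \<xi> \<xi> (q / t)"
    using nek_reflect[of 1 ?h \<xi> \<xi>] by simp
  show ?thesis
    unfolding pair_value_eq nek_ratio_def th nek_mult mult_1_right 1 2
    by (simp only: divide_inverse inverse_mult_distrib mult_ac)
qed

lemma pair_value_reflect:
  assumes \<theta>: "\<And>z. \<theta> z = (1 - z) * V z [] * V (1 / z) []" and "y \<noteq> 0"
    and "is_partition \<xi>" "is_partition \<mu>"
  shows "pair_value qpoch \<xi> \<mu> y * (pair_value V \<xi> \<mu> y * pair_value V \<mu> \<xi> (1 / y)) =
    pair_head qpoch y * pair_head V y * pair_head V (1 / y) * inverse p ^ (sum_list \<xi> + sum_list \<mu>) *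
    (nek_ratio \<theta> \<xi> \<mu> (1 / y) * nek_ratio \<theta> \<mu> \<xi> y)"
proof -
  let ?h = "\<lambda>z. V z []" and ?k = "\<lambda>z. V (1 / z) []" and ?l = "\<lambda>z. qpoch z []"
  have th: "\<theta> = (\<lambda>z. ?l z * ?h z * ?k z)" using \<theta> by auto
  have inv: "\<theta> (1 / z) = - \<theta> z / z" if "z \<noteq> 0" for z
    using that unfolding \<theta> by (simp add: divide_simps) (simp add: algebra_simps)
  \<comment> \<open>All four factors of the reversed pair are reflected onto the pair at
    \<open>y\<close>; combined with the factors \<open>1 - z\<close> and \<open>V z []\<close> there
    they complete \<open>\<theta>\<close>.\<close>
  have r: "nek ?h q t \<xi> \<mu> (1 / y / p) = nek ?k q t \<mu> \<xi> (p * q / t * y)"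
    "nek ?h q t \<xi> \<mu> (p * q / t * (1 / y)) = nek ?k q t \<mu> \<xi> (y / p)"
    "nek ?h q t \<xi> \<mu> (1 / y) = nek ?k q t \<mu> \<xi> (q / t * y)"
    "nek ?h q t \<xi> \<mu> (q / t * (1 / y)) = nek ?k q t \<mu> \<xi> y"
    using assms(2) nek_reflect[of "1 / y / p" ?h \<xi> \<mu>] nek_reflect[of "p * q / t * (1 / y)" ?h \<xi> \<mu>]
      nek_reflect[of "1 / y" ?h \<xi> \<mu>] nek_reflect[of "q / t * (1 / y)" ?h \<xi> \<mu>]
    by (simp_all add: mult_ac)
  have "pair_value qpoch \<xi> \<mu> y * (pair_value V \<xi> \<mu> y * pair_value V \<mu> \<xi> (1 / y)) =
    pair_head qpoch y * pair_head V y * pair_head V (1 / y) *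
    ((nek \<theta> q t \<mu> \<xi> (y / p) / nek \<theta> q t \<mu> \<xi> y) *
     (nek \<theta> q t \<mu> \<xi> (p * q / t * y) / nek \<theta> q t \<mu> \<xi> (q / t * y)))"
    unfolding pair_value_eq r th nek_mult
    by (simp only: divide_inverse inverse_mult_distrib mult_ac)
  also have "nek \<theta> q t \<mu> \<xi> (p * q / t * y) / nek \<theta> q t \<mu> \<xi> (q / t * y) = nek_ratio \<theta> \<mu> \<xi> y"
    by (simp add: nek_ratio_def)
  also have "nek \<theta> q t \<mu> \<xi> (y / p) / nek \<theta> q t \<mu> \<xi> y =
      inverse p ^ (sum_list \<xi> + sum_list \<mu>) * nek_ratio \<theta> \<xi> \<mu> (1 / y)"
    by (rule nek_theta_inverse[OF inv assms(2-4)])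
  finally show ?thesis
    by (simp only: mult_ac)
qed

end

section \<open>Traces over the Fock space\<close>

definition mset_fact :: "nat multiset \<Rightarrow> complex" where
  "mset_fact \<rho> = (\<Prod>m\<in>set_mset \<rho>. fact (count \<rho> m))"

definition mset_monomial :: "(nat \<Rightarrow> complex) \<Rightarrow> nat multiset \<Rightarrow> complex" where
  "mset_monomial b \<rho> = (\<Prod>m\<in>#\<rho>. b m)"

lemma mset_fact_superset:
  "finite S \<Longrightarrow> set_mset \<rho> \<subseteq> S \<Longrightarrow> mset_fact \<rho> = (\<Prod>m\<in>S. fact (count \<rho> m))"
  unfolding mset_fact_def by (intro prod.mono_neutral_left) (auto simp: not_in_iff)

lemma mset_monomial_superset:
  assumes "finite S" "set_mset \<rho> \<subseteq> S"
  shows "mset_monomial b \<rho> = (\<Prod>m\<in>S. b m ^ count \<rho> m)"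
proof -
  have "mset_monomial b \<rho> = (\<Prod>m\<in>set_mset \<rho>. b m ^ count \<rho> m)"
    unfolding mset_monomial_def
  proof (induction \<rho>)
    case (add x \<rho>)
    have "(\<Prod>m\<in>insert x (set_mset \<rho>). b m ^ count (add_mset x \<rho>) m) =
        b x ^ Suc (count \<rho> x) * (\<Prod>m\<in>set_mset \<rho> - {x}. b m ^ count \<rho> m)"
      by (subst prod.insert_remove) (auto intro!: prod.cong)
    also have "\<dots> = b x * (b x ^ count \<rho> x * (\<Prod>m\<in>set_mset \<rho> - {x}. b m ^ count \<rho> m))"
      by simp
    also have "b x ^ count \<rho> x * (\<Prod>m\<in>set_mset \<rho> - {x}. b m ^ count \<rho> m) = (\<Prod>m\<in>set_mset \<rho>. b m ^ count \<rho> m)"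
      by (cases "x \<in># \<rho>") (simp_all add: prod.remove not_in_iff)
    finally show ?case using add by simp
  qed simp
  also have "\<dots> = (\<Prod>m\<in>S. b m ^ count \<rho> m)"
    using assms by (intro prod.mono_neutral_left) (auto simp: not_in_iff)
  finally show ?thesis .
qed

lemma mset_fact_nonzero [simp]: "mset_fact \<rho> \<noteq> 0"
  by (simp add: mset_fact_def)

lemma mset_fact_add: "mset_fact (add_mset m \<rho>) = of_nat (Suc (count \<rho> m)) * mset_fact \<rho>"
proof -
  let ?S = "insert m (set_mset \<rho>)"
  have "mset_fact (add_mset m \<rho>) = fact (Suc (count \<rho> m)) * (\<Prod>x\<in>?S - {m}. fact (count \<rho> x))"
    by (subst mset_fact_superset[of ?S], simp, simp, subst prod.remove[of _ m]) (auto intro!: prod.cong)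
  moreover have "mset_fact \<rho> = fact (count \<rho> m) * (\<Prod>x\<in>?S - {m}. fact (count \<rho> x))"
    by (subst mset_fact_superset[of ?S], simp, simp add: subset_insertI, subst prod.remove[of _ m]) auto
  ultimately show ?thesis by (simp only: fact_Suc mult.assoc of_nat_mult)
qed

lemma mset_fact_remove:
  assumes "m \<in># \<rho>"
  shows "mset_fact \<rho> = of_nat (count \<rho> m) * mset_fact (\<rho> - {#m#})"
  using assms mset_fact_add[of m "\<rho> - {#m#}"] by (simp del: of_nat_Suc)

lemma mset_monomial_remove:
  assumes "m \<in># \<rho>"
  shows "b m * mset_monomial b (\<rho> - {#m#}) = mset_monomial b \<rho>"
  using assms by (metis insert_DiffM mset_monomial_def image_mset_add_mset prod_mset.add_mset)

text \<open>Multisets supported in \<open>S\<close> are functions on \<open>S\<close>, so sums over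
  them can factor over the modes via \<open>PiE\<close>.\<close>

lemma bij_betw_count:
  assumes "finite S"
  shows "bij_betw (\<lambda>\<rho>. restrict (count \<rho>) S)
    {\<rho>. set_mset \<rho> \<subseteq> S \<and> (\<forall>m\<in>S. count \<rho> m \<in> B m)} (Pi\<^sub>E S B)"
proof -
  have c: "count (\<Sum>m\<in>S. replicate_mset (f m) m) x = (if x \<in> S then f x else 0)" for f x
    using assms by (simp add: count_sum if_distrib cong: if_cong)
  show ?thesis
    by (rule bij_betw_byWitness[where f' = "\<lambda>f. \<Sum>m\<in>S. replicate_mset (f m) m"])
       (auto simp: c multiset_eq_iff fun_eq_iff not_in_iff PiE_def extensional_def
          simp flip: count_greater_zero_iff split: if_splits)
qed

lemma submultisets_eq:
  "{\<rho>. \<rho> \<subseteq># \<mu>} = {\<rho>. set_mset \<rho> \<subseteq> set_mset \<mu> \<and> (\<forall>m\<in>set_mset \<mu>. count \<rho> m \<in> {..count \<mu> m})}"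
proof (intro set_eqI iffI; clarify)
  fix \<rho> assume "\<rho> \<subseteq># \<mu>"
  then show "set_mset \<rho> \<subseteq> set_mset \<mu> \<and> (\<forall>m\<in>set_mset \<mu>. count \<rho> m \<in> {..count \<mu> m})"
    by (auto simp: mset_subset_eq_count dest: mset_subset_eqD)
next
  fix \<rho> assume *: "set_mset \<rho> \<subseteq> set_mset \<mu>" "\<forall>m\<in>set_mset \<mu>. count \<rho> m \<in> {..count \<mu> m}"
  show "\<rho> \<subseteq># \<mu>"
  proof (rule mset_subset_eqI)
    fix m show "count \<rho> m \<le> count \<mu> m"
    proof (cases "m \<in># \<mu>")
      case False
      then have "m \<notin># \<rho>" using * by blast
      then show ?thesis by (simp add: not_in_iff)
    qed (use * in auto)
  qed
qed

lemma finite_submultisets [simp]: "finite {\<rho>. \<rho> \<subseteq># (\<mu> :: nat multiset)}"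
  unfolding submultisets_eq
  using bij_betw_finite[OF bij_betw_count[of "set_mset \<mu>" "\<lambda>m. {..count \<mu> m}"]]
  by (simp add: finite_PiE)

lemma finite_submultisets_size [simp]: "finite {\<rho>. \<rho> \<subseteq># (\<mu> :: nat multiset) \<and> size \<rho> = k}"
  by (rule finite_subset[OF _ finite_submultisets[of \<mu>]]) auto

text \<open>A multinomial expansion. Pairs of an element \<open>m\<close> and a rest
  \<open>\<rho>\<close> correspond to pairs of the whole multiset \<open>\<sigma>\<close> and an
  element of it; changing weights from \<open>\<rho>\<close> to \<open>\<sigma>\<close> brings in
  \<open>count \<sigma> m\<close>, and these multiplicities add up to \<open>Suc k\<close>.\<close>

lemma creation_power:
  assumes step: "\<And>g \<nu>. 0 \<notin># \<nu> \<Longrightarrow> A g \<nu> = (\<Sum>m\<in>set_mset \<nu>. b m * g (\<nu> - {#m#}))"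
    and "0 \<notin># \<nu>"
  shows "(A ^^ k) g \<nu> =
    fact k * (\<Sum>\<rho> | \<rho> \<subseteq># \<nu> \<and> size \<rho> = k. mset_monomial b \<rho> / mset_fact \<rho> * g (\<nu> - \<rho>))"
  using assms(2)
proof (induction k arbitrary: \<nu>)
  case 0
  have "{\<rho>. \<rho> \<subseteq># \<nu> \<and> size \<rho> = 0} = {{#}}" by auto
  then show ?case by (simp add: mset_monomial_def mset_fact_def)
next
  case (Suc k)
  let ?W = "\<lambda>\<rho>. mset_monomial b \<rho> / mset_fact \<rho>"
  have reinsert: "add_mset m (\<nu> - {#m#}) = \<nu>" if "m \<in># \<sigma>" "\<sigma> \<subseteq># \<nu>" for m :: nat and \<sigma>
    using that by (simp add: mset_subset_eqD)
  have "(A ^^ Suc k) g \<nu> = (\<Sum>m\<in>set_mset \<nu>. b m * (A ^^ k) g (\<nu> - {#m#}))"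
    using step[OF Suc.prems] by simp
  also have "\<dots> = (\<Sum>m\<in>set_mset \<nu>. b m * (fact k *
      (\<Sum>\<rho> | \<rho> \<subseteq># \<nu> - {#m#} \<and> size \<rho> = k. ?W \<rho> * g (\<nu> - {#m#} - \<rho>))))"
    by (intro sum.cong refl arg_cong2[of _ _ _ _ "(*)"] Suc.IH) (use Suc.prems in \<open>auto dest: in_diffD\<close>)
  also have "\<dots> = fact k * (\<Sum>(m, \<rho>)\<in>(SIGMA m:set_mset \<nu>. {\<rho>. \<rho> \<subseteq># \<nu> - {#m#} \<and> size \<rho> = k}).
      b m * ?W \<rho> * g (\<nu> - {#m#} - \<rho>))"
    by (simp add: sum.Sigma[symmetric] sum_distrib_left mult_ac)
  also have "(\<Sum>(m, \<rho>)\<in>(SIGMA m:set_mset \<nu>. {\<rho>. \<rho> \<subseteq># \<nu> - {#m#} \<and> size \<rho> = k}).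
      b m * ?W \<rho> * g (\<nu> - {#m#} - \<rho>)) =
     (\<Sum>(\<sigma>, m)\<in>(SIGMA \<sigma>:{\<sigma>. \<sigma> \<subseteq># \<nu> \<and> size \<sigma> = Suc k}. set_mset \<sigma>). b m * ?W (\<sigma> - {#m#}) * g (\<nu> - \<sigma>))"
  proof (rule sum.reindex_bij_witness[of _ "\<lambda>(\<sigma>, m). (m, \<sigma> - {#m#})" "\<lambda>(m, \<rho>). (add_mset m \<rho>, m)"], goal_cases)
    case (5 a)
    then show ?case by (auto simp: insert_subset_eq_iff)
  qed (auto simp: insert_subset_eq_iff size_Diff_singleton subset_eq_diff_conv reinsert dest: mset_subset_eqD)
  also have "\<dots> = (\<Sum>\<sigma> | \<sigma> \<subseteq># \<nu> \<and> size \<sigma> = Suc k. \<Sum>m\<in>set_mset \<sigma>. of_nat (count \<sigma> m) * (?W \<sigma> * g (\<nu> - \<sigma>)))"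
  proof (subst sum.Sigma[symmetric]; (intro ballI sum.cong refl)?)
    fix \<sigma> :: "nat multiset" and m :: nat assume m: "m \<in># \<sigma>"
    have "b m * ?W (\<sigma> - {#m#}) = of_nat (count \<sigma> m) * ?W \<sigma>"
      using m mset_fact_remove[OF m] mset_monomial_remove[OF m, of b] by (simp add: count_eq_zero_iff)
    then show "b m * ?W (\<sigma> - {#m#}) * g (\<nu> - \<sigma>) = of_nat (count \<sigma> m) * (?W \<sigma> * g (\<nu> - \<sigma>))"
      by simp
  qed auto
  also have "\<dots> = (\<Sum>\<sigma> | \<sigma> \<subseteq># \<nu> \<and> size \<sigma> = Suc k. of_nat (Suc k) * (?W \<sigma> * g (\<nu> - \<sigma>)))"
  proof (intro sum.cong refl)
    fix \<sigma> assume "\<sigma> \<in> {\<sigma>. \<sigma> \<subseteq># \<nu> \<and> size \<sigma> = Suc k}"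
    then have "(\<Sum>m\<in>set_mset \<sigma>. count \<sigma> m) = Suc k"
      by (simp add: size_multiset_overloaded_eq)
    then have "(\<Sum>m\<in>set_mset \<sigma>. of_nat (count \<sigma> m) :: complex) = of_nat (Suc k)"
      by (simp only: of_nat_sum[symmetric])
    then show "(\<Sum>m\<in>set_mset \<sigma>. of_nat (count \<sigma> m) * (?W \<sigma> * g (\<nu> - \<sigma>))) =
        of_nat (Suc k) * (?W \<sigma> * g (\<nu> - \<sigma>))"
      by (simp only: sum_distrib_right[symmetric])
  qed
  finally show ?case
    by (simp add: sum_distrib_left mult_ac)
qed

text \<open>Vanishing off the submultisets of \<open>\<mu>\<close> makes the sum over modes finite
  and is inherited by every power. The quotient of \<open>mset_fact\<close> values is a product of
  binomial coefficients.\<close>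

lemma annihilation_power:
  assumes step: "\<And>g \<nu>. (\<And>\<sigma>. \<not> \<sigma> \<subseteq># \<mu> \<Longrightarrow> g \<sigma> = 0) \<Longrightarrow>
      A g \<nu> = (\<Sum>m\<in>set_mset (\<mu> - \<nu>). a m * of_nat (Suc (count \<nu> m)) * g (add_mset m \<nu>))"
  shows "(A ^^ k) (ket \<mu>) \<nu> = (if \<nu> \<subseteq># \<mu> \<and> size (\<mu> - \<nu>) = k
    then fact k * mset_monomial a (\<mu> - \<nu>) * (mset_fact \<mu> / (mset_fact \<nu> * mset_fact (\<mu> - \<nu>))) else 0)"
proof (induction k arbitrary: \<nu>)
  case 0
  have "\<nu> = \<mu>" if "\<nu> \<subseteq># \<mu>" "size (\<mu> - \<nu>) = 0"
    using that by (metis diff_empty mset_subset_eq_exists_conv size_eq_0_iff_empty add.right_neutral add_diff_cancel_left')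
  then show ?case by (auto simp: ket_def mset_monomial_def mset_fact_def)
next
  case (Suc k)
  let ?C = "\<lambda>\<nu>. mset_monomial a (\<mu> - \<nu>) * (mset_fact \<mu> / (mset_fact \<nu> * mset_fact (\<mu> - \<nu>)))"
  have "(A ^^ Suc k) (ket \<mu>) \<nu> =
    (\<Sum>m\<in>set_mset (\<mu> - \<nu>). a m * of_nat (Suc (count \<nu> m)) * (A ^^ k) (ket \<mu>) (add_mset m \<nu>))"
    unfolding funpow.simps o_def by (rule step) (simp add: Suc.IH)
  also have "\<dots> = (if \<nu> \<subseteq># \<mu> \<and> size (\<mu> - \<nu>) = Suc k then fact (Suc k) * ?C \<nu> else 0)"
  proof (cases "\<nu> \<subseteq># \<mu> \<and> size (\<mu> - \<nu>) = Suc k")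
    case True
    have each: "a m * of_nat (Suc (count \<nu> m)) * (A ^^ k) (ket \<mu>) (add_mset m \<nu>) =
        of_nat (count (\<mu> - \<nu>) m) * (fact k * ?C \<nu>)" if m: "m \<in># \<mu> - \<nu>" for m
    proof -
      have sub: "add_mset m \<nu> \<subseteq># \<mu>"
        using m True by (metis add_mset_add_single mset_subset_eq_mono_add_left_cancel single_subset_iff
            subset_mset.add_diff_inverse)
      have diff: "\<mu> - add_mset m \<nu> = \<mu> - \<nu> - {#m#}" by simp
      have "size (\<mu> - \<nu> - {#m#}) = k"
        unfolding size_Diff_singleton[OF m] using True by simp
      then have "size (\<mu> - add_mset m \<nu>) = k"
        unfolding diff .
      then have e1: "(A ^^ k) (ket \<mu>) (add_mset m \<nu>) = fact k * ?C (add_mset m \<nu>)"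
        using sub by (simp add: Suc.IH)
      have e2: "a m * of_nat (Suc (count \<nu> m)) * ?C (add_mset m \<nu>) = of_nat (count (\<mu> - \<nu>) m) * ?C \<nu>"
      proof -
        have "a m * of_nat (Suc (count \<nu> m)) * ?C (add_mset m \<nu>) =
            (a m * mset_monomial a (\<mu> - \<nu> - {#m#})) * (mset_fact \<mu> / (mset_fact \<nu> * mset_fact (\<mu> - \<nu> - {#m#})))"
          unfolding diff mset_fact_add by (simp del: of_nat_Suc)
        also have "mset_fact (\<mu> - \<nu> - {#m#}) = mset_fact (\<mu> - \<nu>) / of_nat (count (\<mu> - \<nu>) m)"
          using mset_fact_remove[OF m] m by (simp add: count_eq_zero_iff field_simps del: count_diff)
        finally show ?thesis
          unfolding mset_monomial_remove[OF m] using m by (simp add: count_eq_zero_iff del: count_diff)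
      qed
      have "x * (y * z) = w * (y * c)" if "x * z = w * c" for x y z w c :: complex
        using that by (metis mult.left_commute)
      from this[OF e2] show ?thesis unfolding e1 by (simp only: mult.assoc)
    qed
    have "(\<Sum>m\<in>set_mset (\<mu> - \<nu>). a m * of_nat (Suc (count \<nu> m)) * (A ^^ k) (ket \<mu>) (add_mset m \<nu>)) =
        (\<Sum>m\<in>set_mset (\<mu> - \<nu>). of_nat (count (\<mu> - \<nu>) m) * (fact k * ?C \<nu>))"
      by (intro sum.cong refl each)
    also have "\<dots> = of_nat (\<Sum>m\<in>set_mset (\<mu> - \<nu>). count (\<mu> - \<nu>) m) * (fact k * ?C \<nu>)"
      by (simp only: of_nat_sum sum_distrib_right)
    also have "(\<Sum>m\<in>set_mset (\<mu> - \<nu>). count (\<mu> - \<nu>) m) = Suc k"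
      using True size_multiset_overloaded_eq[of "\<mu> - \<nu>"] by simp
    finally show ?thesis using True by simp
  next
    case False
    have "(A ^^ k) (ket \<mu>) (add_mset m \<nu>) = 0" if m: "m \<in># \<mu> - \<nu>" for m
    proof -
      have "Suc (size (\<mu> - \<nu> - {#m#})) = size (\<mu> - \<nu>)"
        using m by (rule size_Suc_Diff1)
      moreover have "\<mu> - add_mset m \<nu> = \<mu> - \<nu> - {#m#}" by simp
      moreover have "\<nu> \<subseteq># \<mu>" if "add_mset m \<nu> \<subseteq># \<mu>"
        using that by (metis mset_subset_eq_add_right add_mset_add_single union_commute subset_mset.order_trans mset_subset_eq_add_left)
      ultimately have "\<not> (add_mset m \<nu> \<subseteq># \<mu> \<and> size (\<mu> - add_mset m \<nu>) = k)"
        using False by metis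
      then show ?thesis unfolding Suc.IH by (rule if_not_P)
    qed
    then show ?thesis unfolding if_not_P[OF False] by (intro sum.neutral) simp
  qed
  finally show ?case by (simp only: mult.assoc)
qed

lemma op_exp_creation:
  assumes step: "\<And>g \<nu>. 0 \<notin># \<nu> \<Longrightarrow> A g \<nu> = (\<Sum>m\<in>set_mset \<nu>. b m * g (\<nu> - {#m#}))"
    and "0 \<notin># \<nu>"
  shows "op_exp A g \<nu> = (\<Sum>\<rho> | \<rho> \<subseteq># \<nu>. mset_monomial b \<rho> / mset_fact \<rho> * g (\<nu> - \<rho>))"
proof -
  let ?f = "\<lambda>\<rho>. mset_monomial b \<rho> / mset_fact \<rho> * g (\<nu> - \<rho>)"
  have "(\<Sum>k. (A ^^ k) g \<nu> / fact k) = (\<Sum>k. \<Sum>\<rho> | \<rho> \<subseteq># \<nu> \<and> size \<rho> = k. ?f \<rho>)"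
    by (simp add: creation_power[OF step assms(2)])
  also have "\<dots> = (\<Sum>k\<le>size \<nu>. \<Sum>\<rho> | \<rho> \<subseteq># \<nu> \<and> size \<rho> = k. ?f \<rho>)"
  proof (rule suminf_finite)
    fix k assume "k \<notin> {..size \<nu>}"
    then have *: "{\<rho>. \<rho> \<subseteq># \<nu> \<and> size \<rho> = k} = {}" using size_mset_mono by auto
    show "(\<Sum>\<rho> | \<rho> \<subseteq># \<nu> \<and> size \<rho> = k. ?f \<rho>) = 0" by (simp only: * sum.empty)
  qed simp
  also have "\<dots> = (\<Sum>\<rho> | \<rho> \<subseteq># \<nu>. ?f \<rho>)"
    using sum.group[of "{\<rho>. \<rho> \<subseteq># \<nu>}" "{..size \<nu>}" size ?f] size_mset_mono by auto
  finally show ?thesis by (simp add: op_exp_def)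
qed

lemma op_exp_annihilation:
  assumes step: "\<And>g \<nu>. (\<And>\<sigma>. \<not> \<sigma> \<subseteq># \<mu> \<Longrightarrow> g \<sigma> = 0) \<Longrightarrow>
      A g \<nu> = (\<Sum>m\<in>set_mset (\<mu> - \<nu>). a m * of_nat (Suc (count \<nu> m)) * g (add_mset m \<nu>))"
    and "\<nu> \<subseteq># \<mu>"
  shows "op_exp A (ket \<mu>) \<nu> =
    mset_monomial a (\<mu> - \<nu>) * (mset_fact \<mu> / (mset_fact \<nu> * mset_fact (\<mu> - \<nu>)))"
proof -
  have "(\<Sum>k. (A ^^ k) (ket \<mu>) \<nu> / fact k) = (\<Sum>k\<in>{size (\<mu> - \<nu>)}. (A ^^ k) (ket \<mu>) \<nu> / fact k)"
    by (rule suminf_finite) (auto simp: annihilation_power[OF step])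
  then show ?thesis
    using assms(2) by (simp add: op_exp_def annihilation_power[OF step])
qed

section \<open>Summation over occupation numbers\<close>

lemma infsum_tendsto_exhaustion:
  fixes f :: "'a \<Rightarrow> complex"
  assumes "(\<lambda>x. norm (f x)) summable_on A" "\<And>K. S K \<subseteq> A" "incseq S" "A \<subseteq> (\<Union>K. S K)"
  shows "(\<lambda>K :: nat. infsum f (S K)) \<longlonglongrightarrow> infsum f A"
proof (rule LIMSEQ_I)
  fix e :: real assume e: "e > 0"
  let ?n = "\<lambda>x. norm (f x)"
  have sn: "?n summable_on B" if "B \<subseteq> A" for B
    using assms(1) that by (rule summable_on_subset_banach)
  have sf: "f summable_on B" if "B \<subseteq> A" for B
    using sn[OF that] by (rule abs_summable_summable)
  obtain F where F: "finite F" "F \<subseteq> A" "dist (sum ?n F) (infsum ?n A) \<le> e / 2"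
    using has_sum_finite_approximation[OF has_sum_infsum[OF assms(1)], of "e / 2"] e by auto
  have "\<exists>K. x \<in> S K" if "x \<in> F" for x using that F(2) assms(4) by blast
  then obtain k where k: "\<And>x. x \<in> F \<Longrightarrow> x \<in> S (k x)" by metis
  have "norm (infsum f (S K) - infsum f A) < e" if "K \<ge> Max (insert 0 (k ` F))" for K
  proof -
    have "F \<subseteq> S K"
    proof
      fix x assume x: "x \<in> F"
      then have "k x \<le> K" using that F(1) by (auto intro: order_trans[rotated])
      then show "x \<in> S K" using k[OF x] assms(3) by (auto simp: incseq_def)
    qed
    then have "sum ?n F \<le> infsum ?n (S K)"
      using F(1) sn[OF assms(2)] by (intro finite_sum_le_infsum) auto
    moreover have "norm (infsum f (A - S K)) \<le> infsum ?n (A - S K)"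
      by (intro norm_infsum_bound sn) auto
    moreover have "infsum f (A - S K) = infsum f A - infsum f (S K)"
      by (intro infsum_Diff sf assms) auto
    moreover have "infsum ?n (A - S K) = infsum ?n A - infsum ?n (S K)"
      by (intro infsum_Diff sn assms) auto
    moreover have "infsum ?n A - sum ?n F \<le> e / 2"
      using F(3) unfolding dist_real_def by linarith
    ultimately show ?thesis
      using e by (simp add: norm_minus_commute)
  qed
  then show "\<exists>K0. \<forall>K\<ge>K0. norm (infsum f (S K) - infsum f A) < e" by blast
qed

text \<open>Induction by the Cauchy product with the geometric series and the hockey-stick identity.
  Absolute summability is the same formula at \<open>norm y\<close>.\<close>

lemma negative_binomial_sums:
  fixes y :: complex
  assumes "norm y < 1"
  shows "(\<lambda>j. of_nat ((k + j) choose k) * y ^ j) sums (1 / (1 - y) ^ Suc k)"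
    and "summable (\<lambda>j. norm (of_nat ((k + j) choose k) * y ^ j))"
proof -
  have norms: "summable (\<lambda>j. norm (of_nat ((k + j) choose k) * y ^ j))"
    if "(\<lambda>j. of_nat ((k + j) choose k) * complex_of_real (norm y) ^ j) sums w" for y :: complex and k w
  proof -
    have "(\<lambda>j. of_nat ((k + j) choose k) * complex_of_real (norm y) ^ j) =
        (\<lambda>j. complex_of_real (norm (of_nat ((k + j) choose k) * y ^ j)))"
      by (simp add: norm_mult norm_power)
    then show ?thesis
      using sums_summable[OF that] by (simp only: summable_complex_of_real)
  qed
  have main: "(\<lambda>j. of_nat ((k + j) choose k) * y ^ j) sums (1 / (1 - y) ^ Suc k)" if "norm y < 1" for y :: complex
    using that
  proof (induction k arbitrary: y)
    case 0
    then show ?case using geometric_sums[OF 0] by simp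
  next
    case (Suc k)
    note y = Suc.prems
    have s: "summable (\<lambda>j. norm (y ^ j))" using y by (simp add: norm_power summable_geometric)
    have c: "(\<Sum>i\<le>j. of_nat ((k + i) choose k) * y ^ i * y ^ (j - i)) = of_nat ((Suc k + j) choose Suc k) * y ^ j" for j
    proof -
      have "(\<Sum>i\<le>j. of_nat ((k + i) choose k) * y ^ i * y ^ (j - i)) = of_nat (\<Sum>i\<le>j. (k + i) choose i) * y ^ j"
        unfolding of_nat_sum sum_distrib_right
        by (intro sum.cong refl) (simp add: mult.assoc binomial_symmetric[of k] flip: power_add)
      also have "(\<Sum>i\<le>j. (k + i) choose i) = (Suc k + j) choose Suc k"
        using sum_choose_lower[of k j] binomial_symmetric[of j "Suc (k + j)"] by simp
      finally show ?thesis .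
    qed
    have "(\<lambda>j. \<Sum>i\<le>j. of_nat ((k + i) choose k) * y ^ i * y ^ (j - i)) sums
        ((\<Sum>j. of_nat ((k + j) choose k) * y ^ j) * (\<Sum>j. y ^ j))"
      using s Suc.IH[of "complex_of_real (norm y)"] y
      by (intro Cauchy_product_sums norms[where w = "1 / (1 - complex_of_real (norm y)) ^ Suc k"]) auto
    then show ?case
      unfolding c using Suc.IH[OF y] geometric_sums[OF y] by (simp add: sums_iff mult_ac del: binomial_Suc_Suc)
  qed
  show "(\<lambda>j. of_nat ((k + j) choose k) * y ^ j) sums (1 / (1 - y) ^ Suc k)"
    by (rule main[OF assms])
  show "summable (\<lambda>j. norm (of_nat ((k + j) choose k) * y ^ j))"
    using main[of "complex_of_real (norm y)"] assms by (intro norms) auto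
qed

text \<open>Every finite partial sum of norms lies inside a finite product of single-mode sums,
  hence below \<open>exp\<close> of the total of \<open>h\<close>. This gives absolute summability,
  and the trace is then the limit over finitely many modes.\<close>

lemma fock_product_infsum:
  fixes F :: "nat \<Rightarrow> nat \<Rightarrow> complex" and h :: "nat \<Rightarrow> real"
  assumes F0: "\<And>m. F m 0 = 1"
    and summ: "\<And>m. m > 0 \<Longrightarrow> (\<lambda>n. norm (F m n)) summable_on UNIV"
    and bound: "\<And>m. m > 0 \<Longrightarrow> (\<Sum>\<^sub>\<infinity>n. norm (F m n)) \<le> exp (h m)"
    and h: "\<And>m. m > 0 \<Longrightarrow> h m \<ge> 0" "summable (\<lambda>n. h (Suc n))"
  shows "(\<lambda>K. \<Prod>m=1..K. \<Sum>\<^sub>\<infinity>n. F m n) \<longlonglongrightarrow>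
    (\<Sum>\<^sub>\<infinity>\<mu>\<in>fock_basis. \<Prod>m\<in>set_mset \<mu>. F m (count \<mu> m))"
proof -
  define D where "D \<mu> = (\<Prod>m\<in>set_mset \<mu>. F m (count \<mu> m))" for \<mu>
  define S where "S K = {\<mu>. set_mset \<mu> \<subseteq> {1..K :: nat}}" for K
  have D: "D \<mu> = (\<Prod>m=1..K. F m (restrict (count \<mu>) {1..K} m))" if "\<mu> \<in> S K" for \<mu> K
  proof -
    have "D \<mu> = (\<Prod>m=1..K. F m (count \<mu> m))"
      using that F0 unfolding D_def S_def by (intro prod.mono_neutral_left) (auto simp: not_in_iff)
    then show ?thesis by simp
  qed
  have h_sum: "(\<Sum>m=1..K. h m) \<le> (\<Sum>n. h (Suc n))" for K
  proof -
    have "(\<Sum>m=1..K. h m) = (\<Sum>n<K. h (Suc n))"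
      by (rule sum.reindex_bij_witness[of _ Suc "\<lambda>m. m - 1"]) auto
    also have "\<dots> \<le> (\<Sum>n. h (Suc n))"
      using h by (intro sum_le_suminf) auto
    finally show ?thesis .
  qed
  have "(\<lambda>\<mu>. norm (D \<mu>)) summable_on fock_basis"
  proof (rule nonneg_bdd_above_summable_on)
    show "bdd_above (sum (\<lambda>\<mu>. norm (D \<mu>)) ` {G. G \<subseteq> fock_basis \<and> finite G})"
    proof (rule bdd_aboveI2)
      fix G assume G: "G \<in> {G. G \<subseteq> fock_basis \<and> finite G}"
      \<comment> \<open>Modes up to \<open>K\<close> with occupation numbers up to \<open>n0\<close>
        form a finite box containing \<open>G\<close>, over which the sum factors.\<close>
      define K where "K = Max (insert 0 (\<Union>\<mu>\<in>G. set_mset \<mu>))"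
      define n0 where "n0 = Max (insert 0 (size ` G))"
      let ?B = "{\<mu>. set_mset \<mu> \<subseteq> {1..K} \<and> (\<forall>m\<in>{1..K}. count \<mu> m \<in> {..n0})}"
      have sub: "G \<subseteq> ?B"
      proof
        fix \<mu> assume \<mu>: "\<mu> \<in> G"
        have "set_mset \<mu> \<subseteq> {1..K}"
        proof
          fix m assume m: "m \<in># \<mu>"
          then have "m \<le> K" unfolding K_def using \<mu> G by (intro Max_ge) auto
          moreover have "m \<noteq> 0" using m \<mu> G by (auto simp: fock_basis_def intro: ccontr)
          ultimately show "m \<in> {1..K}" by simp
        qed
        moreover have "size \<mu> \<le> n0" unfolding n0_def using \<mu> G by (intro Max_ge) auto
        ultimately show "\<mu> \<in> ?B" using count_le_size[of \<mu>] by (auto intro: order_trans)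
      qed
      have bij: "bij_betw (\<lambda>\<mu>. restrict (count \<mu>) {1..K}) ?B (Pi\<^sub>E {1..K} (\<lambda>_. {..n0}))"
        by (rule bij_betw_count) simp
      have finB: "finite ?B"
        using bij_betw_finite[OF bij] by (simp add: finite_PiE)
      have "(\<Sum>\<mu>\<in>G. norm (D \<mu>)) \<le> (\<Sum>\<mu>\<in>?B. norm (D \<mu>))"
        by (rule sum_mono2[OF finB sub]) auto
      also have "\<dots> = (\<Sum>\<mu>\<in>?B. \<Prod>m=1..K. norm (F m (restrict (count \<mu>) {1..K} m)))"
      proof (intro sum.cong refl)
        fix \<mu> assume "\<mu> \<in> ?B"
        then have "\<mu> \<in> S K" by (simp add: S_def)
        then show "norm (D \<mu>) = (\<Prod>m=1..K. norm (F m (restrict (count \<mu>) {1..K} m)))"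
          by (simp only: D prod_norm)
      qed
      also have "\<dots> = (\<Sum>f\<in>Pi\<^sub>E {1..K} (\<lambda>_. {..n0}). \<Prod>m=1..K. norm (F m (f m)))"
        by (rule sum.reindex_bij_betw[OF bij])
      also have "\<dots> = (\<Prod>m=1..K. \<Sum>n\<le>n0. norm (F m n))"
        by (subst prod_sum_PiE) auto
      also have "\<dots> \<le> (\<Prod>m=1..K. exp (h m))"
      proof (intro prod_mono conjI sum_nonneg)
        fix m assume "m \<in> {1..K}"
        then have m: "m > 0" by simp
        have "(\<Sum>n\<le>n0. norm (F m n)) \<le> (\<Sum>\<^sub>\<infinity>n. norm (F m n))"
          using summ[OF m] by (intro finite_sum_le_infsum) auto
        then show "(\<Sum>n\<le>n0. norm (F m n)) \<le> exp (h m)" using bound[OF m] by linarith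
      qed auto
      also have "\<dots> = exp (\<Sum>m=1..K. h m)" by (simp add: exp_sum)
      also have "\<dots> \<le> exp (\<Sum>n. h (Suc n))" using h_sum by simp
      finally show "(\<Sum>\<mu>\<in>G. norm (D \<mu>)) \<le> exp (\<Sum>n. h (Suc n))" .
    qed
  qed auto
  then have "(\<lambda>K. infsum D (S K)) \<longlonglongrightarrow> infsum D fock_basis"
  proof (rule infsum_tendsto_exhaustion)
    show "S K \<subseteq> fock_basis" for K by (auto simp: S_def fock_basis_def)
    show "incseq S" by (auto simp: incseq_def S_def)
    show "fock_basis \<subseteq> (\<Union>K. S K)"
    proof
      fix \<mu> assume \<mu>: "\<mu> \<in> fock_basis"
      have "set_mset \<mu> \<subseteq> {1..Max (insert 0 (set_mset \<mu>))}"
      proof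
        fix m assume m: "m \<in># \<mu>"
        then have "m \<le> Max (insert 0 (set_mset \<mu>))" by (intro Max_ge) auto
        moreover have "m \<noteq> 0" using m \<mu> by (auto simp: fock_basis_def intro: ccontr)
        ultimately show "m \<in> {1..Max (insert 0 (set_mset \<mu>))}" by simp
      qed
      then show "\<mu> \<in> (\<Union>K. S K)" by (auto simp: S_def)
    qed
  qed
  moreover have "infsum D (S K) = (\<Prod>m=1..K. \<Sum>\<^sub>\<infinity>n. F m n)" for K
  proof -
    have "infsum D (S K) = infsum (\<lambda>\<mu>. \<Prod>m=1..K. F m (restrict (count \<mu>) {1..K} m)) (S K)"
      by (intro infsum_cong D)
    also have "\<dots> = infsum (\<lambda>f. \<Prod>m=1..K. F m (f m)) (Pi\<^sub>E {1..K} (\<lambda>_. UNIV))"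
    proof (rule infsum_reindex_bij_betw)
      show "bij_betw (\<lambda>\<mu>. restrict (count \<mu>) {1..K}) (S K) (Pi\<^sub>E {1..K} (\<lambda>_. UNIV))"
        using bij_betw_count[of "{1..K}" "\<lambda>_. UNIV"] by (simp add: S_def)
    qed
    also have "\<dots> = (\<Prod>m=1..K. \<Sum>\<^sub>\<infinity>n. F m n)"
      using summ by (intro infsum_prod_PiE_abs) auto
    finally show ?thesis .
  qed
  ultimately show ?thesis by (simp add: D_def[abs_def])
qed

text \<open>The Laguerre polynomial of degree \<open>n\<close> at \<open>- A\<close>: the diagonal
  matrix element of a normal-ordered exponential in the n-th state of one oscillator.\<close>

definition osc_sum :: "complex \<Rightarrow> nat \<Rightarrow> complex" where
  "osc_sum A n = (\<Sum>k\<le>n. A ^ k / fact k * of_nat (n choose k))"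

lemma infsum_nat_eqI:
  fixes f :: "nat \<Rightarrow> 'a :: banach"
  assumes "summable (\<lambda>n. norm (f n))" "f sums s"
  shows "infsum f UNIV = s"
  using norm_summable_imp_has_sum[OF assms] by (rule infsumI)

text \<open>The generating function of Laguerre polynomials. Writing n = k + j separates an
  exponential series in \<open>k\<close> from a negative binomial series in
  \<open>j\<close>.\<close>

lemma osc_sum_infsum:
  fixes y A :: complex
  assumes y: "norm y < 1"
  shows "(\<lambda>n. norm (y ^ n * osc_sum A n)) summable_on UNIV"
    and "(\<Sum>\<^sub>\<infinity>n. y ^ n * osc_sum A n) = exp (A * (y / (1 - y))) / (1 - y)"
proof -
  define g where "g = (\<lambda>(k, j). (A * y) ^ k / fact k * (of_nat ((k + j) choose k) * y ^ j))"
  have y1: "1 - y \<noteq> 0" using y by auto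
  have inner: "(\<Sum>\<^sub>\<infinity>j. of_nat ((k + j) choose k) * y ^ j) = 1 / (1 - y) ^ Suc k" for k
    using negative_binomial_sums[OF y, of k] by (intro infsum_nat_eqI) auto
  have sj: "(\<lambda>j. norm (of_nat ((k + j) choose k) * y ^ j)) summable_on UNIV" for k
    using negative_binomial_sums(2)[OF y, of k] by (intro summable_nonneg_imp_summable_on) auto
  have innern: "(\<Sum>\<^sub>\<infinity>j. norm (of_nat ((k + j) choose k) * y ^ j)) = 1 / (1 - norm y) ^ Suc k" for k
  proof (rule infsum_nat_eqI)
    have "(\<lambda>j. of_nat ((k + j) choose k) * complex_of_real (norm y) ^ j) sums (1 / (1 - complex_of_real (norm y)) ^ Suc k)"
      using y by (intro negative_binomial_sums) auto
    also have "(\<lambda>j. of_nat ((k + j) choose k) * complex_of_real (norm y) ^ j) =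
        (\<lambda>j. complex_of_real (norm (of_nat ((k + j) choose k) * y ^ j)))"
      by (simp add: norm_mult norm_power)
    also have "1 / (1 - complex_of_real (norm y)) ^ Suc k = complex_of_real (1 / (1 - norm y) ^ Suc k)"
      by simp
    finally show "(\<lambda>j. norm (of_nat ((k + j) choose k) * y ^ j)) sums (1 / (1 - norm y) ^ Suc k)"
      by (simp only: sums_of_real_iff)
  qed (use negative_binomial_sums(2)[OF y, of k] in auto)
  have gn: "(\<Sum>\<^sub>\<infinity>j. norm (g (k, j))) = norm (A * y) ^ k / fact k / (1 - norm y) ^ Suc k" for k
    unfolding g_def prod.case norm_mult[of "(A * y) ^ k / fact k"] infsum_cmult_right' innern
    by (simp add: norm_divide norm_power)
  have "summable (\<lambda>k. norm (A * y) ^ k / fact k / (1 - norm y) ^ Suc k)"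
  proof -
    have "summable (\<lambda>k. inverse (1 - norm y) * (inverse (fact k) * (norm (A * y) / (1 - norm y)) ^ k))"
      by (intro summable_mult summable_exp)
    then show ?thesis by (simp add: power_divide divide_inverse mult_ac power_inverse power_mult_distrib)
  qed
  then have gk: "(\<lambda>k. norm (\<Sum>\<^sub>\<infinity>j. norm (g (k, j)))) summable_on UNIV"
    unfolding gn using y by (intro summable_nonneg_imp_summable_on) auto
  have gabs: "(\<lambda>x. norm (g x)) summable_on UNIV \<times> UNIV"
    unfolding Infinite_Sum.abs_summable_on_Sigma_iff
  proof (intro conjI ballI)
    show "(\<lambda>j. norm (g (k, j))) summable_on UNIV" for k
      unfolding g_def prod.case norm_mult[of "(A * y) ^ k / fact k"]
      by (intro summable_on_cmult_right sj)
  qed (rule gk)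
  define \<phi> where "\<phi> = (\<lambda>(n :: nat, k :: nat). (k, n - k))"
  have bij: "bij_betw \<phi> (SIGMA n:UNIV. {..n}) (UNIV \<times> UNIV)"
    by (rule bij_betw_byWitness[where f' = "\<lambda>(k, j). (k + j, k)"]) (auto simp: \<phi>_def)
  have g\<phi>: "g (\<phi> (n, k)) = y ^ n * (A ^ k / fact k * of_nat (n choose k))" if "k \<le> n" for n k
  proof -
    have "y ^ k * y ^ (n - k) = y ^ n" using that by (simp flip: power_add)
    then show ?thesis using that by (simp add: g_def \<phi>_def power_mult_distrib mult_ac)
  qed
  have sumn: "(\<Sum>\<^sub>\<infinity>k\<in>{..n}. g (\<phi> (n, k))) = y ^ n * osc_sum A n" for n
    by (simp add: infsum_finite osc_sum_def sum_distrib_left g\<phi>)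
  have "(\<lambda>x. norm (g (\<phi> x))) summable_on (SIGMA n:UNIV. {..n})"
    using gabs by (subst summable_on_reindex_bij_betw[OF bij, of "\<lambda>x. norm (g x)"])
  then have gp: "(\<lambda>x. norm (g (\<phi> x))) summable_on (SIGMA n:UNIV. {..n})" .
  then have "(\<lambda>(n, k). norm (g (\<phi> (n, k)))) summable_on (SIGMA n:UNIV. {..n})"
    by (simp add: case_prod_unfold)
  then have "(\<lambda>n. \<Sum>\<^sub>\<infinity>k\<in>{..n}. norm (g (\<phi> (n, k)))) summable_on UNIV"
    by (rule summable_on_Sigma_banach)
  then have "(\<lambda>n. \<Sum>k\<le>n. norm (g (\<phi> (n, k)))) summable_on UNIV"
    by (simp add: infsum_finite)
  then show "(\<lambda>n. norm (y ^ n * osc_sum A n)) summable_on UNIV"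
  proof (rule summable_on_comparison_test)
    show "norm (y ^ n * osc_sum A n) \<le> (\<Sum>k\<le>n. norm (g (\<phi> (n, k))))" for n
      unfolding sumn[symmetric] by (simp add: infsum_finite norm_sum)
  qed auto
  have "(\<lambda>(n, k). g (\<phi> (n, k))) summable_on (SIGMA n:UNIV. {..n})"
    using abs_summable_summable[OF gp] by (simp add: case_prod_unfold)
  then have "(\<Sum>\<^sub>\<infinity>n. \<Sum>\<^sub>\<infinity>k\<in>{..n}. g (\<phi> (n, k))) = infsum (\<lambda>(n, k). g (\<phi> (n, k))) (SIGMA n:UNIV. {..n})"
    by (rule infsum_Sigma'_banach)
  also have "\<dots> = infsum (\<lambda>x. g (\<phi> x)) (SIGMA n:UNIV. {..n})"
    by (simp add: case_prod_unfold)
  also have "\<dots> = infsum g (UNIV \<times> UNIV)"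
    by (rule infsum_reindex_bij_betw[OF bij])
  also have "\<dots> = (\<Sum>\<^sub>\<infinity>k. \<Sum>\<^sub>\<infinity>j. g (k, j))"
    by (rule infsum_Sigma_banach[symmetric]) (rule abs_summable_summable[OF gabs])
  also have "\<dots> = (\<Sum>\<^sub>\<infinity>k. (A * y) ^ k / fact k / (1 - y) ^ Suc k)"
    unfolding g_def prod.case infsum_cmult_right' inner by simp
  also have "\<dots> = exp (A * (y / (1 - y))) / (1 - y)"
  proof (rule infsum_nat_eqI)
    have eq: "(A * y) ^ k / fact k / (1 - y) ^ Suc k = ((A * (y / (1 - y))) ^ k /\<^sub>R fact k) * (1 / (1 - y))" for k
      by (simp add: scaleR_conv_of_real divide_inverse power_mult_distrib power_inverse mult_ac)
    show "(\<lambda>k. (A * y) ^ k / fact k / (1 - y) ^ Suc k) sums (exp (A * (y / (1 - y))) / (1 - y))"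
      unfolding eq using sums_mult2[OF exp_converges[of "A * (y / (1 - y))"], of "1 / (1 - y)"] by simp
    show "summable (\<lambda>k. norm ((A * y) ^ k / fact k / (1 - y) ^ Suc k))"
      unfolding eq norm_mult by (intro summable_mult2 summable_norm_exp)
  qed
  finally show "(\<Sum>\<^sub>\<infinity>n. y ^ n * osc_sum A n) = exp (A * (y / (1 - y))) / (1 - y)"
    by (simp only: sumn)
qed

text \<open>Majorise by the generating function at \<open>norm y\<close> and \<open>norm A\<close>.
  Its prefactor 1/(1 - |y|) is 1 + w with w = |y|/(1 - |y|), hence at most \<open>exp w\<close>,
  which accounts for the added 1.\<close>

lemma osc_sum_norm_infsum:
  fixes y A :: complex
  assumes y: "norm y < 1"
  shows "(\<Sum>\<^sub>\<infinity>n. norm (y ^ n * osc_sum A n)) \<le> exp ((norm A + 1) * (norm y / (1 - norm y)))"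
proof -
  let ?y = "complex_of_real (norm y)" and ?A = "complex_of_real (norm A)"
  define L where "L n = norm y ^ n * (\<Sum>k\<le>n. norm A ^ k / fact k * of_nat (n choose k))" for n
  have L: "?y ^ n * osc_sum ?A n = complex_of_real (L n)" for n
    by (simp add: L_def osc_sum_def)
  have L0: "L n \<ge> 0" for n
    unfolding L_def by (intro mult_nonneg_nonneg sum_nonneg) auto
  have y': "norm ?y < 1" using y by simp
  have Ls: "L summable_on UNIV"
    using osc_sum_infsum(1)[OF y', of ?A] L0 unfolding L by simp
  have "(\<Sum>\<^sub>\<infinity>n. norm (y ^ n * osc_sum A n)) \<le> (\<Sum>\<^sub>\<infinity>n. L n)"
  proof (rule infsum_mono[OF osc_sum_infsum(1)[OF y] Ls])
    fix n
    have "norm (osc_sum A n) \<le> (\<Sum>k\<le>n. norm A ^ k / fact k * of_nat (n choose k))"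
      unfolding osc_sum_def by (intro order_trans[OF norm_sum] sum_mono) (simp add: norm_mult norm_divide norm_power)
    then show "norm (y ^ n * osc_sum A n) \<le> L n"
      unfolding L_def norm_mult norm_power by (intro mult_left_mono) auto
  qed
  also have "complex_of_real (\<Sum>\<^sub>\<infinity>n. L n) = complex_of_real (exp (norm A * (norm y / (1 - norm y))) / (1 - norm y))"
    using osc_sum_infsum(2)[OF y', of ?A]
      infsumI[OF has_sum_bounded_linear[OF bounded_linear_of_real[where 'a = complex] has_sum_infsum[OF Ls]]]
    unfolding L by (simp add: exp_of_real[symmetric])
  then have "(\<Sum>\<^sub>\<infinity>n. L n) = exp (norm A * (norm y / (1 - norm y))) / (1 - norm y)"
    by (simp only: of_real_eq_iff)
  also have "\<dots> \<le> exp ((norm A + 1) * (norm y / (1 - norm y)))"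
  proof -
    define w where "w = norm y / (1 - norm y)"
    have "1 / (1 - norm y) = 1 + w" using y by (simp add: w_def field_simps)
    then have "1 / (1 - norm y) \<le> exp w" using exp_ge_add_one_self[of w] by simp
    then have "exp (norm A * w) * (1 / (1 - norm y)) \<le> exp (norm A * w) * exp w"
      by (rule mult_left_mono) simp
    then show ?thesis
      unfolding w_def[symmetric] by (simp add: distrib_right exp_add)
  qed
  finally show ?thesis .
qed

section \<open>Matrix elements and trace of one vertex operator\<close>

context refined_params
begin

lemma finite_Suc_preimage: "finite {n. Suc n \<in># \<nu>}"
  by (rule finite_subset[of _ "(\<lambda>m. m - 1) ` set_mset \<nu>"]) force+

lemma sum_Suc_preimage:
  fixes f :: "nat \<Rightarrow> complex"
  assumes "0 \<notin># \<nu>"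
  shows "(\<Sum>n | Suc n \<in># \<nu>. f (Suc n)) = (\<Sum>m\<in>set_mset \<nu>. f m)"
proof (rule sum.reindex_bij_witness[of _ "\<lambda>m. m - 1" Suc])
  fix m assume "m \<in># \<nu>"
  then have "m \<noteq> 0" using assms by metis
  then show "Suc (m - 1) = m" "m - 1 \<in> {n. Suc n \<in># \<nu>}" using \<open>m \<in># \<nu>\<close> by auto
qed auto

lemma creation_step:
  assumes "0 \<notin># \<nu>"
  shows "(\<Sum>n. b (- int (Suc n)) * osc q t p (- int (Suc n)) g \<nu>) =
    (\<Sum>m\<in>set_mset \<nu>. b (- int m) * g (\<nu> - {#m#}))"
proof -
  have o: "osc q t p (- int (Suc n)) g \<nu> = (if Suc n \<in># \<nu> then g (\<nu> - {#Suc n#}) else 0)" for n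
    by (simp add: osc_def nat_add_distrib)
  have "(\<Sum>n. b (- int (Suc n)) * osc q t p (- int (Suc n)) g \<nu>) =
      (\<Sum>n | Suc n \<in># \<nu>. b (- int (Suc n)) * osc q t p (- int (Suc n)) g \<nu>)"
    by (rule suminf_finite[OF finite_Suc_preimage]) (simp only: o, simp)
  also have "\<dots> = (\<Sum>n | Suc n \<in># \<nu>. b (- int (Suc n)) * g (\<nu> - {#Suc n#}))"
    by (intro sum.cong refl) (simp only: o mem_Collect_eq if_True)
  also have "\<dots> = (\<Sum>m\<in>set_mset \<nu>. b (- int m) * g (\<nu> - {#m#}))"
    by (rule sum_Suc_preimage[OF assms, of "\<lambda>m. b (- int m) * g (\<nu> - {#m#})"])
  finally show ?thesis .
qed

lemma annihilation_step:
  assumes "0 \<notin># \<mu>" and g: "\<And>\<sigma>. \<not> \<sigma> \<subseteq># \<mu> \<Longrightarrow> g \<sigma> = 0"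
  shows "(\<Sum>n. a (int (Suc n)) * osc q t p (int (Suc n)) g \<nu>) =
    (\<Sum>m\<in>set_mset (\<mu> - \<nu>). a (int m) * comm q t p (int m) * of_nat (Suc (count \<nu> m)) * g (add_mset m \<nu>))"
proof -
  let ?f = "\<lambda>m. a (int m) * comm q t p (int m) * of_nat (Suc (count \<nu> m)) * g (add_mset m \<nu>)"
  have o: "a (int (Suc n)) * osc q t p (int (Suc n)) g \<nu> = ?f (Suc n)" for n
    unfolding osc_def by (simp add: nat_add_distrib mult.assoc)
  have z: "?f m = 0" if "m \<notin># \<mu> - \<nu>" for m
  proof -
    have "\<not> add_mset m \<nu> \<subseteq># \<mu>"
    proof
      assume "add_mset m \<nu> \<subseteq># \<mu>"
      then have "count (add_mset m \<nu>) m \<le> count \<mu> m" by (rule mset_subset_eq_count)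
      then show False using that by (simp add: in_diff_count)
    qed
    then show ?thesis using g by simp
  qed
  have "(\<Sum>n. a (int (Suc n)) * osc q t p (int (Suc n)) g \<nu>) = (\<Sum>n. ?f (Suc n))"
    by (simp only: o)
  also have "\<dots> = (\<Sum>n | Suc n \<in># \<mu> - \<nu>. ?f (Suc n))"
    by (rule suminf_finite[OF finite_Suc_preimage]) (rule z, blast)
  also have "\<dots> = (\<Sum>m\<in>set_mset (\<mu> - \<nu>). ?f m)"
    using assms(1) by (intro sum_Suc_preimage) (auto dest: in_diffD)
  finally show ?thesis .
qed

text \<open>A diagonal element removes some submultiset \<open>\<rho>\<close> of
  \<open>\<mu>\<close> and puts it back. The sum over \<open>\<rho>\<close> is a sum over count
  functions and therefore factors over the modes.\<close>

lemma vop_apply_diagonal: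
  assumes "0 \<notin># \<mu>"
  shows "vop_apply q t p X (ket \<mu>) \<mu> = vscalar X * (\<Prod>m\<in>set_mset \<mu>.
    osc_sum (vmodes X (int m) * vmodes X (- int m) * comm q t p (int m)) (count \<mu> m))"
proof -
  define A where "A m = vmodes X (int m) * vmodes X (- int m) * comm q t p (int m)" for m
  let ?a = "\<lambda>m. vmodes X (int m) * comm q t p (int m)" and ?b = "\<lambda>m. vmodes X (- int m)"
  let ?S = "set_mset \<mu>"
  let ?G = "\<lambda>f. \<Prod>m\<in>?S. A m ^ f m / fact (f m) * of_nat (count \<mu> m choose f m)"
  define g where "g = op_exp (\<lambda>g \<nu>. \<Sum>n. vmodes X (int (Suc n)) * osc q t p (int (Suc n)) g \<nu>) (ket \<mu>)"
  have g: "g \<nu> = mset_monomial ?a (\<mu> - \<nu>) * (mset_fact \<mu> / (mset_fact \<nu> * mset_fact (\<mu> - \<nu>)))" if "\<nu> \<subseteq># \<mu>" for \<nu>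
    unfolding g_def by (rule op_exp_annihilation[OF annihilation_step[OF assms] that])
  have "vop_apply q t p X (ket \<mu>) \<mu> = vscalar X *
      (\<Sum>\<rho> | \<rho> \<subseteq># \<mu>. mset_monomial ?b \<rho> / mset_fact \<rho> * g (\<mu> - \<rho>))"
    unfolding vop_apply_def g_def[symmetric] by (subst op_exp_creation[OF creation_step assms]) auto
  also have "(\<Sum>\<rho> | \<rho> \<subseteq># \<mu>. mset_monomial ?b \<rho> / mset_fact \<rho> * g (\<mu> - \<rho>)) =
      (\<Sum>\<rho> | \<rho> \<subseteq># \<mu>. ?G (restrict (count \<rho>) ?S))"
  proof (intro sum.cong refl)
    fix \<rho> assume "\<rho> \<in> {\<rho>. \<rho> \<subseteq># \<mu>}"
    then have \<rho>: "\<rho> \<subseteq># \<mu>" by simp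
    then have S: "set_mset \<rho> \<subseteq> ?S" "set_mset (\<mu> - \<rho>) \<subseteq> ?S"
      by (auto dest: mset_subset_eqD in_diffD)
    have dd: "\<mu> - (\<mu> - \<rho>) = \<rho>"
      using mset_subset_eq_count[OF \<rho>] by (intro multiset_eqI) simp
    have "mset_monomial ?b \<rho> / mset_fact \<rho> * g (\<mu> - \<rho>) =
      mset_monomial ?b \<rho> / mset_fact \<rho> * (mset_monomial ?a \<rho> * (mset_fact \<mu> / (mset_fact (\<mu> - \<rho>) * mset_fact \<rho>)))"
      by (subst g) (simp_all add: dd)
    also have "\<dots> = (\<Prod>m\<in>?S. (?b m ^ count \<rho> m / fact (count \<rho> m)) *
        (?a m ^ count \<rho> m * (fact (count \<mu> m) / (fact (count (\<mu> - \<rho>) m) * fact (count \<rho> m)))))"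
      unfolding mset_monomial_superset[OF finite_set_mset S(1)] mset_fact_superset[OF finite_set_mset S(1)]
        mset_fact_superset[OF finite_set_mset S(2)] mset_fact_superset[OF finite_set_mset order_refl[of ?S]]
        prod.distrib prod_dividef ..
    also have "\<dots> = ?G (restrict (count \<rho>) ?S)"
    proof (intro prod.cong refl)
      fix m assume "m \<in># \<mu>"
      have "of_nat (count \<mu> m choose count \<rho> m) =
          (fact (count \<mu> m) / (fact (count \<rho> m) * fact (count \<mu> m - count \<rho> m)) :: complex)"
        using mset_subset_eq_count[OF \<rho>] by (rule binomial_fact)
      then show "(?b m ^ count \<rho> m / fact (count \<rho> m)) *
        (?a m ^ count \<rho> m * (fact (count \<mu> m) / (fact (count (\<mu> - \<rho>) m) * fact (count \<rho> m)))) =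
        A m ^ restrict (count \<rho>) ?S m / fact (restrict (count \<rho>) ?S m) * of_nat (count \<mu> m choose restrict (count \<rho>) ?S m)"
        using \<open>m \<in># \<mu>\<close> by (simp add: A_def power_mult_distrib mult_ac)
    qed
    finally show "mset_monomial ?b \<rho> / mset_fact \<rho> * g (\<mu> - \<rho>) = ?G (restrict (count \<rho>) ?S)" .
  qed
  also have "\<dots> = (\<Sum>f\<in>Pi\<^sub>E ?S (\<lambda>m. {..count \<mu> m}). ?G f)"
    unfolding submultisets_eq by (rule sum.reindex_bij_betw[OF bij_betw_count]) simp
  also have "\<dots> = (\<Prod>m\<in>?S. osc_sum (A m) (count \<mu> m))"
    unfolding osc_sum_def by (rule prod_sum_PiE[symmetric]) auto
  finally show ?thesis by (simp add: A_def)
qed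

lemma vop_vev_eq: "vop_vev q t p X = vscalar X"
  by (simp add: vop_vev_def vop_apply_diagonal)

text \<open>Holds for every multiset, also outside \<open>fock_basis\<close>; no mode acts on an
  element 0, so 0 is left out of the degree.\<close>

lemma degree_op_eq: "degree_op q t p f \<mu> = - (of_nat (\<Sum>m\<in>set_mset \<mu> - {0}. m * count \<mu> m) * f \<mu>)"
proof -
  \<comment> \<open>The coefficients in \<open>d\<close> are chosen to cancel all of the commutator
    except its 1/m, which against the square of \<open>m\<close> leaves \<open>m\<close>.\<close>
  have coeff: "of_int ((int m)\<^sup>2) / (kappa q t (int m) * (1 - (t / q) powi int m)) *
      ((1 - p powi int m) / (1 - pstar q t p powi int m)) * comm q t p (int m) = of_nat m" if "m > 0" for m
  proof -
    have "q ^ m \<noteq> 1" "t ^ m \<noteq> 1" "p ^ m \<noteq> 1" "q ^ m \<noteq> t ^ m" "(p * q / t) ^ m \<noteq> 1"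
      using that norms power_neq_1 power_q_neq_power_t by auto
    moreover from this have "kappa q t (int m) \<noteq> 0" "1 - (t / q) ^ m \<noteq> 0"
      by (auto simp: kappa_def power_int_minus power_divide divide_simps)
    moreover have "x / (k * w) * (P / R) * (- (k / y) * (- w) * (R / P)) = x / y"
      if "k \<noteq> 0" "w \<noteq> 0" "P \<noteq> 0" "R \<noteq> 0" for x k w P R y :: complex
      using that by simp
    ultimately have "of_int ((int m)\<^sup>2) / (kappa q t (int m) * (1 - (t / q) ^ m)) *
      ((1 - p ^ m) / (1 - (p * q / t) ^ m)) *
      (- (kappa q t (int m) / of_int (int m)) * (- (1 - (t / q) ^ m)) * ((1 - (p * q / t) ^ m) / (1 - p ^ m))) =
      of_int ((int m)\<^sup>2) / of_int (int m)"
      by (metis eq_iff_diff_eq_0)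
    then show ?thesis
      using that by (simp add: comm_def pstar_def power2_eq_square)
  qed
  have oo: "osc q t p (- int (Suc n)) (osc q t p (int (Suc n)) f) \<mu> =
      (if Suc n \<in># \<mu> then comm q t p (int (Suc n)) * of_nat (count \<mu> (Suc n)) * f \<mu> else 0)" for n
  proof (cases "Suc n \<in># \<mu>")
    case True
    then have "Suc (count (\<mu> - {#Suc n#}) (Suc n)) = count \<mu> (Suc n)" by simp
    then show ?thesis
      using True by (simp add: osc_def nat_add_distrib del: of_nat_Suc count_diff)
  qed (simp add: osc_def nat_add_distrib)
  have "degree_op q t p f \<mu> = - (\<Sum>n. if Suc n \<in># \<mu> then of_nat (Suc n) * of_nat (count \<mu> (Suc n)) * f \<mu> else 0)"
    unfolding degree_op_def Let_def oo
  proof (intro arg_cong[of _ _ uminus] suminf_cong)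
    fix n
    show "of_int ((int (Suc n))\<^sup>2) / (kappa q t (int (Suc n)) * (1 - (t / q) powi int (Suc n))) *
         ((1 - p powi int (Suc n)) / (1 - pstar q t p powi int (Suc n))) *
         (if Suc n \<in># \<mu> then comm q t p (int (Suc n)) * of_nat (count \<mu> (Suc n)) * f \<mu> else 0) =
         (if Suc n \<in># \<mu> then of_nat (Suc n) * of_nat (count \<mu> (Suc n)) * f \<mu> else 0)"
      unfolding coeff[of "Suc n", OF zero_less_Suc, symmetric]
      by (cases "Suc n \<in># \<mu>") (simp_all only: if_True if_False simp_thms mult.assoc mult_zero_right)
  qed
  also have "(\<Sum>n. if Suc n \<in># \<mu> then of_nat (Suc n) * of_nat (count \<mu> (Suc n)) * f \<mu> else 0) =
      (\<Sum>n | Suc n \<in># \<mu>. of_nat (Suc n) * of_nat (count \<mu> (Suc n)) * f \<mu>)"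
    by (subst suminf_finite[OF finite_Suc_preimage[of \<mu>]]) (auto intro!: sum.cong)
  also have "\<dots> = (\<Sum>m\<in>set_mset \<mu> - {0}. of_nat (m * count \<mu> m) * f \<mu>)"
    by (rule sum.reindex_bij_witness[of _ "\<lambda>m. m - 1" Suc]) (auto simp del: of_nat_Suc mult_Suc)
  finally show ?thesis by (simp add: sum_distrib_right)
qed

lemma op_power_degree:
  assumes "x \<noteq> 0" "0 \<notin># \<mu>"
  shows "op_power x (\<lambda>g \<mu>. - degree_op q t p g \<mu>) f \<mu> = (\<Prod>m\<in>set_mset \<mu>. (x ^ m) ^ count \<mu> m) * f \<mu>"
proof -
  let ?N = "\<lambda>\<mu>. \<Sum>m\<in>set_mset \<mu> - {0 :: nat}. m * count \<mu> m"
  have "((\<lambda>f \<mu>. Ln x * - degree_op q t p f \<mu>) ^^ k) f \<mu> = (Ln x * of_nat (?N \<mu>)) ^ k * f \<mu>" for k f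
    by (induction k arbitrary: f) (simp_all add: degree_op_eq funpow_swap1 mult_ac)
  then have "op_power x (\<lambda>g \<mu>. - degree_op q t p g \<mu>) f \<mu> = (\<Sum>k. (Ln x * of_nat (?N \<mu>)) ^ k * f \<mu> / fact k)"
    by (simp add: op_power_def op_exp_def)
  also have "\<dots> = (\<Sum>k. ((Ln x * of_nat (?N \<mu>)) ^ k /\<^sub>R fact k) * f \<mu>)"
    by (simp add: scaleR_conv_of_real divide_inverse mult_ac)
  also have "\<dots> = exp (Ln x * of_nat (?N \<mu>)) * f \<mu>"
    using sums_mult2[OF exp_converges[of "Ln x * of_nat (?N \<mu>)"], of "f \<mu>"] by (simp only: sums_iff)
  also have "exp (Ln x * of_nat (?N \<mu>)) = x ^ ?N \<mu>"
    by (simp only: exp_of_nat2_mult exp_Ln[OF assms(1)])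
  also have "\<dots> = (\<Prod>m\<in>set_mset \<mu>. (x ^ m) ^ count \<mu> m)"
    using assms(2) by (simp add: power_sum power_mult)
  finally show ?thesis .
qed

text \<open>Mode \<open>m\<close> contributes a Laguerre generating function at
  \<open>x ^ m\<close>. The exponentials combine into the series and the denominators
  \<open>1 - x ^ m\<close> multiply to \<open>qpoch x [x]\<close>.\<close>

lemma fock_trace_vop:
  fixes X x
  defines "A \<equiv> \<lambda>m. vmodes X (int m) * vmodes X (- int m) * comm q t p (int m)"
  assumes x: "x \<noteq> 0" "norm x < 1"
    and summ: "summable (\<lambda>n. norm (A (Suc n) * (x ^ Suc n / (1 - x ^ Suc n))))"
  shows "fock_trace (\<lambda>f. op_power x (\<lambda>g \<mu>. - degree_op q t p g \<mu>) (vop_apply q t p X f)) =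
    vscalar X * (exp (\<Sum>n. A (Suc n) * (x ^ Suc n / (1 - x ^ Suc n))) / qpoch x [x])"
proof -
  define F where "F m n = (x ^ m) ^ n * osc_sum (A m) n" for m n
  define h where "h m = (norm (A m) + 1) * (norm (x ^ m) / (1 - norm (x ^ m)))" for m
  have xm: "norm (x ^ m) < 1" if "m > 0" for m
    using x(2) that by (cases m) (auto simp: norm_power power_less_one_iff simp del: power_Suc)
  have xb: "norm (x ^ m) \<le> norm x" if "m > 0" for m
    using power_decreasing[of 1 m "norm x"] that x by (simp add: norm_power)
  have geo: "summable (\<lambda>n. norm x ^ Suc n)"
    using x by (simp add: summable_geometric)
  have "summable (\<lambda>n. h (Suc n))"
  proof (rule summable_comparison_test'[where N = 0])
    \<comment> \<open>With y = x^(n+1), \<open>summ\<close> controls |y/(1 - y)| while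
      \<open>h\<close> involves |y|/(1 - |y|). Since |1 - y| \<le> 2 and |y| \<le> |x|, the passage
      costs the factor 2/(1 - |x|).\<close>
    show "summable (\<lambda>n. norm (A (Suc n) * (x ^ Suc n / (1 - x ^ Suc n))) * (2 / (1 - norm x)) +
        norm x ^ Suc n * (1 / (1 - norm x)))"
      by (intro summable_add summable_mult2 summ geo)
    fix n
    let ?y = "x ^ Suc n"
    have y: "norm ?y < 1" "norm ?y \<le> norm x" "?y \<noteq> 1" using xm[of "Suc n"] xb[of "Suc n"] by auto
    have "norm (1 - ?y) \<le> 2" using norm_triangle_ineq4[of 1 ?y] y by simp
    have "norm ?y / (1 - norm ?y) = norm (?y / (1 - ?y)) * (norm (1 - ?y) * (1 / (1 - norm ?y)))"
      using y by (simp add: norm_divide)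
    also have "\<dots> \<le> norm (?y / (1 - ?y)) * (2 * (1 / (1 - norm x)))"
      using y x \<open>norm (1 - ?y) \<le> 2\<close> by (intro mult_left_mono mult_mono divide_left_mono) auto
    finally have 1: "norm ?y / (1 - norm ?y) \<le> norm (?y / (1 - ?y)) * (2 / (1 - norm x))" by simp
    have 2: "norm ?y / (1 - norm ?y) \<le> norm x ^ Suc n * (1 / (1 - norm x))"
      unfolding norm_power[symmetric] using y x by (simp add: divide_left_mono frac_le del: power_Suc)
    have "h (Suc n) = norm (A (Suc n)) * (norm ?y / (1 - norm ?y)) + norm ?y / (1 - norm ?y)"
      unfolding h_def by (simp only: ring_distribs mult_1_left)
    also have "\<dots> \<le> norm (A (Suc n)) * (norm (?y / (1 - ?y)) * (2 / (1 - norm x))) + norm x ^ Suc n * (1 / (1 - norm x))"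
      by (intro add_mono mult_left_mono 1 2) auto
    finally have "h (Suc n) \<le> norm (A (Suc n) * (?y / (1 - ?y))) * (2 / (1 - norm x)) + norm x ^ Suc n * (1 / (1 - norm x))"
      unfolding norm_mult by (simp only: mult.assoc)
    moreover have "h (Suc n) \<ge> 0" unfolding h_def using y by (intro mult_nonneg_nonneg divide_nonneg_pos) auto
    ultimately show "norm (h (Suc n)) \<le> norm (A (Suc n) * (?y / (1 - ?y))) * (2 / (1 - norm x)) +
        norm x ^ Suc n * (1 / (1 - norm x))" by simp
  qed
  then have lim: "(\<lambda>K. \<Prod>m=1..K. \<Sum>\<^sub>\<infinity>n. F m n) \<longlonglongrightarrow>
      (\<Sum>\<^sub>\<infinity>\<mu>\<in>fock_basis. \<Prod>m\<in>set_mset \<mu>. F m (count \<mu> m))"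
  proof (rule fock_product_infsum[rotated 4])
    show "F m 0 = 1" for m by (simp add: F_def osc_sum_def)
    show "(\<lambda>n. norm (F m n)) summable_on UNIV" if "m > 0" for m
      unfolding F_def by (rule osc_sum_infsum(1)[OF xm[OF that]])
    show "(\<Sum>\<^sub>\<infinity>n. norm (F m n)) \<le> exp (h m)" if "m > 0" for m
      unfolding F_def h_def by (rule osc_sum_norm_infsum[OF xm[OF that]])
    show "h m \<ge> 0" if "m > 0" for m
      unfolding h_def using xm[OF that] by (intro mult_nonneg_nonneg divide_nonneg_pos) auto
  qed
  have "(\<Prod>m=1..K. \<Sum>\<^sub>\<infinity>n. F m n) =
      exp (\<Sum>n<K. A (Suc n) * (x ^ Suc n / (1 - x ^ Suc n))) / (\<Prod>n<K. qpoch (x * x ^ n) [])" for K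
  proof -
    have "(\<Prod>m=1..K. \<Sum>\<^sub>\<infinity>n. F m n) = (\<Prod>m=1..K. exp (A m * (x ^ m / (1 - x ^ m))) / (1 - x ^ m))"
      unfolding F_def using xm by (intro prod.cong refl osc_sum_infsum(2)) auto
    also have "\<dots> = (\<Prod>n<K. exp (A (Suc n) * (x ^ Suc n / (1 - x ^ Suc n))) / (1 - x ^ Suc n))"
      by (rule prod.reindex_bij_witness[of _ Suc "\<lambda>m. m - 1"]) auto
    finally show ?thesis by (simp add: prod_dividef exp_sum)
  qed
  moreover have "(\<lambda>K. exp (\<Sum>n<K. A (Suc n) * (x ^ Suc n / (1 - x ^ Suc n))) / (\<Prod>n<K. qpoch (x * x ^ n) []))
      \<longlonglongrightarrow> exp (\<Sum>n. A (Suc n) * (x ^ Suc n / (1 - x ^ Suc n))) / qpoch x [x]"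
  proof (intro tendsto_divide tendsto_exp summable_LIMSEQ summable_norm_cancel[OF summ])
    have "(\<lambda>K. \<Prod>n\<le>K. qpoch (x * x ^ n) []) \<longlonglongrightarrow> (\<Prod>n. qpoch (x * x ^ n) [])"
      using x by (intro convergent_prod_LIMSEQ qpoch_convergent) auto
    then show "(\<lambda>K. \<Prod>n<K. qpoch (x * x ^ n) []) \<longlonglongrightarrow> qpoch x [x]"
      using LIMSEQ_lessThan_iff_atMost[of "\<lambda>S. \<Prod>n\<in>S. qpoch (x * x ^ n) []"] by simp
    have "x * x ^ n \<noteq> 1" for n
    proof
      assume "x * x ^ n = 1"
      then have "norm (x ^ Suc n) = 1" by simp
      then show False using xm[of "Suc n"] by simp
    qed
    then show "qpoch x [x] \<noteq> 0"
      using x by (intro qpoch_Cons_nonzero) auto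
  qed
  ultimately have trace_value: "(\<Sum>\<^sub>\<infinity>\<mu>\<in>fock_basis. \<Prod>m\<in>set_mset \<mu>. F m (count \<mu> m)) =
      exp (\<Sum>n. A (Suc n) * (x ^ Suc n / (1 - x ^ Suc n))) / qpoch x [x]"
    using LIMSEQ_unique lim by simp
  have "fock_trace (\<lambda>f. op_power x (\<lambda>g \<mu>. - degree_op q t p g \<mu>) (vop_apply q t p X f)) =
      (\<Sum>\<^sub>\<infinity>\<mu>\<in>fock_basis. vscalar X * (\<Prod>m\<in>set_mset \<mu>. F m (count \<mu> m)))"
    unfolding fock_trace_def
  proof (rule infsum_cong)
    fix \<mu> assume "\<mu> \<in> fock_basis"
    then have "0 \<notin># \<mu>" by (simp add: fock_basis_def)
    then show "op_power x (\<lambda>g \<mu>. - degree_op q t p g \<mu>) (vop_apply q t p X (ket \<mu>)) \<mu> =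
        vscalar X * (\<Prod>m\<in>set_mset \<mu>. F m (count \<mu> m))"
      using x(1) by (simp add: op_power_degree vop_apply_diagonal F_def A_def prod.distrib)
  qed
  then show ?thesis
    by (simp only: infsum_cmult_right' trace_value)
qed

end

section \<open>Assembling the partition functions\<close>

definition index_pairs :: "nat \<Rightarrow> (nat \<times> nat) set" where
  "index_pairs M = {(i, j). 1 \<le> i \<and> i < j \<and> j \<le> M}"

lemma index_pairs_Sigma: "index_pairs M = (SIGMA i:{1..M}. {Suc i..M})"
  by (auto simp: index_pairs_def)

lemma finite_index_pairs [simp]: "finite (index_pairs M)"
  by (simp add: index_pairs_Sigma)

lemma prod_square_pairs:
  fixes f :: "nat \<Rightarrow> nat \<Rightarrow> complex"
  shows "(\<Prod>i=1..M. \<Prod>j=1..M. f i j) = (\<Prod>i=1..M. f i i) * (\<Prod>(i, j)\<in>index_pairs M. f i j * f j i)"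
proof (induction M)
  case 0
  then show ?case by (simp add: index_pairs_Sigma)
next
  case (Suc M)
  have I: "index_pairs (Suc M) = index_pairs M \<union> (\<lambda>i. (i, Suc M)) ` {1..M}"
    by (auto simp: index_pairs_def)
  have "index_pairs M \<inter> (\<lambda>i. (i, Suc M)) ` {1..M} = {}"
    by (auto simp: index_pairs_def)
  then have "(\<Prod>(i, j)\<in>index_pairs (Suc M). f i j * f j i) =
      (\<Prod>(i, j)\<in>index_pairs M. f i j * f j i) * (\<Prod>i=1..M. f i (Suc M) * f (Suc M) i)"
    unfolding I by (simp add: prod.union_disjoint prod.reindex inj_on_def)
  then show ?case
    using Suc.IH by (simp add: prod.distrib mult_ac)
qed

text \<open>Each index lies in M - 1 unordered pairs. The claim follows from
  \<open>prod_square_pairs\<close> by cancelling one copy of the full product, hence the condition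
  that \<open>g\<close> is nonzero.\<close>

lemma prod_pairs_mult:
  fixes g :: "nat \<Rightarrow> complex"
  assumes "\<And>i. g i \<noteq> 0" "M \<ge> 1"
  shows "(\<Prod>(i, j)\<in>index_pairs M. g i * g j) = (\<Prod>i=1..M. g i) ^ (M - 1)"
proof -
  have "(\<Prod>i=1..M. g i) ^ M = (\<Prod>i=1..M. g i) * (\<Prod>(i, j)\<in>index_pairs M. g i * g j)"
    using prod_square_pairs[of "\<lambda>i j. g i" M] by (simp add: prod.distrib prod_power_distrib)
  moreover have "(\<Prod>i=1..M. g i) ^ M = (\<Prod>i=1..M. g i) * (\<Prod>i=1..M. g i) ^ (M - 1)"
    using assms(2) by (simp flip: power_Suc)
  moreover have "(\<Prod>i=1..M. g i) \<noteq> 0" using assms(1) by simp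
  ultimately show ?thesis by simp
qed

context refined_params
begin

text \<open>The square of \<open>V\<close>-values splits into diagonal entries, which meet the self
  contractions in \<open>pair_value_self\<close>, and unordered pairs, which meet the contractions
  for i < j in \<open>pair_value_reflect\<close>.\<close>

lemma partition_function_summand:
  fixes N :: int and M :: nat and u :: "nat \<Rightarrow> complex" and \<Lambda> :: "nat \<Rightarrow> nat list"
  assumes \<theta>: "\<And>z. \<theta> z = (1 - z) * V z [] * V (1 / z) []"
    and u: "\<And>i. i \<in> {1..M} \<Longrightarrow> u i \<noteq> 0"
    and part: "\<And>i. i \<in> {1..M} \<Longrightarrow> is_partition (\<Lambda> i)"
    and M: "M \<ge> 1"
  defines "k \<equiv> \<Sum>i=1..M. sum_list (\<Lambda> i)"
  shows "((\<Prod>i=1..M. C_self q t p * (pstar q t p * p powi (N - 1) * r) ^ sum_list (\<Lambda> i) *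
          nek_ratio (\<lambda>y. 1 - y) (\<Lambda> i) (\<Lambda> i) 1) *
        (\<Prod>i=1..M. \<Prod>j=Suc i..M. pair_value qpoch (\<Lambda> i) (\<Lambda> j) (u j / u i))) *
      (\<Prod>i=1..M. \<Prod>j=1..M. pair_value V (\<Lambda> i) (\<Lambda> j) (u j / u i)) =
    C_self q t p ^ M * pair_head V 1 ^ M *
    (\<Prod>(i, j)\<in>index_pairs M. pair_head qpoch (u j / u i) * pair_head V (u j / u i) * pair_head V (u i / u j)) *
    (inst_param q t p r N M ^ k *
     (\<Prod>i=1..M. \<Prod>j=1..M. nek_ratio \<theta> (\<Lambda> i) (\<Lambda> j) (u i / u j)))"
proof -
  let ?I = "pstar q t p * p powi (N - 1) * r" and ?C = "C_self q t p"
  let ?l = "\<lambda>i. sum_list (\<Lambda> i)"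
  let ?B = "\<lambda>i j. pair_head qpoch (u j / u i) * pair_head V (u j / u i) * pair_head V (u i / u j)"
  let ?R = "\<lambda>i j. nek_ratio \<theta> (\<Lambda> i) (\<Lambda> j) (u i / u j)"
  have diag: "?C * ?I ^ ?l i * nek_ratio (\<lambda>y. 1 - y) (\<Lambda> i) (\<Lambda> i) 1 * pair_value V (\<Lambda> i) (\<Lambda> i) (u i / u i) =
      ?C * pair_head V 1 * ?I ^ ?l i * ?R i i" if "i \<in> {1..M}" for i
    using pair_value_self[of \<theta> V "\<Lambda> i", OF \<theta>] u[OF that] by (simp add: mult_ac)
  have off: "pair_value qpoch (\<Lambda> i) (\<Lambda> j) (u j / u i) *
      (pair_value V (\<Lambda> i) (\<Lambda> j) (u j / u i) * pair_value V (\<Lambda> j) (\<Lambda> i) (u i / u j)) =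
      ?B i j * (inverse p ^ ?l i * inverse p ^ ?l j) * (?R i j * ?R j i)" if "(i, j) \<in> index_pairs M" for i j
  proof -
    have ij: "i \<in> {1..M}" "j \<in> {1..M}" using that by (auto simp: index_pairs_def)
    show ?thesis
      using pair_value_reflect[of \<theta> V "u j / u i" "\<Lambda> i" "\<Lambda> j", OF \<theta>] ij u part by (simp add: power_add)
  qed
  have "(\<Prod>i=1..M. \<Prod>j=Suc i..M. pair_value qpoch (\<Lambda> i) (\<Lambda> j) (u j / u i)) =
      (\<Prod>(i, j)\<in>index_pairs M. pair_value qpoch (\<Lambda> i) (\<Lambda> j) (u j / u i))"
    by (simp add: index_pairs_Sigma prod.Sigma)
  then have "((\<Prod>i=1..M. ?C * ?I ^ ?l i * nek_ratio (\<lambda>y. 1 - y) (\<Lambda> i) (\<Lambda> i) 1) *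
        (\<Prod>i=1..M. \<Prod>j=Suc i..M. pair_value qpoch (\<Lambda> i) (\<Lambda> j) (u j / u i))) *
      (\<Prod>i=1..M. \<Prod>j=1..M. pair_value V (\<Lambda> i) (\<Lambda> j) (u j / u i)) =
      (\<Prod>i=1..M. ?C * ?I ^ ?l i * nek_ratio (\<lambda>y. 1 - y) (\<Lambda> i) (\<Lambda> i) 1 * pair_value V (\<Lambda> i) (\<Lambda> i) (u i / u i)) *
      (\<Prod>(i, j)\<in>index_pairs M. pair_value qpoch (\<Lambda> i) (\<Lambda> j) (u j / u i) *
         (pair_value V (\<Lambda> i) (\<Lambda> j) (u j / u i) * pair_value V (\<Lambda> j) (\<Lambda> i) (u i / u j)))"
    unfolding prod_square_pairs by (simp add: prod.distrib case_prod_unfold mult_ac)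
  also have "\<dots> = (\<Prod>i=1..M. ?C * pair_head V 1 * ?I ^ ?l i * ?R i i) *
      (\<Prod>(i, j)\<in>index_pairs M. ?B i j * (inverse p ^ ?l i * inverse p ^ ?l j) * (?R i j * ?R j i))"
  proof (rule arg_cong2[of _ _ _ _ "(*)"])
    show "(\<Prod>i=1..M. ?C * ?I ^ ?l i * nek_ratio (\<lambda>y. 1 - y) (\<Lambda> i) (\<Lambda> i) 1 * pair_value V (\<Lambda> i) (\<Lambda> i) (u i / u i)) =
        (\<Prod>i=1..M. ?C * pair_head V 1 * ?I ^ ?l i * ?R i i)"
      by (intro prod.cong refl diag)
    show "(\<Prod>(i, j)\<in>index_pairs M. pair_value qpoch (\<Lambda> i) (\<Lambda> j) (u j / u i) *
         (pair_value V (\<Lambda> i) (\<Lambda> j) (u j / u i) * pair_value V (\<Lambda> j) (\<Lambda> i) (u i / u j))) =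
      (\<Prod>(i, j)\<in>index_pairs M. ?B i j * (inverse p ^ ?l i * inverse p ^ ?l j) * (?R i j * ?R j i))"
      by (intro prod.cong refl) (simp only: split_paired_all prod.case off)
  qed
  also have "\<dots> = ?C ^ M * pair_head V 1 ^ M * (\<Prod>(i, j)\<in>index_pairs M. ?B i j) *
      ((\<Prod>i=1..M. ?I ^ ?l i) * (\<Prod>(i, j)\<in>index_pairs M. inverse p ^ ?l i * inverse p ^ ?l j)) *
      ((\<Prod>i=1..M. ?R i i) * (\<Prod>(i, j)\<in>index_pairs M. ?R i j * ?R j i))"
    by (simp add: prod.distrib case_prod_unfold mult_ac power_mult_distrib)
  \<comment> \<open>This is the origin of \<open>p powi (- (int M - 1))\<close> in
    \<open>inst_param\<close>: one inverse \<open>p\<close> per box and per pair containing its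
    partition.\<close>
  also have "(\<Prod>(i, j)\<in>index_pairs M. inverse p ^ ?l i * inverse p ^ ?l j) = (\<Prod>i=1..M. inverse p ^ ?l i) ^ (M - 1)"
    by (rule prod_pairs_mult) (use M in auto)
  also have "(\<Prod>i=1..M. ?I ^ ?l i) * (\<Prod>i=1..M. inverse p ^ ?l i) ^ (M - 1) = inst_param q t p r N M ^ k"
  proof -
    have "int M - 1 = int (M - 1)" using M by simp
    then have e1: "p powi (- (int M - 1)) = inverse p ^ (M - 1)"
      by (simp only: power_int_minus power_int_of_nat power_inverse)
    have e2: "(inverse p ^ k) ^ (M - 1) = (inverse p ^ (M - 1)) ^ k"
      by (simp add: mult.commute flip: power_mult)
    have e3: "(\<Prod>i=1..M. a ^ ?l i) = a ^ k" for a :: complex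
      unfolding k_def power_sum ..
    show ?thesis
      unfolding e3 e2 inst_param_def e1 by (simp only: power_mult_distrib)
  qed
  also have "(\<Prod>i=1..M. ?R i i) * (\<Prod>(i, j)\<in>index_pairs M. ?R i j * ?R j i) = (\<Prod>i=1..M. \<Prod>j=1..M. ?R i j)"
    by (rule prod_square_pairs[symmetric])
  finally show ?thesis by (simp only: mult.assoc)
qed

lemma nek_ratio_unit: "nek_ratio g \<xi> \<mu> (x / y) =
    nek g q t \<xi> \<mu> (p * q * (x / y) / t) / nek g q t \<xi> \<mu> (q * (x / y) / t)"
  by (simp add: nek_ratio_def)

lemma vev_summand:
  assumes M: "M \<ge> 1"
    and u: "\<And>i. i \<in> {1..M} \<Longrightarrow> u i \<noteq> 0" and v: "\<And>i. i \<in> {1..M} \<Longrightarrow> v i \<noteq> 0"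
    and generic_u: "\<And>i j (a :: int) (b :: int). i \<in> {1..M} \<Longrightarrow> j \<in> {1..M} \<Longrightarrow> i \<noteq> j \<Longrightarrow>
      u i / u j \<noteq> q powi a * t powi b"
    and \<Lambda>: "\<Lambda> \<in> partition_tuples M k"
  shows "vop_vev q t p (T_product q t p r N M u v \<Lambda>) = C_vev q t p M u * (inst_param q t p r N M ^ k *
    (\<Prod>i=1..M. \<Prod>j=1..M. nek_ratio (\<lambda>y. 1 - y) (\<Lambda> i) (\<Lambda> j) (u i / u j)))"
proof -
  have part: "\<And>i. i \<in> {1..M} \<Longrightarrow> is_partition (\<Lambda> i)" and k: "(\<Sum>i=1..M. sum_list (\<Lambda> i)) = k"
    using \<Lambda> by (auto simp: partition_tuples_def)
  have 1: "pair_value (\<lambda>_ _. 1) \<xi> \<mu> y = 1" "pair_head (\<lambda>_ _. 1) y = 1" for \<xi> \<mu> y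
    by (simp_all add: pair_value_def pair_factor_def pair_head_def)
  have C: "C_vev q t p M u = C_self q t p ^ M * (\<Prod>(i, j)\<in>index_pairs M. pair_head qpoch (u j / u i))"
    by (simp add: C_vev_def index_pairs_def pair_head_def)
  have T: "T_product q t p r N M u v \<Lambda> = VOp ((\<Prod>i=1..M. C_self q t p * (pstar q t p * p powi (N - 1) * r) ^ sum_list (\<Lambda> i) *
          nek_ratio (\<lambda>y. 1 - y) (\<Lambda> i) (\<Lambda> i) 1) *
        (\<Prod>i=1..M. \<Prod>j=Suc i..M. pair_value qpoch (\<Lambda> i) (\<Lambda> j) (u j / u i))) (\<lambda>m. \<Sum>i=1..M. T_modes (\<Lambda> i) (u i) m)"
    by (rule T_product_eq[OF u v generic_u part])
  show ?thesis
    using partition_function_summand[of "\<lambda>y. 1 - y" "\<lambda>_ _. 1" M u \<Lambda> N, OF _ u part M]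
    unfolding vop_vev_eq T C k 1 by simp
qed

section \<open>The trace of the product\<close>

definition trace_cont :: "complex \<Rightarrow> complex list \<Rightarrow> complex" where
  "trace_cont c bs = qpoch (c * Q) (Q # bs)"

text \<open>Only positive powers of \<open>Q\<close> can produce a zero. Hence the condition is also
  met at ratio 1, where a \<open>T\<close> is contracted with itself.\<close>

lemma pair_factor_trace_nonzero:
  assumes "\<And>a b c :: int. c > 0 \<Longrightarrow> z * (q powi a * t powi b * Q powi c) \<noteq> 1"
  shows "pair_factor trace_cont \<xi> \<mu> z \<noteq> 0"
proof -
  have "qpoch (t * z * Q) [q, t, Q] \<noteq> 0"
  proof (rule qpoch3_nonzero[OF _ norms(5)])
    fix a b c :: nat
    show "t * z * Q * q ^ a * t ^ b * Q ^ c \<noteq> 1"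
      using assms[of "int (Suc c)" "int a" "int (Suc b)"] unfolding power_int_of_nat by (simp add: mult_ac)
  qed
  moreover have "qpoch (t * z * Q) [Q, q, t] = qpoch (t * z * Q) [q, t, Q]"
    using norms by (intro qpoch_perm) auto
  moreover have "qpoch (z * nek_weight q t \<mu> \<xi> c * Q) [Q] \<noteq> 0" for c
  proof (rule qpoch1_nonzero[OF _ norms(5)])
    fix n :: nat
    obtain a b where "nek_weight q t \<mu> \<xi> c = q powi a * t powi b" using nek_weight_monomial by blast
    then show "z * nek_weight q t \<mu> \<xi> c * Q * Q ^ n \<noteq> 1"
      using assms[of "int (Suc n)" a b] unfolding power_int_of_nat by (simp add: mult_ac)
  qed
  ultimately show ?thesis
    unfolding pair_factor_def trace_cont_def by (simp del: qpoch.simps)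
qed

text \<open>The exponent of the trace is quadratic in the total modes, so every \<open>T\<close>
  meets every other in both orders and also itself; this gives the full square of pairs.\<close>

lemma vop_trace_eq:
  fixes u :: "nat \<Rightarrow> complex" and \<Lambda> :: "nat \<Rightarrow> nat list"
  assumes u: "\<And>i. i \<in> {1..M} \<Longrightarrow> u i \<noteq> 0"
    and part: "\<And>i. i \<in> {1..M} \<Longrightarrow> is_partition (\<Lambda> i)"
    and generic_u: "\<And>i j (a :: int) (b :: int) (c :: int). i \<in> {1..M} \<Longrightarrow> j \<in> {1..M} \<Longrightarrow> i \<noteq> j \<Longrightarrow>
      u i / u j \<noteq> q powi a * t powi b * Q powi c"
  shows "vop_trace q t p Q (VOp s (\<lambda>m. \<Sum>i=1..M. T_modes (\<Lambda> i) (u i) m)) =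
    s * ((\<Prod>i=1..M. \<Prod>j=1..M. pair_value trace_cont (\<Lambda> i) (\<Lambda> j) (u j / u i)) * inverse (qpoch Q [Q]))"
proof -
  let ?K = "\<lambda>m x :: complex. x ^ m / (1 - x ^ m)"
  let ?X = "VOp s (\<lambda>m. \<Sum>i=1..M. T_modes (\<Lambda> i) (u i) m)"
  define A where "A m = vmodes ?X (int m) * vmodes ?X (- int m) * comm q t p (int m)" for m
  have V: "exp_continues (ball 0 1) Q ?K (\<lambda>m. - (c ^ m / qpoch_denom bs m)) (trace_cont c bs)"
    if "\<And>b. b \<in> set bs \<Longrightarrow> norm b < 1" for c bs
    unfolding trace_cont_def by (rule exp_continues_qpoch_nome) (use that norms in auto)
  have nz: "u j / u i * (q powi a * t powi b * Q powi c) \<noteq> 1"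
    if ij: "i \<in> {1..M}" "j \<in> {1..M}" and c: "c > 0" for i j and a b c :: int
  proof (cases "i = j")
    case True
    then show ?thesis using generic_neq_1[of a b 0 c] u[OF ij(1)] c by simp
  next
    case False
    show ?thesis
    proof
      assume "u j / u i * (q powi a * t powi b * Q powi c) = 1"
      then have "u i / u j = q powi a * t powi b * Q powi c"
        using u[OF ij(1)] u[OF ij(2)] by (simp add: field_simps)
      then show False using generic_u[OF ij False] by blast
    qed
  qed
  have QQ: "qpoch Q [Q] \<noteq> 0"
  proof (rule qpoch1_nonzero[OF _ norms(5)])
    fix a show "Q * Q ^ a \<noteq> 1" using power_neq_1[of "Suc a" Q] norms by simp
  qed
  \<comment> \<open>The added coefficient 1/m encodes the bare oscillator trace: under this kernel
    it exponentiates to \<open>1 / qpoch x [x]\<close>, the inverse of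
    \<open>trace_cont 1 []\<close> at the nome \<open>Q\<close>.\<close>
  have "exp_continues (ball 0 1) Q ?K (\<lambda>m.
      (\<Sum>i=1..M. \<Sum>j=1..M. T_modes (\<Lambda> i) (u i) (int m) * T_modes (\<Lambda> j) (u j) (- int m) * comm q t p (int m)) +
      - (- (1 ^ m / qpoch_denom [] m)))
    ((\<Prod>i=1..M. \<Prod>j=1..M. pair_value trace_cont (\<Lambda> i) (\<Lambda> j) (u j / u i)) * inverse (trace_cont 1 []))"
  proof (intro exp_continues_add exp_continues_sum exp_continues_T_pair exp_continues_uminus V)
    fix i j assume ij: "i \<in> {1..M}" "j \<in> {1..M}"
    show "pair_factor trace_cont (\<Lambda> i) (\<Lambda> j) (u j / u i) \<noteq> 0"
      using nz[OF ij] by (intro pair_factor_trace_nonzero) auto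
    show "pair_factor trace_cont (\<Lambda> i) (\<Lambda> j) (q / t * (u j / u i)) \<noteq> 0"
    proof (rule pair_factor_trace_nonzero)
      fix a b c :: int assume "c > 0"
      then show "q / t * (u j / u i) * (q powi a * t powi b * Q powi c) \<noteq> 1"
        using nz[OF ij, of c "a + 1" "b - 1"] by (simp add: power_int_add power_int_diff mult_ac)
    qed
  qed (use u part QQ in \<open>auto simp: trace_cont_def\<close>)
  then have cont: "exp_continues (ball 0 1) Q ?K (\<lambda>m. A m + 1 / of_nat m)
    ((\<Prod>i=1..M. \<Prod>j=1..M. pair_value trace_cont (\<Lambda> i) (\<Lambda> j) (u j / u i)) * inverse (qpoch Q [Q]))"
  proof (rule exp_continues_cong)
    fix m :: nat
    have "(\<Sum>i=1..M. \<Sum>j=1..M. T_modes (\<Lambda> i) (u i) (int m) * T_modes (\<Lambda> j) (u j) (- int m) * comm q t p (int m)) = A m"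
      unfolding A_def vop.sel
      unfolding sum_product
      unfolding sum_distrib_right ..
    then show "(\<Sum>i=1..M. \<Sum>j=1..M. T_modes (\<Lambda> i) (u i) (int m) * T_modes (\<Lambda> j) (u j) (- int m) * comm q t p (int m)) +
      - (- (1 ^ m / qpoch_denom [] m)) = A m + 1 / of_nat m"
      by (simp add: qpoch_denom_def)
  qed (simp add: trace_cont_def)
  have "\<forall>\<^sub>F x in at 0. norm (1 * x :: complex) < 1"
    by (rule eventually_norm_mult_less_1)
  moreover have "\<forall>\<^sub>F x in at (0 :: complex). x \<noteq> 0"
    by (rule eventually_neq_at_within)
  ultimately have "\<forall>\<^sub>F x in at 0. summable (\<lambda>n. norm ((A (Suc n) + 1 / of_nat (Suc n)) * ?K (Suc n) x)) \<longrightarrow>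
      fock_trace (\<lambda>f. op_power x (\<lambda>g \<mu>. - degree_op q t p g \<mu>) (vop_apply q t p ?X f)) =
      s * exp (\<Sum>n. (A (Suc n) + 1 / of_nat (Suc n)) * ?K (Suc n) x)"
  proof eventually_elim
    case (elim x)
    have x: "norm x < 1" "\<And>b. b \<in> set [x] \<Longrightarrow> norm b < 1" using elim by auto
    have l: "x ^ Suc n / qpoch_denom [x] (Suc n) = 1 / of_nat (Suc n) * ?K (Suc n) x" for n
      by (simp add: qpoch_denom_def)
    have qx: "qpoch x [x] = exp (- (\<Sum>n. x ^ Suc n / qpoch_denom [x] (Suc n)))"
      by (rule qpoch_eq_exp[OF x(2,1)])
    have s1: "summable (\<lambda>n. norm (1 / of_nat (Suc n) * ?K (Suc n) x))"
      unfolding l[symmetric] by (rule qpoch_log_summable[OF x(2,1)])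
    show ?case
    proof
      assume s2: "summable (\<lambda>n. norm ((A (Suc n) + 1 / of_nat (Suc n)) * ?K (Suc n) x))"
      have eq: "A (Suc n) * ?K (Suc n) x =
          (A (Suc n) + 1 / of_nat (Suc n)) * ?K (Suc n) x - 1 / of_nat (Suc n) * ?K (Suc n) x" for n
        by (simp only: distrib_right add_diff_cancel_right')
      have s3: "summable (\<lambda>n. norm (A (Suc n) * ?K (Suc n) x))"
        by (rule summable_comparison_test'[OF summable_add[OF s2 s1], where N = 0])
           (simp only: real_norm_def abs_norm_cancel eq norm_triangle_ineq4)
      have "exp (\<Sum>n. (A (Suc n) + 1 / of_nat (Suc n)) * ?K (Suc n) x) =
          exp ((\<Sum>n. A (Suc n) * ?K (Suc n) x) + (\<Sum>n. 1 / of_nat (Suc n) * ?K (Suc n) x))"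
        using suminf_add[OF summable_norm_cancel[OF s3] summable_norm_cancel[OF s1]]
        by (simp only: distrib_right)
      also have "\<dots> = exp (\<Sum>n. A (Suc n) * ?K (Suc n) x) / qpoch x [x]"
        unfolding qx l by (simp only: exp_add exp_minus divide_inverse inverse_inverse_eq)
      finally show "fock_trace (\<lambda>f. op_power x (\<lambda>g \<mu>. - degree_op q t p g \<mu>) (vop_apply q t p ?X f)) =
          s * exp (\<Sum>n. (A (Suc n) + 1 / of_nat (Suc n)) * ?K (Suc n) x)"
        using fock_trace_vop[of x ?X] elim s3 unfolding A_def[symmetric] by simp
    qed
  qed
  then show ?thesis
    unfolding vop_trace_def using norms
    by (intro mero_cont_eqI[OF _ _ _ _ cont]) auto
qed


lemma qpoch_nome_perm: "qpoch z [Q, q, t] = qpoch z [q, t, Q]"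
  using norms by (intro qpoch_perm) auto

lemma trace_cont_qt: "trace_cont z [q, t] = qpoch (z * Q) [q, t, Q]"
  unfolding trace_cont_def qpoch_nome_perm ..

lemma qpoch_trace_cont: "qpoch z [q, t] * trace_cont z [q, t] = qpoch z [q, t, Q]"
  unfolding trace_cont_def qpoch_nome_perm[symmetric]
  using norms by (intro qpoch_Cons_shift[symmetric]) auto

text \<open>The vacuum contraction for i < j supplies the power-0 factors in \<open>Q\<close> that
  \<open>trace_cont\<close> omits, completing the first half of each \<open>Gamma3\<close>; the
  value at \<open>1 / y\<close> is the second half.\<close>

lemma pair_head_trace:
  "pair_head qpoch y * pair_head trace_cont y * pair_head trace_cont (1 / y) =
   Gamma3 (t / p * y) q t Q * Gamma3 (p * q * y) q t Q / (Gamma3 (t * y) q t Q * Gamma3 (q * y) q t Q)"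
proof -
  have args: "q * t * Q / (t / p * y) = p * q * (1 / y) * Q" "q * t * Q / (p * q * y) = t / p * (1 / y) * Q"
    "q * t * Q / (t * y) = q * (1 / y) * Q" "q * t * Q / (q * y) = t * (1 / y) * Q"
    by simp_all
  show ?thesis
    unfolding pair_head_def Gamma3_def args trace_cont_qt[symmetric]
    unfolding qpoch_trace_cont[symmetric]
    by (simp only: divide_inverse inverse_mult_distrib mult_ac)
qed

text \<open>On the diagonal no vacuum contraction supplies the power-0 factors, so the double
  Pochhammer symbols have to be divided out of the \<open>Gamma3\<close> quotient.\<close>

lemma pair_head_trace_1:
  "pair_head trace_cont 1 = qpoch t [q, t] * Gamma3 (t / p) q t Q / (qpoch (t / p) [q, t] * Gamma3 t q t Q)"
proof -
  have args: "q * t * Q / (t / p) = p * q * Q" "q * t * Q / t = q * Q"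
    by simp_all
  have nz: "qpoch t [q, t] \<noteq> 0" "qpoch (t / p) [q, t] \<noteq> 0"
  proof -
    show "qpoch t [q, t] \<noteq> 0"
    proof (rule qpoch2_nonzero)
      fix a b :: nat show "t * q ^ a * t ^ b \<noteq> 1"
        using generic_neq_1[of "int a" "int (Suc b)" 0 0] unfolding power_int_of_nat by (simp add: mult_ac)
    qed
    show "qpoch (t / p) [q, t] \<noteq> 0"
    proof (rule qpoch2_nonzero)
      fix a b :: nat show "t / p * q ^ a * t ^ b \<noteq> 1"
        using generic_neq_1[of "int a" "int (Suc b)" "-1" 0] unfolding power_int_of_nat
        by (simp add: power_int_minus divide_inverse mult_ac)
    qed
  qed
  show ?thesis
    unfolding pair_head_def Gamma3_def args trace_cont_qt[symmetric] mult_1_right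
    unfolding qpoch_trace_cont[symmetric]
    using nz by (simp del: qpoch.simps)
qed

lemma trace_summand:
  assumes M: "M \<ge> 1"
    and u: "\<And>i. i \<in> {1..M} \<Longrightarrow> u i \<noteq> 0" and v: "\<And>i. i \<in> {1..M} \<Longrightarrow> v i \<noteq> 0"
    and generic_u: "\<And>i j (a :: int) (b :: int) (c :: int). i \<in> {1..M} \<Longrightarrow> j \<in> {1..M} \<Longrightarrow> i \<noteq> j \<Longrightarrow>
      u i / u j \<noteq> q powi a * t powi b * Q powi c"
    and \<Lambda>: "\<Lambda> \<in> partition_tuples M k"
  shows "vop_trace q t p Q (T_product q t p r N M u v \<Lambda>) = C_trace q t p Q M u * (inst_param q t p r N M ^ k *
    (\<Prod>i=1..M. \<Prod>j=1..M. nek_ratio (theta Q) (\<Lambda> i) (\<Lambda> j) (u i / u j)))"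
proof -
  have part: "\<And>i. i \<in> {1..M} \<Longrightarrow> is_partition (\<Lambda> i)" and k: "(\<Sum>i=1..M. sum_list (\<Lambda> i)) = k"
    using \<Lambda> by (auto simp: partition_tuples_def)
  have generic_u0: "u i / u j \<noteq> q powi a * t powi b"
    if "i \<in> {1..M}" "j \<in> {1..M}" "i \<noteq> j" for i j and a b :: int
    using generic_u[OF that, of a b 0] by simp
  \<comment> \<open>Splitting off the power-0 factor of the first half leaves products over positive
    powers of \<open>Q\<close> at \<open>z\<close> and at \<open>1 / z\<close>.\<close>
  have \<theta>: "theta Q z = (1 - z) * trace_cont z [] * trace_cont (1 / z) []" for z
    using qpoch_Cons_shift[of "[]" Q z] norms by (simp add: theta_def trace_cont_def del: qpoch.simps(2))
  have C: "C_trace q t p Q M u = C_self q t p ^ M * pair_head trace_cont 1 ^ M *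
    (\<Prod>(i, j)\<in>index_pairs M. pair_head qpoch (u j / u i) * pair_head trace_cont (u j / u i) * pair_head trace_cont (u i / u j)) *
    inverse (qpoch Q [Q])"
  proof -
    have E: "pair_head qpoch (u j / u i) * pair_head trace_cont (u j / u i) * pair_head trace_cont (u i / u j) =
      Gamma3 (t / p * (u j / u i)) q t Q * Gamma3 (p * q * (u j / u i)) q t Q /
      (Gamma3 (t * (u j / u i)) q t Q * Gamma3 (q * (u j / u i)) q t Q)" for i j
      using pair_head_trace[of "u j / u i"] by simp
    show ?thesis
      unfolding C_trace_def index_pairs_def pair_head_trace_1 E
      by (simp only: inverse_eq_divide mult_ac)
  qed
  let ?s = "(\<Prod>i=1..M. C_self q t p * (pstar q t p * p powi (N - 1) * r) ^ sum_list (\<Lambda> i) *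
          nek_ratio (\<lambda>y. 1 - y) (\<Lambda> i) (\<Lambda> i) 1) *
        (\<Prod>i=1..M. \<Prod>j=Suc i..M. pair_value qpoch (\<Lambda> i) (\<Lambda> j) (u j / u i))"
  have T: "T_product q t p r N M u v \<Lambda> = VOp ?s (\<lambda>m. \<Sum>i=1..M. T_modes (\<Lambda> i) (u i) m)"
    by (rule T_product_eq[OF u v generic_u0 part])
  have "vop_trace q t p Q (T_product q t p r N M u v \<Lambda>) =
      ?s * ((\<Prod>i=1..M. \<Prod>j=1..M. pair_value trace_cont (\<Lambda> i) (\<Lambda> j) (u j / u i)) * inverse (qpoch Q [Q]))"
    unfolding T by (rule vop_trace_eq[OF u part generic_u])
  also have "\<dots> = (?s * (\<Prod>i=1..M. \<Prod>j=1..M. pair_value trace_cont (\<Lambda> i) (\<Lambda> j) (u j / u i))) * inverse (qpoch Q [Q])"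
    by (simp only: mult.assoc)
  also have "?s * (\<Prod>i=1..M. \<Prod>j=1..M. pair_value trace_cont (\<Lambda> i) (\<Lambda> j) (u j / u i)) =
    C_self q t p ^ M * pair_head trace_cont 1 ^ M *
    (\<Prod>(i, j)\<in>index_pairs M. pair_head qpoch (u j / u i) * pair_head trace_cont (u j / u i) * pair_head trace_cont (u i / u j)) *
    (inst_param q t p r N M ^ (\<Sum>i=1..M. sum_list (\<Lambda> i)) *
     (\<Prod>i=1..M. \<Prod>j=1..M. nek_ratio (theta Q) (\<Lambda> i) (\<Lambda> j) (u i / u j)))"
    by (rule partition_function_summand[where \<theta> = "theta Q" and V = trace_cont, OF \<theta> u part M])
  finally show ?thesis
    unfolding C k by (simp only: mult_ac)
qed

end

theorem mainTheorem18:
  fixes q t p Q r :: complex and N :: int and M :: nat and u v :: "nat \<Rightarrow> complex"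
  assumes norms: "norm q < 1" "norm t < 1" "norm p < 1" "norm (p * q / t) < 1" "norm Q < 1"
    and generic: "generic_params q t p Q"
    and root: "r\<^sup>2 = t / q"
    and M: "M \<ge> 1"
    and u: "\<And>i. i \<in> {1..M} \<Longrightarrow> u i \<noteq> 0"
    and v: "\<And>i. i \<in> {1..M} \<Longrightarrow> v i \<noteq> 0"
    and u_generic: "\<And>i j (a :: int) (b :: int). i \<in> {1..M} \<Longrightarrow> j \<in> {1..M} \<Longrightarrow> i \<noteq> j \<Longrightarrow>
      u i / u j \<noteq> q powi a * t powi b"
  shows
    "vev_series q t p r N M u v =
       fps_const (C_vev q t p M u) *
       Abs_fps (\<lambda>k. inst_param q t p r N M ^ k * chi_genus q t p M u k)
     \<and> ((\<forall>i\<in>{1..M}. u i * v i = u 1 * v 1) \<and>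
        (\<forall>i\<in>{1..M}. \<forall>j\<in>{1..M}. \<forall>a b c :: int. i \<noteq> j \<longrightarrow>
           u i / u j \<noteq> q powi a * t powi b * Q powi c) \<longrightarrow>
        trace_series q t p r Q N M u v =
          fps_const (C_trace q t p Q M u) *
          Abs_fps (\<lambda>k. inst_param q t p r N M ^ k * elliptic_genus q t p Q M u k))"
proof -
  interpret refined_params q t p Q r
    by unfold_locales (fact norms generic root)+
  have nek_sum: "nek_sum g q t p M u k =
      (\<Sum>\<Lambda>\<in>partition_tuples M k. \<Prod>i=1..M. \<Prod>j=1..M. nek_ratio g (\<Lambda> i) (\<Lambda> j) (u i / u j))" for g k
    by (simp only: nek_sum_def nek_ratio_unit)
  show ?thesis
  proof (intro conjI impI)
    show "vev_series q t p r N M u v = fps_const (C_vev q t p M u) *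
       Abs_fps (\<lambda>k. inst_param q t p r N M ^ k * chi_genus q t p M u k)"
    proof (rule fps_ext)
      fix k
      have "(\<Sum>\<Lambda>\<in>partition_tuples M k. vop_vev q t p (T_product q t p r N M u v \<Lambda>)) =
          C_vev q t p M u * (inst_param q t p r N M ^ k * chi_genus q t p M u k)"
        unfolding chi_genus_def nek_sum sum_distrib_left
        using M u v u_generic by (intro sum.cong refl vev_summand) auto
      then show "fps_nth (vev_series q t p r N M u v) k = fps_nth (fps_const (C_vev q t p M u) *
       Abs_fps (\<lambda>k. inst_param q t p r N M ^ k * chi_genus q t p M u k)) k"
        by (simp add: vev_series_def)
    qed
  next
    assume *: "(\<forall>i\<in>{1..M}. u i * v i = u 1 * v 1) \<and>
        (\<forall>i\<in>{1..M}. \<forall>j\<in>{1..M}. \<forall>a b c :: int. i \<noteq> j \<longrightarrow>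
           u i / u j \<noteq> q powi a * t powi b * Q powi c)"
    then have generic_u: "\<And>i j (a :: int) (b :: int) (c :: int). i \<in> {1..M} \<Longrightarrow> j \<in> {1..M} \<Longrightarrow> i \<noteq> j \<Longrightarrow>
      u i / u j \<noteq> q powi a * t powi b * Q powi c"
      by blast
    show "trace_series q t p r Q N M u v = fps_const (C_trace q t p Q M u) *
          Abs_fps (\<lambda>k. inst_param q t p r N M ^ k * elliptic_genus q t p Q M u k)"
    proof (rule fps_ext)
      fix k
      have "(\<Sum>\<Lambda>\<in>partition_tuples M k. vop_trace q t p Q (T_product q t p r N M u v \<Lambda>)) =
          C_trace q t p Q M u * (inst_param q t p r N M ^ k * elliptic_genus q t p Q M u k)"
        unfolding elliptic_genus_def nek_sum sum_distrib_left
        by (intro sum.cong refl trace_summand[OF M u v generic_u])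
      then show "fps_nth (trace_series q t p r Q N M u v) k = fps_nth (fps_const (C_trace q t p Q M u) *
          Abs_fps (\<lambda>k. inst_param q t p r N M ^ k * elliptic_genus q t p Q M u k)) k"
        by (simp add: trace_series_def)
    qed
  qed
qed

end
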